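(* Let $n\ge 1$. (1) For every domain $\Omega\subset\mathbb C^n$ and every $N>0$, $$PSH(\Omega)\subset BUO_{\rm loc}(\Omega,\mathcal P_N)\subset BMO_{\rm loc}(\Omega,\mathcal P_N).$$ (2) For $n\ge 2$, $PSH(\mathbb D^n)\nsubseteq BMO_{\rm loc}(\mathbb D^n,\mathcal P)$, where $\mathbb D^n$ is the unit polydisc in $\mathbb C^n$. (3) $\mathcal L\subset BUO(\mathbb C^n,\mathcal P)$; more precisely, for every $\phi\in PSH(\mathbb C^n)$ for which there is a constant $c$ with $$\phi(z_1,\dots,z_n)\le c+\max_{1\le j\le n}\log(1+|z_j|)\qquad\text{for all }(z_1,\dots,z_n)\in\mathbb C^n,$$ one has $UO_P(\phi)<3^n$ for all polydiscs $P$ in $\mathbb C^n$.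
   Context: $PSH(\Omega)$ is the set of plurisubharmonic functions on the domain $\Omega\subset\mathbb C^n$ (not identically $-\infty$, so contained in $L^1_{\rm loc}(\Omega)$). $|S|$ and $\int_S$ denote Lebesgue measure and Lebesgue integral on $\mathbb C^n$, and $\phi_S:=\frac1{|S|}\int_S\phi$. For a relatively compact open set $S\subset\Omega$ put $$MO_S(\phi):=\frac1{|S|}\int_S|\phi-\phi_S|,\qquad UO_S(\phi):=\frac1{|S|}\int_S\bigl|\phi-\sup_S\phi\bigr|=\sup_S\phi-\phi_S .$$ For a family $\mathcal S$ of relatively compact open subsets of $\Omega$, $BMO(\Omega,\mathcal S)$ (resp. $BUO(\Omega,\mathcal S)$) is the set of $\phi\in L^1_{\rm loc}(\Omega)$ with $\sup_{S\in\mathcal S}MO_S(\phi)<\infty$ (resp. $\sup_{S\in\mathcal S}UO_S(\phi)<\infty$). For open $\Omega_0\subset\subset\Omega$, $\mathcal S|_{\Omega_0}$ is the set of all $S\in\mathcal S$ that are relatively compact in $\Omega_0$; $BMO_{\rm loc}(\Omega,\mathcal S)$ (resp. $BUO_{\rm loc}(\Omega,\mathcal S)$) is the set of functions on $\Omega$ which belong to $BMO(\Omega_0,\mathcal S|_{\Omega_0})$ (resp. $BUO(\Omega_0,\mathcal S|_{\Omega_0})$) for every open $\Omega_0\subset\subset\Omega$. A polydisc is a set $\{z\in\mathbb C^n:|z_j-\hat z_j|<r_j,\ 1\le j\le n\}$ with $\hat z\in\mathbb C^n$ and polyradius $(r_1,\dots,r_n)$, $r_j>0$. $\mathcal P=\mathcal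 P(\Omega)$ is the set of polydiscs relatively compact in $\Omega$. $\mathcal P_N$ is the set of polydiscs $P\subset\subset\Omega$ of finite type $N$, i.e. with $\max_j\{r_j\}\le\min_j\{r_j^{1/N}\}$. The Lelong class is $\mathcal L=\{u\in PSH(\mathbb C^n):\limsup_{|z|\to\infty}(u(z)-\log|z|)<\infty\}$. *)

theory Defs
  imports "HOL-Analysis.Analysis"
begin

text \<open>
  Functions on \<open>\<Omega> \<subseteq> \<complex>\<^sup>n\<close> are modelled as total functions \<open>complex ^ 'n \<Rightarrow> ereal\<close> of which only the
  values on \<open>\<Omega>\<close> matter; the value \<open>-\<infinity>\<close> is needed for plurisubharmonic functions.
\<close>

definition relatively_compact_in :: "'a::topological_space set \<Rightarrow> 'a set \<Rightarrow> bool"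
    (infix \<open>\<subset>\<subset>\<close> 50) where
  "S \<subset>\<subset> \<Omega> \<longleftrightarrow> compact (closure S) \<and> closure S \<subseteq> \<Omega>"

definition is_domain :: "(complex ^ 'n) set \<Rightarrow> bool" where
  "is_domain \<Omega> \<longleftrightarrow> open \<Omega> \<and> connected \<Omega> \<and> \<Omega> \<noteq> {}"


subsection \<open>Integrals and means of extended real functions\<close>

text \<open>
  The integral of an extended real function is \<open>\<integral> f\<^sup>+ - \<integral> f\<^sup>-\<close>; note that \<open>e2ennreal\<close> sends negative
  arguments to \<open>0\<close>. It is meaningful when at least one of the two parts is finite, which is the
  case for locally integrable functions on relatively compact sets and for functions that are
  upper semicontinuous and \<open>< \<infinity>\<close> on a circle.
\<close>

definition ereal_integral :: "'a measure \<Rightarrow> 'a set \<Rightarrow> ('a \<Rightarrow> ereal) \<Rightarrow> ereal" where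
  "ereal_integral M S f =
     enn2ereal (\<integral>\<^sup>+x\<in>S. e2ennreal (f x) \<partial>M) - enn2ereal (\<integral>\<^sup>+x\<in>S. e2ennreal (- f x) \<partial>M)"

definition avg :: "(complex ^ 'n) set \<Rightarrow> (complex ^ 'n \<Rightarrow> ereal) \<Rightarrow> ereal" where
  "avg S \<phi> = ereal_integral lebesgue S \<phi> / ereal (measure lebesgue S)"

definition circle_mean :: "(complex \<Rightarrow> ereal) \<Rightarrow> complex \<Rightarrow> real \<Rightarrow> ereal" where
  "circle_mean u a r =
     ereal_integral lborel {0..2 * pi} (\<lambda>\<theta>. u (a + of_real r * cis \<theta>)) / ereal (2 * pi)"


subsection \<open>Plurisubharmonic functions and the Lelong class\<close>

definition usc_on :: "'a::topological_space set \<Rightarrow> ('a \<Rightarrow> ereal) \<Rightarrow> bool" where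
  "usc_on U u \<longleftrightarrow> (\<forall>c. openin (top_of_set U) {z \<in> U. u z < c})"

text \<open>Here a subharmonic function may be identically \<open>-\<infinity>\<close> on components of \<open>U\<close>.\<close>

definition subharmonic_on :: "complex set \<Rightarrow> (complex \<Rightarrow> ereal) \<Rightarrow> bool" where
  "subharmonic_on U u \<longleftrightarrow>
     usc_on U u \<and> (\<forall>z\<in>U. u z < \<infinity>) \<and>
     (\<forall>a r. r > 0 \<and> cball a r \<subseteq> U \<longrightarrow> u a \<le> circle_mean u a r)"

definition PSH :: "(complex ^ 'n) set \<Rightarrow> (complex ^ 'n \<Rightarrow> ereal) set" where
  "PSH \<Omega> = {\<phi>. usc_on \<Omega> \<phi> \<and> (\<forall>z\<in>\<Omega>. \<phi> z < \<infinity>) \<and> (\<exists>z\<in>\<Omega>. \<phi> z \<noteq> -\<infinity>) \<and>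
     (\<forall>a w. subharmonic_on {t. a + t *s w \<in> \<Omega>} (\<lambda>t. \<phi> (a + t *s w)))}"

definition Lelong_class :: "(complex ^ 'n \<Rightarrow> ereal) set" where
  "Lelong_class = {u \<in> PSH UNIV. Limsup at_infinity (\<lambda>z. u z - ereal (ln (norm z))) < \<infinity>}"


subsection \<open>Bounded mean oscillation and bounded upper oscillation\<close>

definition L1_loc :: "(complex ^ 'n) set \<Rightarrow> (complex ^ 'n \<Rightarrow> ereal) set" where
  "L1_loc \<Omega> = {\<phi>. \<phi> \<in> borel_measurable (lebesgue_on \<Omega>) \<and>
     (\<forall>K. compact K \<and> K \<subseteq> \<Omega> \<longrightarrow> (\<integral>\<^sup>+z\<in>K. e2ennreal \<bar>\<phi> z\<bar> \<partial>lebesgue) < \<infinity>)}"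

definition MO :: "(complex ^ 'n) set \<Rightarrow> (complex ^ 'n \<Rightarrow> ereal) \<Rightarrow> ennreal" where
  "MO S \<phi> = (\<integral>\<^sup>+z\<in>S. e2ennreal \<bar>\<phi> z - avg S \<phi>\<bar> \<partial>lebesgue) / emeasure lebesgue S"

definition UO :: "(complex ^ 'n) set \<Rightarrow> (complex ^ 'n \<Rightarrow> ereal) \<Rightarrow> ennreal" where
  "UO S \<phi> = (\<integral>\<^sup>+z\<in>S. e2ennreal \<bar>\<phi> z - (SUP w\<in>S. \<phi> w)\<bar> \<partial>lebesgue) / emeasure lebesgue S"

definition BMO :: "(complex ^ 'n) set \<Rightarrow> (complex ^ 'n) set set \<Rightarrow> (complex ^ 'n \<Rightarrow> ereal) set" where
  "BMO \<Omega> \<S> = {\<phi> \<in> L1_loc \<Omega>. (SUP S\<in>\<S>. MO S \<phi>) < \<infinity>}"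

definition BUO :: "(complex ^ 'n) set \<Rightarrow> (complex ^ 'n) set set \<Rightarrow> (complex ^ 'n \<Rightarrow> ereal) set" where
  "BUO \<Omega> \<S> = {\<phi> \<in> L1_loc \<Omega>. (SUP S\<in>\<S>. UO S \<phi>) < \<infinity>}"

definition BMO_loc :: "(complex ^ 'n) set \<Rightarrow> (complex ^ 'n) set set \<Rightarrow> (complex ^ 'n \<Rightarrow> ereal) set" where
  "BMO_loc \<Omega> \<S> = {\<phi>. \<forall>\<Omega>\<^sub>0. open \<Omega>\<^sub>0 \<and> \<Omega>\<^sub>0 \<subset>\<subset> \<Omega> \<longrightarrow> \<phi> \<in> BMO \<Omega>\<^sub>0 {S \<in> \<S>. S \<subset>\<subset> \<Omega>\<^sub>0}}"

definition BUO_loc :: "(complex ^ 'n) set \<Rightarrow> (complex ^ 'n) set set \<Rightarrow> (complex ^ 'n \<Rightarrow> ereal) set" where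
  "BUO_loc \<Omega> \<S> = {\<phi>. \<forall>\<Omega>\<^sub>0. open \<Omega>\<^sub>0 \<and> \<Omega>\<^sub>0 \<subset>\<subset> \<Omega> \<longrightarrow> \<phi> \<in> BUO \<Omega>\<^sub>0 {S \<in> \<S>. S \<subset>\<subset> \<Omega>\<^sub>0}}"


subsection \<open>Polydiscs\<close>

definition polydisc :: "complex ^ 'n \<Rightarrow> real ^ 'n \<Rightarrow> (complex ^ 'n) set" where
  "polydisc a r = {z. \<forall>j. cmod (z $ j - a $ j) < r $ j}"

definition polydiscs :: "(complex ^ 'n) set \<Rightarrow> (complex ^ 'n) set set" where
  "polydiscs \<Omega> = {polydisc a r |a r. (\<forall>j. 0 < r $ j) \<and> polydisc a r \<subset>\<subset> \<Omega>}"

definition polydiscs_type :: "real \<Rightarrow> (complex ^ 'n) set \<Rightarrow> (complex ^ 'n) set set" where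
  "polydiscs_type N \<Omega> = {polydisc a r |a r. (\<forall>j. 0 < r $ j) \<and> polydisc a r \<subset>\<subset> \<Omega> \<and>
     (MAX j. r $ j) \<le> (MIN j. (r $ j) powr (1 / N))}"

end

theory Submission
  imports Defs "HOL-Complex_Analysis.Cauchy_Integral_Formula" "HOL-Real_Asymp.Real_Asymp"
begin

text \<open>
  Let \<open>h t\<close> be the supremum of a plurisubharmonic \<open>\<phi>\<close> over the closed polydisc with centre \<open>a\<close> and
  polyradius \<open>t r\<close>, and let \<open>b\<close> be a point where \<open>h (1/3)\<close> is attained. The mean of \<open>\<phi>\<close> over the
  polydisc about \<open>b\<close> of polyradius \<open>4r/3\<close> is at least \<open>\<phi> b\<close>, and this polydisc lies between those
  of polyradii \<open>r\<close> and \<open>5r/3\<close> about \<open>a\<close>; hence \<open>UO \<phi> \<le> (16/9)^n (h (5/3) - h (1/3))\<close>. By the three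
  circles theorem \<open>h\<close> is a convex function of \<open>ln t\<close>, so the difference is controlled by the slope
  at larger scales. Logarithmic growth makes the slope at most \<open>1\<close>, which gives \<open>UO \<phi> \<le> (16/9)^n ln 5 < 3^n\<close>;
  for polydiscs of finite type the slope is at most a constant times \<open>ln (min r) / ln (max r)\<close>.
  The counterexample on the unit polydisc is \<open>- sqrt (ln |z\<^sub>i| ln |z\<^sub>j|)\<close>, whose derivative in \<open>ln |z\<^sub>i|\<close> is
  unbounded as \<open>z\<^sub>j\<close> tends to \<open>0\<close>.
\<close>

subsection \<open>Rotation invariance of Lebesgue measure\<close>

text \<open>The mean value inequality bounds a mean from below by the value at the centre, and
  \<phi> may be -\<infinity> at \<open>a\<close>. Recentring at \<open>b\<close> costs only the
  volume ratio \<open>(4/3)^(2n)\<close>, since the nonnegative function \<open>C - \<phi>\<close>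
  may be integrated over a larger set. With \<open>s\<close> in place of 1/3 the bound would read
  \<open>(1+s)^(2n) * ln ((1+2s)/s)\<close>; \<open>s = 1/3\<close> pushes it below
  \<open>3^n\<close>, the tightest case being n = 1, where \<open>16/9 * ln 5\<close> is about 2.86.
  On a general domain the scales \<open>t\<close> stop once the largest radius reaches a fixed size,
  so the logarithmic room for the slope is about \<open>ln (1 / max r)\<close>, while the supremum
  near \<open>a\<close> may have dropped by a multiple of \<open>ln (1 / min r)\<close>. Type N says
  precisely that the second logarithm is at most N times the first. The counterexample exploits
  polydiscs where this quotient is unbounded: on \<open>|z_i| < 1/2\<close>,
  \<open>|z_j| < exp (-T)\<close> it oscillates in \<open>z_i\<close> by an amount of order
  \<open>sqrt T\<close>.\<close>

lemma nn_integral_lborel_translate: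
  fixes f :: "'a::euclidean_space \<Rightarrow> ennreal"
  assumes [measurable]: "f \<in> borel_measurable borel"
  shows "(\<integral>\<^sup>+x. f (c + x) \<partial>lborel) = (\<integral>\<^sup>+x. f x \<partial>lborel)"
  by (subst (2) lborel_distr_plus[of c, symmetric]) (simp add: nn_integral_distr)

text \<open>Translation invariance determines Lebesgue measure up to a factor, and the unit ball,
  which is preserved by orthogonal maps, fixes the factor.\<close>

lemma emeasure_lborel_vimage_orthogonal:
  fixes f :: "'a::euclidean_space \<Rightarrow> 'a"
  assumes f: "orthogonal_transformation f" and A [measurable]: "A \<in> sets borel"
  shows "emeasure lborel (f -` A) = emeasure lborel A"
proof -
  have lin: "linear f" and surj: "surj f"
    using f by (auto simp: orthogonal_transformation_def orthogonal_transformation_surj)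
  have [measurable]: "f \<in> borel_measurable borel"
    using lin by (intro borel_measurable_continuous_onI linear_continuous_on) (simp add: linear_conv_bounded_linear)
  have vim [measurable]: "f -` C \<in> sets borel" if "C \<in> sets borel" for C
    using that by (metis measurable_sets_borel \<open>f \<in> borel_measurable borel\<close>)
  define B where "B = (ball 0 1 :: 'a set)"
  have [measurable]: "B \<in> sets borel" by (simp add: B_def)
  have fB: "f -` B = B"
    using f by (auto simp: B_def orthogonal_transformation_norm)
  have tr: "(\<integral>\<^sup>+x. indicator A (f x) * indicator B (f x + y) \<partial>lborel)
          = (\<integral>\<^sup>+x. indicator A (f x - y) * indicator B (f x) \<partial>lborel)" for y :: 'a
  proof -
    obtain c where c: "f c = y" using surj by (metis surjD)
    show ?thesis
      using nn_integral_lborel_translate[of "\<lambda>x. indicator A (f x - y) * indicator B (f x)" c]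
      by (simp add: linear_add[OF lin] c add.commute)
  qed
  have refl: "(\<integral>\<^sup>+y. indicator A (z - y) \<partial>lborel) = emeasure lborel A" for z :: 'a
  proof -
    have "emeasure lborel A = (\<integral>\<^sup>+x. indicator A x \<partial>lborel)" by simp
    also have "\<dots> = (\<integral>\<^sup>+y. indicator A (z - y) \<partial>lborel)"
      by (subst lborel_affine[of "-1" z]) (simp_all add: emeasure_density nn_integral_density nn_integral_distr)
    finally show ?thesis by simp
  qed
  have "emeasure lborel (f -` A) * emeasure lborel B
      = (\<integral>\<^sup>+x. indicator A (f x) * emeasure lborel B \<partial>lborel)"
    by (subst nn_integral_multc) (auto simp flip: nn_integral_indicator simp: indicator_vimage)
  also have "\<dots> = (\<integral>\<^sup>+x. (\<integral>\<^sup>+y. indicator A (f x) * indicator B (f x + y) \<partial>lborel) \<partial>lborel)"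
    by (intro nn_integral_cong)
       (simp add: nn_integral_cmult nn_integral_lborel_translate[of "indicator B"])
  also have "\<dots> = (\<integral>\<^sup>+y. (\<integral>\<^sup>+x. indicator A (f x) * indicator B (f x + y) \<partial>lborel) \<partial>lborel)"
    by (subst lborel_pair.Fubini') (auto simp: case_prod_unfold)
  also have "\<dots> = (\<integral>\<^sup>+y. (\<integral>\<^sup>+x. indicator A (f x - y) * indicator B (f x) \<partial>lborel) \<partial>lborel)"
    by (simp add: tr)
  also have "\<dots> = (\<integral>\<^sup>+x. (\<integral>\<^sup>+y. indicator A (f x - y) * indicator B (f x) \<partial>lborel) \<partial>lborel)"
    by (subst lborel_pair.Fubini') (auto simp: case_prod_unfold)
  also have "\<dots> = (\<integral>\<^sup>+x. emeasure lborel A * indicator B (f x) \<partial>lborel)"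
    by (simp add: nn_integral_multc refl)
  also have "\<dots> = emeasure lborel A * emeasure lborel (f -` B)"
    by (subst nn_integral_cmult) (auto simp flip: nn_integral_indicator simp: indicator_vimage)
  finally have eq: "emeasure lborel (f -` A) * emeasure lborel B = emeasure lborel A * emeasure lborel B"
    by (simp add: fB)
  moreover have "unit_ball_vol (real DIM('a)) \<noteq> 0"
    using unit_ball_vol_pos[of "real DIM('a)"] less_irrefl[of "0::real"] by (metis of_nat_0_le_iff)
  then have "emeasure lborel B \<noteq> 0" "emeasure lborel B \<noteq> \<infinity>"
    by (simp_all add: B_def emeasure_ball)
  ultimately show ?thesis
    by (metis ennreal_mult_divide_eq infinity_ennreal_def)
qed

lemma distr_lborel_orthogonal:
  fixes f :: "'a::euclidean_space \<Rightarrow> 'a"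
  assumes f: "orthogonal_transformation f"
  shows "distr lborel borel f = lborel"
proof (rule measure_eqI)
  fix A assume "A \<in> sets (distr lborel borel f)"
  moreover have "f \<in> borel_measurable borel"
    using f by (intro borel_measurable_continuous_onI linear_continuous_on)
      (simp add: linear_conv_bounded_linear orthogonal_transformation_def)
  ultimately show "emeasure (distr lborel borel f) A = emeasure lborel A"
    by (simp add: emeasure_distr emeasure_lborel_vimage_orthogonal[OF f])
qed simp

lemma nn_integral_lborel_orthogonal:
  fixes f :: "'a::euclidean_space \<Rightarrow> 'a"
  assumes f: "orthogonal_transformation f" and [measurable]: "g \<in> borel_measurable borel"
  shows "(\<integral>\<^sup>+x. g (f x) \<partial>lborel) = (\<integral>\<^sup>+x. g x \<partial>lborel)"
proof -
  have [measurable]: "f \<in> borel_measurable borel"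
    using f by (intro borel_measurable_continuous_onI linear_continuous_on)
      (simp add: linear_conv_bounded_linear orthogonal_transformation_def)
  show ?thesis
    by (subst (2) distr_lborel_orthogonal[OF f, symmetric]) (simp add: nn_integral_distr)
qed

lemma orthogonal_transformation_cis_vector: "orthogonal_transformation (\<lambda>z :: complex ^ 'n. cis \<theta> *s z)"
  unfolding orthogonal_transformation
proof
  show "linear (\<lambda>z :: complex ^ 'n. cis \<theta> *s z)"
    by (rule linearI) (auto simp: vec_eq_iff algebra_simps)
  show "\<forall>v :: complex ^ 'n. norm (cis \<theta> *s v) = norm v"
    by (simp add: norm_vec_def norm_mult)
qed

lemma nn_integral_rotate:
  fixes b :: "complex ^ 'n"
  assumes [measurable]: "g \<in> borel_measurable borel"
  shows "(\<integral>\<^sup>+z. g (b + cis \<theta> *s (z - b)) \<partial>lborel) = (\<integral>\<^sup>+z. g z \<partial>lborel)"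
proof -
  have [measurable]: "(\<lambda>z :: complex ^ 'n. cis \<theta> *s z) \<in> borel_measurable borel"
    using orthogonal_transformation_linear[OF orthogonal_transformation_cis_vector]
    by (intro borel_measurable_continuous_onI linear_continuous_on) (simp add: linear_conv_bounded_linear)
  have "(\<integral>\<^sup>+z. g (b + cis \<theta> *s (z - b)) \<partial>lborel) = (\<integral>\<^sup>+z. g (b + cis \<theta> *s z) \<partial>lborel)"
    using nn_integral_lborel_translate[of "\<lambda>z. g (b + cis \<theta> *s z)" "-b"] by simp
  also have "\<dots> = (\<integral>\<^sup>+z. g (b + z) \<partial>lborel)"
    by (rule nn_integral_lborel_orthogonal[OF orthogonal_transformation_cis_vector]) measurable
  finally show ?thesis by (simp add: nn_integral_lborel_translate)
qed

text \<open>On the closed unit disc \<open>1 + w * u\<close> has positive real part, so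
  \<open>Ln (1 + w * u)\<close> obeys Cauchy's formula there; its value at 0 is
  \<open>Ln 1 = 0\<close>, and real parts give the claim.\<close>

lemma circle_integral_ln_cmod:
  assumes "cmod w < 1"
  shows "((\<lambda>t. ln (cmod (1 + w * cis t))) has_integral 0) {0..2*pi}"
proof -
  define f where "f u = Ln (1 + w * u)" for u
  have dom: "1 + w * u \<notin> \<real>\<^sub>\<le>\<^sub>0" if "cmod u \<le> 1" for u
  proof -
    have "cmod (w * u) < 1"
      using assms that by (metis mult_left_le norm_ge_zero norm_mult order_le_less_trans)
    then have "Re (1 + w * u) > 0"
      using abs_Re_le_cmod[of "w * u"] by simp
    then show ?thesis using complex_nonpos_Reals_iff by force
  qed
  have "((\<lambda>u. f u/(u-0)) has_contour_integral (2 * of_real pi * \<i> * f 0)) (circlepath 0 1)"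
    using dom unfolding f_def
    by (intro Cauchy_integral_circlepath)
       (auto intro!: continuous_intros holomorphic_intros)
  then have "((\<lambda>t. \<i> * f (cis t)) has_integral 0) {0..2*pi}"
    by (simp add: circlepath_def has_contour_integral_part_circlepath_iff f_def mult.commute[of \<i>])
  \<comment> \<open>The factor \<open>\<i>\<close> left by the derivative of the circle makes the
    imaginary part of the integrand the real part of \<open>f\<close>.\<close>
  from has_integral_linear[OF this bounded_linear_Im]
  have "((\<lambda>t. Im (\<i> * f (cis t))) has_integral 0) {0..2*pi}"
    by (simp only: o_def zero_complex.sel)
  moreover have "Im (\<i> * f (cis t)) = ln (cmod (1 + w * cis t))" for t
  proof -
    have "1 + w * cis t \<noteq> 0" using dom[of "cis t"] by auto
    then show ?thesis by (simp add: f_def)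
  qed
  ultimately show ?thesis by simp
qed

subsection \<open>Subharmonic functions of one variable\<close>

lemma ereal_integral_le:
  assumes F: "set_integrable M S F" and le: "\<And>x. x \<in> S \<Longrightarrow> u x \<le> ereal (F x)"
  shows "ereal_integral M S u \<le> ereal (LINT x:S|M. F x)"
proof -
  have int: "integrable M (\<lambda>x. indicator S x * F x)"
    using F by (simp add: set_integrable_def)
  define p where "p = (\<integral>\<^sup>+x. ennreal (indicator S x * F x) \<partial>M)"
  define n where "n = (\<integral>\<^sup>+x. ennreal (- (indicator S x * F x)) \<partial>M)"
  \<comment> \<open>Both parts of \<open>F\<close> are finite, which rules out \<infinity> -
    \<infinity> when positive and negative parts are compared separately.\<close>
  have fin: "p < \<infinity>" "n < \<infinity>"
    using int unfolding p_def n_def real_integrable_def by (auto simp: top.not_eq_extremum)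
  have "(\<integral>\<^sup>+x\<in>S. e2ennreal (u x) \<partial>M) \<le> p"
    unfolding p_def using le
    by (intro nn_integral_mono) (auto simp: indicator_def e2ennreal_mono simp flip: e2ennreal_ereal)
  moreover have "n \<le> (\<integral>\<^sup>+x\<in>S. e2ennreal (- u x) \<partial>M)"
    unfolding n_def using le
    by (intro nn_integral_mono)
       (auto simp: indicator_def ereal_minus_le_minus
             zero_ennreal.abs_eq[symmetric]
             simp flip: e2ennreal_ereal uminus_ereal.simps(1) zero_ereal_def intro!: e2ennreal_mono)
  ultimately have "ereal_integral M S u \<le> enn2ereal p - enn2ereal n"
    unfolding ereal_integral_def by (intro ereal_minus_mono) (simp_all add: less_eq_ennreal.rep_eq)
  also have "\<dots> = ereal (enn2real p - enn2real n)"
    using fin by (cases p; cases n) auto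
  also have "enn2real p - enn2real n = (LINT x:S|M. F x)"
    unfolding set_lebesgue_integral_def p_def n_def using int by (simp add: real_lebesgue_integral_def)
  finally show ?thesis .
qed

lemma circle_mean_le:
  assumes F: "continuous_on {0..2*pi} F" and I: "(F has_integral I) {0..2*pi}"
    and le: "\<And>\<theta>. u (a + of_real r * cis \<theta>) \<le> ereal (F \<theta>)"
  shows "circle_mean u a r \<le> ereal (I / (2*pi))"
proof -
  have int: "set_integrable lborel {0..2*pi} F"
    using F unfolding set_integrable_def by (intro borel_integrable_compact) auto
  have "(LINT x:{0..2*pi}|lborel. F x) = I"
    using set_borel_integral_eq_integral(2)[OF int] I by (simp add: integral_unique)
  then have "ereal_integral lborel {0..2*pi} (\<lambda>\<theta>. u (a + of_real r * cis \<theta>)) \<le> ereal I"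
    using ereal_integral_le[OF int, of "\<lambda>\<theta>. u (a + of_real r * cis \<theta>)"] le by simp
  then have "circle_mean u a r \<le> ereal I / ereal (2*pi)"
    unfolding circle_mean_def by (intro ereal_divide_right_mono) auto
  then show ?thesis by simp
qed

text \<open>Turns a difference of two integrals into a constant minus one nonnegative integral, so
  that Fubini and monotonicity become available without integrability conditions.\<close>

lemma ereal_integral_bounded_above:
  assumes u [measurable]: "u \<in> borel_measurable M" "S \<in> sets M"
    and s: "emeasure M S = ennreal s" "0 \<le> s"
    and le: "\<And>x. x \<in> S \<Longrightarrow> u x \<le> ereal C"
  shows "ereal_integral M S u = ereal (C * s) - enn2ereal (\<integral>\<^sup>+x\<in>S. e2ennreal (ereal C - u x) \<partial>M)"
proof -
  define X where "X = (\<integral>\<^sup>+x\<in>S. e2ennreal (ereal C - u x) \<partial>M)"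
  define p where "p = (\<integral>\<^sup>+x\<in>S. e2ennreal (u x) \<partial>M)"
  define n where "n = (\<integral>\<^sup>+x\<in>S. e2ennreal (- u x) \<partial>M)"
  have const: "(\<integral>\<^sup>+x\<in>S. ennreal c \<partial>M) = ennreal (max 0 c * s)" for c
    using s by (simp add: nn_integral_cmult_indicator ennreal_mult'' max_def ennreal_neg)
  have "p \<le> (\<integral>\<^sup>+x\<in>S. ennreal C \<partial>M)"
    unfolding p_def using le
    by (intro nn_integral_mono) (auto simp: indicator_def simp flip: e2ennreal_ereal intro!: e2ennreal_mono)
  then obtain p' where p': "p = ennreal p'" "0 \<le> p'"
    unfolding const by (cases p) (auto simp: top_unique)
  \<comment> \<open>The identity \<open>(C - u) + u^+ + C^- = C^+ + u^-\<close> has nonnegative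
    terms on both sides, so it may be integrated even where \<open>u = -\<infinity>\<close>; the
    finite \<open>p\<close> can be cancelled at the end.\<close>
  have "X + p + (\<integral>\<^sup>+x\<in>S. ennreal (-C) \<partial>M)
      = (\<integral>\<^sup>+x. e2ennreal (ereal C - u x) * indicator S x + e2ennreal (u x) * indicator S x
               + ennreal (-C) * indicator S x \<partial>M)"
    unfolding X_def p_def by (simp add: nn_integral_add)
  also have "\<dots> = (\<integral>\<^sup>+x. ennreal C * indicator S x + e2ennreal (- u x) * indicator S x \<partial>M)"
  proof (intro nn_integral_cong)
    fix x
    show "e2ennreal (ereal C - u x) * indicator S x + e2ennreal (u x) * indicator S x
               + ennreal (-C) * indicator S x = ennreal C * indicator S x + e2ennreal (- u x) * indicator S x"
    proof (cases "x \<in> S")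
      case True
      with le[OF True] show ?thesis
      proof (cases "u x")
        case (real r)
        with le[OF True] have "r \<le> C" by simp
        then have "ennreal (C - r) + ennreal r + ennreal (-C) = ennreal C + ennreal (-r)"
          by (cases "r \<ge> 0"; cases "C \<ge> 0") (simp_all add: ennreal_neg flip: ennreal_plus)
        with real True show ?thesis by simp
      qed (use True in auto)
    qed simp
  qed
  also have "\<dots> = (\<integral>\<^sup>+x\<in>S. ennreal C \<partial>M) + n"
    unfolding n_def by (simp add: nn_integral_add)
  finally have eq: "X + ennreal p' + ennreal (max 0 (-C) * s) = ennreal (max 0 C * s) + n"
    by (simp only: const p')
  have "enn2ereal p - enn2ereal n = ereal (C * s) - enn2ereal X"
  proof (cases X)
    case (real x)
    then obtain n' where n': "n = ennreal n'" "0 \<le> n'"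
      using eq by (cases n) (auto simp flip: ennreal_plus)
    have "ennreal (x + p' + max 0 (-C) * s) = ennreal (max 0 C * s + n')"
      using eq real p' n' s by (simp add: max_def)
    then have "x + p' + max 0 (-C) * s = max 0 C * s + n'"
      using real p' n' s by (subst (asm) ennreal_inj) auto
    then show ?thesis
      using real p' n' by (auto simp: max_def enn2ereal_ennreal split: if_splits)
  next
    case top
    then have "ennreal (max 0 C * s) + n = top" using eq by simp
    then have "n = \<infinity>" by (simp add: ennreal_add_eq_top)
    then show ?thesis using top p' by (simp add: enn2ereal_ennreal)
  qed
  then show ?thesis by (simp add: ereal_integral_def p_def n_def X_def)
qed

lemma ereal_integral_ge_imp:
  assumes "u \<in> borel_measurable M" "S \<in> sets M"
    and "emeasure M S = ennreal s" "0 \<le> s"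
    and "\<And>x. x \<in> S \<Longrightarrow> u x \<le> ereal C"
    and I: "ereal I \<le> ereal_integral M S u"
  shows "(\<integral>\<^sup>+x\<in>S. e2ennreal (ereal C - u x) \<partial>M) \<le> ennreal (C * s - I)"
proof -
  define X where "X = (\<integral>\<^sup>+x\<in>S. e2ennreal (ereal C - u x) \<partial>M)"
  have "ereal I \<le> ereal (C * s) - enn2ereal X"
    using I ereal_integral_bounded_above[OF assms(1-5)] by (simp add: X_def)
  then have "X \<le> ennreal (C * s - I)"
    by (cases X) (auto simp: enn2ereal_ennreal intro: ennreal_leI)
  then show ?thesis by (simp add: X_def)
qed

section \<open>Upper semicontinuous functions\<close>

lemma usc_on_subset:
  assumes u: "usc_on U u" and V: "V \<subseteq> U"
  shows "usc_on V u"
  unfolding usc_on_def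
proof
  fix c
  obtain T where "open T" "{z \<in> U. u z < c} = U \<inter> T"
    using u unfolding usc_on_def openin_open by metis
  then have "{z \<in> V. u z < c} = V \<inter> T" using V by auto
  then show "openin (top_of_set V) {z \<in> V. u z < c}"
    using \<open>open T\<close> by (auto simp: openin_open)
qed

lemma usc_on_add_continuous:
  assumes u: "usc_on U u" and fin: "\<And>z. z \<in> U \<Longrightarrow> u z < \<infinity>" and g: "continuous_on U g"
  shows "usc_on U (\<lambda>z. u z + ereal (g z))"
  unfolding usc_on_def
proof
  fix c
  \<comment> \<open>A real \<open>q\<close> separates \<open>u z\<close> from
    \<open>c - g z\<close>, which writes the sublevel set of the sum as a union of open
    sets.\<close>
  have *: "u z + ereal (g z) < c \<longleftrightarrow> (\<exists>q. u z < ereal q \<and> ereal (g z) < c - ereal q)" if "z \<in> U" for z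
  proof (cases "u z")
    case (real r)
    have "(r + g z < c') \<longleftrightarrow> (\<exists>q. r < q \<and> g z < c' - q)" for c'
    proof
      assume "r + g z < c'"
      then show "\<exists>q. r < q \<and> g z < c' - q"
        by (intro exI[of _ "r + (c' - (r + g z)) / 2"]) (simp add: field_simps)
    qed auto
    moreover have "\<exists>q. r < q" by (rule gt_ex)
    ultimately show ?thesis using real by (cases c) auto
  next
    case MInf
    moreover have "\<exists>q. g z < c' - q" for c'
      by (rule exI[of _ "c' - g z - 1"]) simp
    ultimately show ?thesis
      by (cases c) auto
  qed (use fin[OF that] in auto)
  have "{z \<in> U. u z + ereal (g z) < c} = (\<Union>q. {z \<in> U. u z < ereal q} \<inter> {z \<in> U. ereal (g z) < c - ereal q})"
    using * by auto
  moreover have "openin (top_of_set U) {z \<in> U. ereal (g z) < d}" for d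
  proof -
    have "continuous_on U (\<lambda>z. ereal (g z))" using g by (intro continuous_intros)
    then have "openin (top_of_set U) (U \<inter> (\<lambda>z. ereal (g z)) -` {..<d})"
      by (rule continuous_openin_preimage_gen) simp
    also have "U \<inter> (\<lambda>z. ereal (g z)) -` {..<d} = {z \<in> U. ereal (g z) < d}" by auto
    finally show ?thesis .
  qed
  ultimately show "openin (top_of_set U) {z \<in> U. u z + ereal (g z) < c}"
    using u by (auto simp: usc_on_def intro!: openin_Union openin_Int)
qed

text \<open>If the supremum \<open>s\<close> were not attained, the sets \<open>{u < c}\<close> with
  \<open>c < s\<close> would cover \<open>K\<close>, and a finite subcover would bound
  \<open>u\<close> by some \<open>c < s\<close>. This is why maxima are taken over closed polydiscs
  and closed annuli.\<close>

lemma usc_attains_max: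
  assumes u: "usc_on K u" and K: "compact K" "K \<noteq> {}"
  shows "\<exists>x\<in>K. \<forall>y\<in>K. u y \<le> u x"
proof -
  define s where "s = (SUP y\<in>K. u y)"
  have "\<exists>x\<in>K. u x = s"
  proof (rule ccontr)
    assume "\<not> (\<exists>x\<in>K. u x = s)"
    then have less: "u x < s" if "x \<in> K" for x
      using that SUP_upper[of x K u] by (auto simp: s_def less_le)
    have "\<exists>c<s. u x < c" if "x \<in> K" for x
      using dense[OF less[OF that]] by auto
    then have cov: "K \<subseteq> \<Union> ((\<lambda>c. {z \<in> K. u z < c}) ` {..<s})"
      by auto
    obtain T where T: "\<And>c. open (T c)" "\<And>c. {z \<in> K. u z < c} = K \<inter> T c"
      using u unfolding usc_on_def openin_open by metis
    have "K \<subseteq> \<Union> (T ` {..<s})" using cov T(2) by blast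
    then obtain C where C: "C \<subseteq> {..<s}" "finite C" "K \<subseteq> \<Union> (T ` C)"
      using compactE_image[OF K(1), of "{..<s}" T] T(1) by blast
    then have "C \<noteq> {}" using K by auto
    have "u x \<le> Max C" if xK: "x \<in> K" for x
    proof -
      obtain c where "c \<in> C" "x \<in> T c" using subsetD[OF C(3) xK] by auto
      then have "u x < c" using T(2)[of c] xK by auto
      also have "c \<le> Max C" using C \<open>c \<in> C\<close> by auto
      finally show ?thesis by simp
    qed
    then have "s \<le> Max C" unfolding s_def by (rule SUP_least)
    moreover have "Max C < s" using C \<open>C \<noteq> {}\<close> by auto
    ultimately show False by simp
  qed
  then show ?thesis using SUP_upper[of _ K u] unfolding s_def by metis
qed

section \<open>The three circles theorem\<close>

lemma circle_integral_cos_sin: "((\<lambda>t. p * cos t + q * sin t) has_integral 0) {0..2*pi}"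
proof -
  have "((\<lambda>t. p * cos t + q * sin t) has_integral
         ((p * sin (2*pi) - q * cos (2*pi)) - (p * sin 0 - q * cos 0))) {0..2*pi}"
    by (intro fundamental_theorem_of_calculus)
       (auto intro!: derivative_eq_intros simp flip: has_real_derivative_iff_has_vector_derivative)
  then show ?thesis by simp
qed

text \<open>The perturbation \<open>\<epsilon> |z|\<^sup>2\<close> is strictly subharmonic, so an interior maximum of
  \<open>u - k ln |z| + \<epsilon> |z|\<^sup>2\<close> on the annulus violates the mean value inequality.\<close>

lemma subharmonic_three_circles:
  assumes sh: "subharmonic_on U u" and t: "0 < t1" "t1 < t2"
    and ann: "\<And>z. t1 \<le> cmod z \<Longrightarrow> cmod z \<le> t2 \<Longrightarrow> z \<in> U"
    and A: "\<And>z. cmod z = t1 \<Longrightarrow> u z \<le> ereal A" and B: "\<And>z. cmod z = t2 \<Longrightarrow> u z \<le> ereal B"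
    and z: "t1 \<le> cmod z" "cmod z \<le> t2"
  shows "u z \<le> ereal (A + (B - A) * (ln (cmod z / t1) / ln (t2 / t1)))"
proof (rule ccontr)
  \<comment> \<open>The slope for which \<open>A + k * ln (|y| / t1)\<close> takes the values
    \<open>A\<close> and \<open>B\<close> on the two boundary circles.\<close>
  define k where "k = (B - A) / ln (t2 / t1)"
  define K where "K = {z. t1 \<le> cmod z \<and> cmod z \<le> t2}"
  assume "\<not> ?thesis"
  then have gt: "ereal (A + k * ln (cmod z / t1)) < u z" by (simp add: k_def)
  have fin: "u y < \<infinity>" if "y \<in> K" for y
    using sh ann that by (auto simp: subharmonic_on_def K_def)
  have zK: "z \<in> K" using z by (simp add: K_def)
  with gt fin[OF zK] obtain uz where uz: "u z = ereal uz" by (cases "u z") auto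
  define D where "D = uz - (A + k * ln (cmod z / t1))"
  have D: "D > 0" using gt uz by (simp add: D_def)
  \<comment> \<open>\<open>D\<close> is the excess at \<open>z\<close>. Since
    \<open>\<epsilon> * t2^2 = D / 2\<close>, the perturbation stays below the excess on the whole
    annulus, so no boundary circle can carry the maximum.\<close>
  define \<epsilon> where "\<epsilon> = D / (2 * t2^2)"
  have \<epsilon>: "\<epsilon> > 0" "\<epsilon> * t2^2 < D" using D t by (auto simp: \<epsilon>_def field_simps)
  define g where "g y = \<epsilon> * (cmod y)^2 - k * ln (cmod y)" for y
  have compK: "compact K"
  proof -
    have "K = cball 0 t2 - ball 0 t1" by (auto simp: K_def)
    then show ?thesis by (simp add: compact_diff)
  qed
  have uscK: "usc_on K u"
    using sh ann by (auto simp: subharmonic_on_def K_def intro: usc_on_subset)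
  have contg: "continuous_on K g"
    using t unfolding g_def K_def by (intro continuous_intros) auto
  have uscW: "usc_on K (\<lambda>z. u z + ereal (g z))"
    by (rule usc_on_add_continuous[OF uscK _ contg]) (rule fin)
  have "K \<noteq> {}" using zK by auto
  from usc_attains_max[OF uscW compK this]
  obtain x where x: "x \<in> K" "\<And>y. y \<in> K \<Longrightarrow> u y + ereal (g y) \<le> u x + ereal (g x)"
    by blast
  have "ereal (uz + g z) \<le> u x + ereal (g x)" using x(2)[OF zK] uz by simp
  with fin[OF x(1)] obtain ux where ux: "u x = ereal ux" and uxz: "uz + g z \<le> ux + g x"
    by (cases "u x") auto
  have "z \<noteq> 0" using z t by auto
  then have lnz: "ln (cmod z / t1) = ln (cmod z) - ln t1"
    using t by (simp add: ln_div)
  have "ux + g x \<ge> A + k * ln (cmod z / t1) + D - k * ln (cmod z)"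
  proof -
    have "0 \<le> \<epsilon> * (cmod z)^2" using \<epsilon> by simp
    then show ?thesis using uxz by (simp add: D_def g_def[of z])
  qed
  then have low: "ux + g x \<ge> A - k * ln t1 + D"
    unfolding lnz by (simp add: algebra_simps)
  have kB: "B = A + k * ln t2 - k * ln t1"
  proof -
    have L: "ln (t2 / t1) = ln t2 - ln t1" "ln (t2 / t1) > 0" using t by (simp_all add: ln_div)
    have "k * ln (t2 / t1) = B - A" using L(2) by (simp add: k_def)
    then show ?thesis unfolding L(1) by (simp add: algebra_simps)
  qed
  have ne: "cmod x \<noteq> t1" "cmod x \<noteq> t2"
  proof -
    have bd: "\<epsilon> * (cmod x)^2 < D" 
    proof -
      have "(cmod x)^2 \<le> t2^2" using x(1) by (intro power_mono) (auto simp: K_def)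
      then show ?thesis using \<epsilon> by (smt (verit) mult_left_mono)
    qed
    show "cmod x \<noteq> t1"
    proof
      assume h: "cmod x = t1"
      with A[of x] ux have "ux \<le> A" by simp
      with low bd h show False by (simp add: g_def)
    qed
    show "cmod x \<noteq> t2"
    proof
      assume h: "cmod x = t2"
      with B[of x] ux have "ux \<le> B" by simp
      with low bd h show False using kB by (simp add: g_def)
    qed
  qed
  \<comment> \<open>The disc of radius \<open>r\<close> about \<open>x\<close> stays in the annulus
    and, as \<open>r < |x|\<close>, avoids 0, so \<open>ln |y|\<close> is harmonic on it.\<close>
  define r where "r = min (cmod x - t1) (t2 - cmod x)"
  have r: "r > 0" using ne x(1) by (auto simp: r_def K_def)
  have x0: "cmod x > 0" "r < cmod x" using x(1) t by (auto simp: K_def r_def)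
  have sub: "cball x r \<subseteq> K"
  proof
    fix y assume "y \<in> cball x r"
    then have "cmod (x - y) \<le> r" by (simp add: dist_norm)
    then show "y \<in> K"
      using norm_triangle_ineq2[of x y] norm_triangle_ineq3[of x y] by (auto simp: K_def r_def)
  qed
  \<comment> \<open>Maximality at \<open>x\<close> gives \<open>u y \<le> ux + g x - g y\<close> on
    the circle. Factoring \<open>x\<close> out of the logarithm and expanding \<open>|y|^2\<close>
    isolates terms of mean zero; the mean of \<open>F\<close> is
    \<open>ux - \<epsilon> * r^2\<close>, strictly below \<open>u x\<close>.\<close>
  define F where "F \<theta> = (ux + g x + k * ln (cmod x) - \<epsilon> * ((cmod x)^2 + r^2))
      + (k * ln (cmod (1 + (of_real r / x) * cis \<theta>)) - \<epsilon> * (2 * r * Re x * cos \<theta> + 2 * r * Im x * sin \<theta>))" for \<theta>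
  have circ: "x + of_real r * cis \<theta> = x * (1 + (of_real r / x) * cis \<theta>)" for \<theta>
    using x0 by (auto simp: field_simps)
  have nz: "1 + (of_real r / x) * cis \<theta> \<noteq> 0" for \<theta>
  proof
    assume "1 + (of_real r / x) * cis \<theta> = 0"
    then have "cmod ((of_real r / x) * cis \<theta>) = 1" by (metis add_eq_0_iff norm_minus_cancel norm_one)
    then show False using x0 r by (simp add: norm_mult norm_divide)
  qed
  have sq: "(cmod (x + of_real r * cis \<theta>))^2 = (cmod x)^2 + r^2 + (2 * r * Re x * cos \<theta> + 2 * r * Im x * sin \<theta>)" for \<theta>
  proof -
    have "r^2 * (cos \<theta>)^2 + r^2 * (sin \<theta>)^2 = r^2"
      by (metis distrib_left mult.right_neutral sin_cos_squared_add2)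
    then show ?thesis by (simp add: cmod_power2 power2_sum power_mult_distrib)
  qed
  have "u (x + of_real r * cis \<theta>) \<le> ereal (F \<theta>)" for \<theta>
  proof -
    define y where "y = x + of_real r * cis \<theta>"
    have "y \<in> K" using sub r by (auto simp: y_def dist_norm norm_mult)
    have "u y \<le> ereal (ux + g x - g y)"
      using x(2)[OF \<open>y \<in> K\<close>] ux fin[OF \<open>y \<in> K\<close>] by (cases "u y") auto
    also have "ux + g x - g y = F \<theta>"
    proof -
      have "ln (cmod y) = ln (cmod x) + ln (cmod (1 + (of_real r / x) * cis \<theta>))"
        using nz[of \<theta>] x0 unfolding y_def circ norm_mult by (subst ln_mult) auto
      then have "g y = \<epsilon> * ((cmod x)^2 + r^2 + (2 * r * Re x * cos \<theta> + 2 * r * Im x * sin \<theta>))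
          - k * (ln (cmod x) + ln (cmod (1 + (of_real r / x) * cis \<theta>)))"
        unfolding g_def y_def sq by simp
      then show ?thesis unfolding F_def by (simp only: algebra_simps)
    qed
    finally show ?thesis by (simp add: y_def)
  qed
  moreover have "continuous_on {0..2*pi} F"
    unfolding F_def using nz by (intro continuous_intros) auto
  moreover have "(F has_integral (2*pi) * (ux + g x + k * ln (cmod x) - \<epsilon> * ((cmod x)^2 + r^2))) {0..2*pi}"
  proof -
    have "cmod (of_real r / x) < 1" using x0 r by (simp add: norm_divide)
    from circle_integral_ln_cmod[OF this]
    have "((\<lambda>\<theta>. k * ln (cmod (1 + (of_real r / x) * cis \<theta>))) has_integral k * 0) {0..2*pi}"
      by (intro has_integral_mult_right)
    moreover have "((\<lambda>\<theta>. \<epsilon> * (2 * r * Re x * cos \<theta> + 2 * r * Im x * sin \<theta>)) has_integral \<epsilon> * 0) {0..2*pi}"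
      by (intro has_integral_mult_right circle_integral_cos_sin)
    moreover have "((\<lambda>\<theta>::real. ux + g x + k * ln (cmod x) - \<epsilon> * ((cmod x)^2 + r^2)) has_integral
        (2*pi - 0) * (ux + g x + k * ln (cmod x) - \<epsilon> * ((cmod x)^2 + r^2))) {0..2*pi}"
      using has_integral_const_real[of "ux + g x + k * ln (cmod x) - \<epsilon> * ((cmod x)^2 + r^2)" 0 "2*pi"] by simp
    ultimately have "(F has_integral
        (2*pi - 0) * (ux + g x + k * ln (cmod x) - \<epsilon> * ((cmod x)^2 + r^2)) + (k * 0 - \<epsilon> * 0)) {0..2*pi}"
      unfolding F_def by (intro has_integral_add has_integral_diff)
    then show ?thesis by simp
  qed
  ultimately have "circle_mean u x r \<le> ereal ((2*pi) * (ux + g x + k * ln (cmod x) - \<epsilon> * ((cmod x)^2 + r^2)) / (2*pi))"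
    by (rule circle_mean_le[rotated 2])
  also have "\<dots> = ereal (ux + g x + k * ln (cmod x) - \<epsilon> * ((cmod x)^2 + r^2))"
    by (subst nonzero_mult_div_cancel_left) auto
  also have "\<dots> = ereal (ux - \<epsilon> * r^2)" by (simp add: g_def algebra_simps)
  also have "\<dots> < ereal ux" using r \<epsilon> by simp
  also have "\<dots> \<le> circle_mean u x r"
  proof -
    have "cball x r \<subseteq> U" using sub ann by (auto simp: K_def)
    then show ?thesis using sh r ux unfolding subharmonic_on_def by metis
  qed
  finally show False by simp
qed

subsection \<open>Mean values of plurisubharmonic functions over polydiscs\<close>

text \<open>A plurisubharmonic function is arbitrary off its domain, so measurability on the whole
  space is stated for an extension by a constant.\<close>

lemma usc_on_borel_measurable:
  fixes u :: "'a::topological_space \<Rightarrow> ereal"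
  assumes U: "open U" and u: "usc_on U u"
  shows "(\<lambda>z. if z \<in> U then u z else c) \<in> borel_measurable borel"
proof (rule borel_measurableI_less)
  fix y
  have "open {z \<in> U. u z < y}"
    using u U by (auto simp: usc_on_def openin_open_eq)
  have "{x \<in> space borel. (if x \<in> U then u x else c) < y} = {z \<in> U. u z < y} \<union> (if c < y then - U else {})"
    by auto
  also have "\<dots> \<in> sets borel"
    using \<open>open {z \<in> U. u z < y}\<close> U by auto
  finally show "{x \<in> space borel. (if x \<in> U then u x else c) < y} \<in> sets borel" .
qed

lemma PSH_usc_on: "\<phi> \<in> PSH \<Omega> \<Longrightarrow> usc_on \<Omega> \<phi>"
  and PSH_less_top: "\<phi> \<in> PSH \<Omega> \<Longrightarrow> z \<in> \<Omega> \<Longrightarrow> \<phi> z < \<infinity>"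
  and PSH_subharmonic: "\<phi> \<in> PSH \<Omega> \<Longrightarrow> subharmonic_on {t. a + t *s w \<in> \<Omega>} (\<lambda>t. \<phi> (a + t *s w))"
  by (auto simp: PSH_def)

lemma continuous_on_vector_scalar_mult [continuous_intros]:
  fixes f :: "'a::topological_space \<Rightarrow> complex"
  shows "continuous_on S f \<Longrightarrow> continuous_on S g \<Longrightarrow> continuous_on S (\<lambda>x. f x *s g x)"
  unfolding vector_scalar_mult_def by (intro continuous_intros continuous_on_vec_lambda)

text \<open>The mean value inequality on the disc \<open>b + t *s w\<close>, rewritten through the
  nonnegative function \<open>C - \<phi>\<close>; in this form it can be integrated over directions
  \<open>w\<close>.\<close>

lemma PSH_circle_nn_integral_le:
  assumes \<phi>: "\<phi> \<in> PSH \<Omega>" and \<Omega>: "open \<Omega>"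
    and disc: "\<And>t. cmod t \<le> 1 \<Longrightarrow> b + t *s w \<in> \<Omega>"
    and C: "\<And>\<theta>. \<phi> (b + cis \<theta> *s w) \<le> ereal C"
    and m: "\<phi> b = ereal m"
  shows "(\<integral>\<^sup>+\<theta>\<in>{0..2*pi}. e2ennreal (ereal C - \<phi> (b + cis \<theta> *s w)) \<partial>lborel) \<le> ennreal (2 * pi * (C - m))"
proof -
  define u where "u \<theta> = \<phi> (b + cis \<theta> *s w)" for \<theta>
  have "u = (\<lambda>\<theta>. (if b + cis \<theta> *s w \<in> \<Omega> then \<phi> (b + cis \<theta> *s w) else 0))"
    using disc by (auto simp: u_def)
  moreover have "(\<lambda>\<theta>. b + cis \<theta> *s w) \<in> borel \<rightarrow>\<^sub>M borel"
    by (intro borel_measurable_continuous_onI continuous_intros)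
  ultimately have u: "u \<in> borel_measurable lborel"
    using measurable_compose[OF _ usc_on_borel_measurable[OF \<Omega> PSH_usc_on[OF \<phi>], of 0]] by simp
  have "\<phi> b \<le> circle_mean (\<lambda>t. \<phi> (b + t *s w)) 0 1"
  proof -
    have "cball 0 1 \<subseteq> {t. b + t *s w \<in> \<Omega>}" using disc by auto
    then have "\<phi> (b + 0 *s w) \<le> circle_mean (\<lambda>t. \<phi> (b + t *s w)) 0 1"
      using PSH_subharmonic[OF \<phi>, of b w] zero_less_one unfolding subharmonic_on_def by blast
    then show ?thesis by simp
  qed
  then have "ereal m \<le> ereal_integral lborel {0..2*pi} u / ereal (2 * pi)"
    by (simp add: m circle_mean_def u_def[abs_def])
  then have "ereal (2 * pi * m) \<le> ereal_integral lborel {0..2*pi} u"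
    by (simp add: ereal_le_divide_pos)
  then have "(\<integral>\<^sup>+\<theta>\<in>{0..2*pi}. e2ennreal (ereal C - u \<theta>) \<partial>lborel) \<le> ennreal (C * (2 * pi) - 2 * pi * m)"
    using C by (intro ereal_integral_ge_imp[OF u]) (auto simp: u_def)
  then show ?thesis by (simp add: u_def algebra_simps)
qed

text \<open>The circle action \<open>z \<mapsto> b + cis \<theta> *s (z - b)\<close> preserves \<open>S\<close> and Lebesgue measure, so the mean
  over \<open>S\<close> is an average of means over circles centred at \<open>b\<close>; no polar coordinates are needed.\<close>

lemma PSH_nn_integral_le:
  fixes \<phi> :: "complex ^ 'n \<Rightarrow> ereal"
  assumes \<phi>: "\<phi> \<in> PSH \<Omega>" and \<Omega>: "open \<Omega>" and S: "S \<in> sets borel" "S \<subseteq> \<Omega>"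
    and bal: "\<And>z t. z \<in> S \<Longrightarrow> cmod t \<le> 1 \<Longrightarrow> b + t *s (z - b) \<in> S"
    and C: "\<And>z. z \<in> S \<Longrightarrow> \<phi> z \<le> ereal C" and m: "\<phi> b = ereal m"
  shows "(\<integral>\<^sup>+z\<in>S. e2ennreal (ereal C - \<phi> z) \<partial>lborel) \<le> ennreal (C - m) * emeasure lborel S"
proof -
  note [measurable] = S(1)
  \<comment> \<open>The indicator and the value 0 off \<Omega> give a Borel function on the whole
    space, which supplies the joint measurability that Fubini requires.\<close>
  define g where "g z = e2ennreal (ereal C - (if z \<in> \<Omega> then \<phi> z else 0)) * indicator S z" for z
  have g [measurable]: "g \<in> borel_measurable borel"
    using usc_on_borel_measurable[OF \<Omega> PSH_usc_on[OF \<phi>], of 0] unfolding g_def by measurable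
  have meas: "case_prod (\<lambda>z \<theta>. g (b + cis \<theta> *s (z - b)) * indicator {0..2*pi} \<theta>)
      \<in> borel_measurable ((lborel :: (complex ^ 'n) measure) \<Otimes>\<^sub>M (lborel :: real measure))"
  proof -
    have "(\<lambda>p :: (complex ^ 'n) \<times> real. b + cis (snd p) *s (fst p - b)) \<in> borel \<rightarrow>\<^sub>M borel"
      by (intro borel_measurable_continuous_onI continuous_intros)
    from measurable_compose[OF this g]
    have "(\<lambda>p :: (complex ^ 'n) \<times> real. g (b + cis (snd p) *s (fst p - b))) \<in> borel_measurable (lborel \<Otimes>\<^sub>M lborel)"
      by (simp only: lborel_prod measurable_lborel2)
    then show ?thesis unfolding case_prod_unfold
      by (rule borel_measurable_times_ennreal) measurable
  qed
  have circle: "(\<integral>\<^sup>+\<theta>\<in>{0..2*pi}. g (b + cis \<theta> *s (z - b)) \<partial>lborel) \<le> ennreal (2 * pi * (C - m)) * indicator S z" for z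
  proof (cases "z \<in> S")
    case True
    have "(\<integral>\<^sup>+\<theta>\<in>{0..2*pi}. g (b + cis \<theta> *s (z - b)) \<partial>lborel)
        = (\<integral>\<^sup>+\<theta>\<in>{0..2*pi}. e2ennreal (ereal C - \<phi> (b + cis \<theta> *s (z - b))) \<partial>lborel)"
      using bal[OF True] S by (intro nn_integral_cong) (auto simp: g_def subset_eq)
    also have "\<dots> \<le> ennreal (2 * pi * (C - m))"
      using bal[OF True] S C by (intro PSH_circle_nn_integral_le[OF \<phi> \<Omega>] m) auto
    finally show ?thesis using True by simp
  next
    case False
    \<comment> \<open>The inverse rotation also preserves \<open>S\<close>, hence the complement of
      \<open>S\<close> is invariant too.\<close>
    have "b + cis \<theta> *s (z - b) \<notin> S" for \<theta>
    proof
      assume "b + cis \<theta> *s (z - b) \<in> S"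
      from bal[OF this, of "cis (-\<theta>)"] have "z \<in> S"
        by (simp add: vector_smult_assoc cis_mult)
      with False show False by simp
    qed
    then show ?thesis by (simp add: g_def)
  qed
  have "ennreal (2 * pi) * (\<integral>\<^sup>+z. g z \<partial>lborel) = (\<integral>\<^sup>+\<theta>. (\<integral>\<^sup>+z. g z \<partial>lborel) * indicator {0..2*pi} \<theta> \<partial>lborel)"
    by (simp add: nn_integral_cmult mult.commute)
  also have "\<dots> = (\<integral>\<^sup>+\<theta>. (\<integral>\<^sup>+z. g (b + cis \<theta> *s (z - b)) * indicator {0..2*pi} \<theta> \<partial>lborel) \<partial>lborel)"
  proof (intro nn_integral_cong)
    fix \<theta> :: real
    have "(\<lambda>z. g (b + cis \<theta> *s (z - b))) \<in> borel_measurable borel"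
      by (intro measurable_compose[OF _ g] borel_measurable_continuous_onI continuous_intros)
    then show "(\<integral>\<^sup>+z. g z \<partial>lborel) * indicator {0..2*pi} \<theta>
        = (\<integral>\<^sup>+z. g (b + cis \<theta> *s (z - b)) * indicator {0..2*pi} \<theta> \<partial>lborel)"
      using nn_integral_rotate[OF g, of b \<theta>] by (subst nn_integral_multc) auto
  qed
  also have "\<dots> = (\<integral>\<^sup>+z. (\<integral>\<^sup>+\<theta>. g (b + cis \<theta> *s (z - b)) * indicator {0..2*pi} \<theta> \<partial>lborel) \<partial>lborel)"
    by (rule lborel_pair.Fubini'[OF meas])
  also have "\<dots> \<le> (\<integral>\<^sup>+z. ennreal (2 * pi * (C - m)) * indicator S z \<partial>lborel)"
    by (intro nn_integral_mono circle)
  also have "\<dots> = ennreal (2 * pi * (C - m)) * emeasure lborel S"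
    by (rule nn_integral_cmult_indicator) simp
  also have "\<dots> = ennreal (2 * pi) * (ennreal (C - m) * emeasure lborel S)"
    by (subst ennreal_mult') (simp_all add: mult.assoc)
  finally have "(\<integral>\<^sup>+z. g z \<partial>lborel) \<le> ennreal (C - m) * emeasure lborel S"
    by (subst (asm) ennreal_mult_le_mult_iff) auto
  also have "(\<integral>\<^sup>+z. g z \<partial>lborel) = (\<integral>\<^sup>+z\<in>S. e2ennreal (ereal C - \<phi> z) \<partial>lborel)"
    using S by (intro nn_integral_cong) (auto simp: g_def indicator_def)
  finally show ?thesis .
qed

section \<open>Topology and volume of polydiscs\<close>

definition closed_polydisc :: "complex ^ 'n \<Rightarrow> real ^ 'n \<Rightarrow> (complex ^ 'n) set" where
  "closed_polydisc a r = {z. \<forall>j. cmod (z $ j - a $ j) \<le> r $ j}"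

lemma closed_polydisc_mono:
  fixes r s :: "real ^ 'n"
  shows "(\<And>j. r $ j \<le> s $ j) \<Longrightarrow> closed_polydisc a r \<subseteq> closed_polydisc a s"
  unfolding closed_polydisc_def using order_trans by blast

lemma polydisc_subset_closed_polydisc: "polydisc a r \<subseteq> closed_polydisc a r"
  by (auto simp: closed_polydisc_def polydisc_def less_imp_le)

lemma closed_polydisc_cball: "closed_polydisc a r \<subseteq> cball a (\<Sum>j\<in>UNIV. r $ j)"
proof
  fix z assume z: "z \<in> closed_polydisc a r"
  have "norm (z - a) \<le> (\<Sum>j\<in>UNIV. cmod ((z - a) $ j))"
    unfolding norm_vec_def by (rule L2_set_le_sum) simp
  also have "\<dots> \<le> (\<Sum>j\<in>UNIV. r $ j)"
    using z by (intro sum_mono) (auto simp: closed_polydisc_def)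
  finally show "z \<in> cball a (\<Sum>j\<in>UNIV. r $ j)" by (simp add: dist_norm norm_minus_commute)
qed

lemma compact_closed_polydisc: "compact (closed_polydisc a r)"
proof -
  have "closed (closed_polydisc a r)"
    unfolding closed_polydisc_def
    by (intro closed_Collect_all closed_Collect_le continuous_intros)
  moreover have "bounded (closed_polydisc a r)"
    using bounded_subset[OF bounded_cball closed_polydisc_cball] .
  ultimately show ?thesis by (simp add: compact_eq_bounded_closed)
qed

lemma open_polydisc: "open (polydisc a r)"
proof -
  have "polydisc a r = (\<Inter>j. {z. cmod (z $ j - a $ j) < r $ j})"
    by (auto simp: polydisc_def)
  also have "open \<dots>"
    by (intro open_INT ballI open_Collect_less continuous_intros) simp
  finally show ?thesis .
qed

lemma closure_polydisc_subset: "closure (polydisc a r) \<subseteq> closed_polydisc a r"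
  by (intro closure_minimal polydisc_subset_closed_polydisc compact_imp_closed compact_closed_polydisc)

lemma polydisc_center:
  fixes r :: "real ^ 'n"
  shows "(\<And>j. 0 < r $ j) \<Longrightarrow> a \<in> polydisc a r"
  by (simp add: polydisc_def)

lemma polydisc_borel [measurable]: "polydisc a r \<in> sets borel"
  by (simp add: open_polydisc)

lemma emeasure_polydisc_finite: "emeasure lborel (polydisc a r) < \<infinity>"
proof -
  have "emeasure lborel (polydisc a r) \<le> emeasure lborel (cball a (\<Sum>j\<in>UNIV. r $ j))"
    using polydisc_subset_closed_polydisc[of a r] closed_polydisc_cball[of a r] by (intro emeasure_mono) auto
  then show ?thesis using emeasure_lborel_cball_finite order_le_less_trans by blast
qed

lemma ball_subset_polydisc:
  fixes r :: "real ^ 'n"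
  assumes "\<And>j. \<rho> \<le> r $ j"
  shows "ball a \<rho> \<subseteq> polydisc a r"
proof
  fix z assume "z \<in> ball a \<rho>"
  then have "norm (z - a) < \<rho>" by (simp add: dist_norm norm_minus_commute)
  then show "z \<in> polydisc a r"
    using Finite_Cartesian_Product.norm_nth_le[of "z - a"] assms
    by (auto simp: polydisc_def) (meson order_le_less_trans order_less_le_trans)
qed

lemma emeasure_polydisc_pos:
  fixes r :: "real ^ 'n"
  assumes "\<And>j. 0 < r $ j"
  shows "emeasure lborel (polydisc a r) \<noteq> 0"
  using polydisc_center[of r a] assms open_polydisc[of a r]
    open_not_negligible[of "polydisc a r"]
  by (auto simp: negligible_iff_null_sets null_sets_def)

lemma polydisc_scale:
  assumes "0 < c"
  shows "polydisc b (c *\<^sub>R r) = (\<lambda>z. c *\<^sub>R z + (b - c *\<^sub>R a)) ` polydisc a r"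
proof (intro subset_antisym subsetI)
  fix z assume z: "z \<in> polydisc b (c *\<^sub>R r)"
  have "cmod ((inverse c *\<^sub>R (z - b) + a) $ j - a $ j) < r $ j" for j
  proof -
    have "(inverse c *\<^sub>R (z - b) + a) $ j - a $ j = inverse c *\<^sub>R (z $ j - b $ j)" by simp
    then show ?thesis using z assms by (simp only: norm_scaleR) (simp add: polydisc_def field_simps)
  qed
  moreover have "z = c *\<^sub>R (inverse c *\<^sub>R (z - b) + a) + (b - c *\<^sub>R a)"
    using assms by (simp add: algebra_simps)
  ultimately show "z \<in> (\<lambda>z. c *\<^sub>R z + (b - c *\<^sub>R a)) ` polydisc a r"
    unfolding polydisc_def by blast
next
  fix z assume "z \<in> (\<lambda>z. c *\<^sub>R z + (b - c *\<^sub>R a)) ` polydisc a r"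
  then obtain y where y: "y \<in> polydisc a r" "z = c *\<^sub>R y + (b - c *\<^sub>R a)" by auto
  have "z $ j - b $ j = c *\<^sub>R (y $ j - a $ j)" for j
    by (simp add: y algebra_simps)
  then show "z \<in> polydisc b (c *\<^sub>R r)"
    using y(1) assms by (simp add: polydisc_def)
qed

text \<open>An affine change of variables in real dimension 2n yields volume ratios of homothetic
  polydiscs without a product formula for the volume itself.\<close>

lemma emeasure_polydisc_scale:
  fixes a b :: "complex ^ 'n"
  assumes "0 < c"
  shows "emeasure lborel (polydisc b (c *\<^sub>R r)) = ennreal (c ^ (2 * CARD('n))) * emeasure lborel (polydisc a r)"
proof -
  have "emeasure lebesgue (polydisc b (c *\<^sub>R r)) = ennreal (\<bar>c\<bar> ^ DIM(complex ^ 'n)) * emeasure lebesgue (polydisc a r)"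
    unfolding polydisc_scale[OF assms, of b r a] by (subst emeasure_lebesgue_affine) (simp add: ennreal_power)
  then show ?thesis using assms by (simp add: mult.commute)
qed

text \<open>Raising the supremum to a constant above it can only increase the integrand; where
  \<open>\<phi> z = -\<infinity>\<close> both sides are infinite, whatever the supremum is.\<close>

lemma UO_le:
  assumes "\<And>z. z \<in> S \<Longrightarrow> \<phi> z \<le> ereal C"
  shows "UO S \<phi> \<le> (\<integral>\<^sup>+z\<in>S. e2ennreal (ereal C - \<phi> z) \<partial>lborel) / emeasure lebesgue S"
  unfolding UO_def nn_integral_completion
proof (intro divide_right_mono_ennreal nn_integral_mono)
  fix z
  have "\<bar>\<phi> z - (SUP w\<in>S. \<phi> w)\<bar> \<le> ereal C - \<phi> z" if "z \<in> S"
  proof -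
    have "\<phi> z \<le> (SUP w\<in>S. \<phi> w)" "(SUP w\<in>S. \<phi> w) \<le> ereal C"
      using that assms by (auto intro: SUP_upper SUP_least)
    then show ?thesis
      by (cases "\<phi> z"; cases "SUP w\<in>S. \<phi> w") auto
  qed
  then show "e2ennreal \<bar>\<phi> z - (SUP w\<in>S. \<phi> w)\<bar> * indicator S z \<le> e2ennreal (ereal C - \<phi> z) * indicator S z"
    by (auto simp: indicator_def intro: e2ennreal_mono)
qed

lemma PSH_UO_polydisc_le:
  fixes \<phi> :: "complex ^ 'n \<Rightarrow> ereal" and r :: "real ^ 'n"
  assumes \<phi>: "\<phi> \<in> PSH \<Omega>" and \<Omega>: "open \<Omega>" and r: "\<And>j. 0 < r $ j"
    and sub: "closed_polydisc a ((5/3) *\<^sub>R r) \<subseteq> \<Omega>"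
    and C: "\<And>z. z \<in> closed_polydisc a ((5/3) *\<^sub>R r) \<Longrightarrow> \<phi> z \<le> ereal C"
    and b: "b \<in> closed_polydisc a ((1/3) *\<^sub>R r)" and m: "\<phi> b = ereal m"
  shows "UO (polydisc a r) \<phi> \<le> ennreal ((16/9) ^ CARD('n) * (C - m))"
proof -
  define P where "P = polydisc a r"
  define Q where "Q = polydisc b ((4/3) *\<^sub>R r)"
  have [measurable]: "P \<in> sets borel" "Q \<in> sets borel" by (simp_all add: P_def Q_def)
  have PQ: "P \<subseteq> Q"
  proof
    fix z assume z: "z \<in> P"
    have "cmod (z $ j - b $ j) < 4/3 * r $ j" for j
    proof -
      have "cmod (z $ j - b $ j) \<le> cmod (z $ j - a $ j) + cmod (b $ j - a $ j)"
        using norm_triangle_ineq4[of "z $ j - a $ j" "b $ j - a $ j"] by simp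
      moreover have "cmod (z $ j - a $ j) < r $ j" "cmod (b $ j - a $ j) \<le> 1/3 * r $ j"
        using z b by (auto simp: P_def polydisc_def closed_polydisc_def)
      ultimately show ?thesis by simp
    qed
    then show "z \<in> Q" by (simp add: Q_def polydisc_def)
  qed
  have Qsub: "Q \<subseteq> closed_polydisc a ((5/3) *\<^sub>R r)"
  proof
    fix z assume z: "z \<in> Q"
    have "cmod (z $ j - a $ j) \<le> 5/3 * r $ j" for j
    proof -
      have "cmod (z $ j - a $ j) \<le> cmod (z $ j - b $ j) + cmod (b $ j - a $ j)"
        using norm_triangle_ineq[of "z $ j - b $ j" "b $ j - a $ j"] by simp
      moreover have "cmod (z $ j - b $ j) < 4/3 * r $ j" "cmod (b $ j - a $ j) \<le> 1/3 * r $ j"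
        using z b by (auto simp: Q_def polydisc_def closed_polydisc_def)
      ultimately show ?thesis by simp
    qed
    then show "z \<in> closed_polydisc a ((5/3) *\<^sub>R r)" by (simp add: closed_polydisc_def)
  qed
  have bal: "b + t *s (z - b) \<in> Q" if "z \<in> Q" "cmod t \<le> 1" for z t
  proof -
    have "cmod ((b + t *s (z - b)) $ j - b $ j) < 4/3 * r $ j" for j
    proof -
      have "cmod ((b + t *s (z - b)) $ j - b $ j) = cmod t * cmod (z $ j - b $ j)"
        by (simp flip: norm_mult add: right_diff_distrib)
      also have "\<dots> \<le> cmod (z $ j - b $ j)"
        using that(2) by (simp add: mult_left_le_one_le)
      also have "\<dots> < 4/3 * r $ j"
        using that(1) by (simp add: Q_def polydisc_def)
      finally show ?thesis .
    qed
    then show ?thesis by (simp add: Q_def polydisc_def)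
  qed
  have "(\<integral>\<^sup>+z\<in>P. e2ennreal (ereal C - \<phi> z) \<partial>lborel) \<le> (\<integral>\<^sup>+z\<in>Q. e2ennreal (ereal C - \<phi> z) \<partial>lborel)"
    using PQ by (intro nn_integral_mono) (auto simp: indicator_def)
  \<comment> \<open>\<open>Q\<close> is balanced about \<open>b\<close>, so the averaged mean value
    inequality applies with centre \<open>b\<close>.\<close>
  also have "\<dots> \<le> ennreal (C - m) * emeasure lborel Q"
    using Qsub sub C by (intro PSH_nn_integral_le[OF \<phi> \<Omega> _ _ bal _ m]) auto
  also have "emeasure lborel Q = ennreal ((4/3) ^ (2 * CARD('n))) * emeasure lborel P"
    unfolding Q_def P_def by (rule emeasure_polydisc_scale) simp
  finally have "(\<integral>\<^sup>+z\<in>P. e2ennreal (ereal C - \<phi> z) \<partial>lborel) / emeasure lebesgue P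
      \<le> (ennreal (C - m) * ennreal ((4/3) ^ (2 * CARD('n)))) * emeasure lborel P / emeasure lborel P"
    by (simp add: divide_right_mono_ennreal mult.assoc)
  also have "\<dots> = ennreal (C - m) * ennreal ((4/3) ^ (2 * CARD('n)))"
    using emeasure_polydisc_pos[OF r, of a] emeasure_polydisc_finite[of a r]
    by (intro ennreal_mult_divide_eq) (auto simp: P_def)
  also have "\<dots> = ennreal ((16/9) ^ CARD('n) * (C - m))"
  proof -
    have "((4/3)::real) ^ (2 * CARD('n)) = (16/9) ^ CARD('n)"
      unfolding power_mult by (simp add: power2_eq_square)
    then show ?thesis by (simp add: ennreal_mult'' mult.commute)
  qed
  finally have "(\<integral>\<^sup>+z\<in>P. e2ennreal (ereal C - \<phi> z) \<partial>lborel) / emeasure lebesgue P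
      \<le> ennreal ((16/9) ^ CARD('n) * (C - m))" .
  moreover have "UO P \<phi> \<le> (\<integral>\<^sup>+z\<in>P. e2ennreal (ereal C - \<phi> z) \<partial>lborel) / emeasure lebesgue P"
    using C Qsub PQ by (intro UO_le) auto
  ultimately show ?thesis unfolding P_def by (rule order_trans[rotated])
qed

text \<open>One complex line suffices: with \<open>\<tau>\<close> the largest quotient
  \<open>|z_j - a_j| / r_j\<close>, the line through \<open>a\<close> with direction
  \<open>w = (z - a) / \<tau>\<close> maps the circle of radius \<open>T\<close> into the closed
  polydisc of polyradius \<open>T r\<close> and meets \<open>z\<close> at the parameter
  \<open>\<tau> \<le> s\<close>.\<close>

lemma PSH_three_polydiscs:
  fixes \<phi> :: "complex ^ 'n \<Rightarrow> ereal" and r :: "real ^ 'n"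
  assumes \<phi>: "\<phi> \<in> PSH \<Omega>" and r: "\<And>j. 0 < r $ j" and t: "0 < t1" "t1 < t2"
    and sub: "closed_polydisc a (t2 *\<^sub>R r) \<subseteq> \<Omega>"
    and A: "\<And>z. z \<in> closed_polydisc a (t1 *\<^sub>R r) \<Longrightarrow> \<phi> z \<le> ereal A"
    and B: "\<And>z. z \<in> closed_polydisc a (t2 *\<^sub>R r) \<Longrightarrow> \<phi> z \<le> ereal B"
    and AB: "A \<le> B" and s: "t1 \<le> s" "s \<le> t2" and z: "z \<in> closed_polydisc a (s *\<^sub>R r)"
  shows "\<phi> z \<le> ereal (A + (B - A) * (ln (s / t1) / ln (t2 / t1)))"
proof -
  define q where "q j = cmod (z $ j - a $ j) / r $ j" for j
  define \<tau> where "\<tau> = Max (range q)"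
  have q\<tau>: "q j \<le> \<tau>" for j by (simp add: \<tau>_def)
  have "\<tau> \<in> range q" unfolding \<tau>_def by (rule Max_in) auto
  then have \<tau>s: "\<tau> \<le> s"
    using z r by (auto simp: q_def closed_polydisc_def divide_le_eq)
  have L: "ln (t2 / t1) > 0" using t by simp
  show ?thesis
  \<comment> \<open>Inside the inner radius the three circles theorem says nothing, but there
    \<open>A\<close> itself is a bound, and \<open>A \<le> B\<close> puts it below the interpolated
    value.\<close>
  proof (cases "\<tau> \<le> t1")
    case True
    have "cmod (z $ j - a $ j) \<le> t1 * r $ j" for j
      using order_trans[OF q\<tau>[of j] True] r[of j] by (simp add: q_def divide_le_eq)
    then have "\<phi> z \<le> ereal A" by (intro A) (simp add: closed_polydisc_def)
    also have "\<dots> \<le> ereal (A + (B - A) * (ln (s / t1) / ln (t2 / t1)))"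
      using AB L s t by simp
    finally show ?thesis .
  next
    case False
    then have \<tau>: "t1 < \<tau>" "0 < \<tau>" using t by auto
    define w where "w = (1 / complex_of_real \<tau>) *s (z - a)"
    have w: "cmod (w $ j) \<le> r $ j" for j
    proof -
      have "cmod (w $ j) = q j * r $ j / \<tau>"
      proof -
        have "w $ j = (z $ j - a $ j) / of_real \<tau>" by (simp add: w_def diff_divide_distrib)
        then show ?thesis using \<tau> r[of j] by (simp add: q_def norm_divide)
      qed
      also have "\<dots> \<le> r $ j"
        using q\<tau>[of j] r[of j] \<tau> by (simp add: divide_le_eq mult.commute mult_right_mono)
      finally show ?thesis .
    qed
    have zw: "z = a + of_real \<tau> *s w"
      using \<tau> by (simp add: w_def vector_smult_assoc)
    have mem: "a + \<zeta> *s w \<in> closed_polydisc a (T *\<^sub>R r)" if "cmod \<zeta> \<le> T" for \<zeta> T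
      using that w by (auto simp: closed_polydisc_def norm_mult intro!: mult_mono intro: order_trans[OF norm_ge_zero])
    have "\<phi> (a + of_real \<tau> *s w) \<le> ereal (A + (B - A) * (ln (cmod (of_real \<tau>) / t1) / ln (t2 / t1)))"
      using mem sub A B \<tau> \<tau>s s
      by (intro subharmonic_three_circles[OF PSH_subharmonic[OF \<phi>] t]) auto
    also have "\<dots> \<le> ereal (A + (B - A) * (ln (s / t1) / ln (t2 / t1)))"
      using AB L \<tau> \<tau>s t by (auto intro!: mult_left_mono divide_right_mono divide_right_mono)
    finally show ?thesis unfolding zw .
  qed
qed

subsection \<open>Local integrability and functions of logarithmic growth\<close>

lemma PSH_bounded_above:
  assumes \<phi>: "\<phi> \<in> PSH \<Omega>" and K: "compact K" "K \<subseteq> \<Omega>"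
  shows "\<exists>C. \<forall>z\<in>K. \<phi> z \<le> ereal C"
proof (cases "K = {}")
  case False
  obtain x where x: "x \<in> K" "\<forall>y\<in>K. \<phi> y \<le> \<phi> x"
    using usc_attains_max[OF usc_on_subset[OF PSH_usc_on[OF \<phi>] K(2)] K(1) False] by blast
  have "\<phi> x < \<infinity>" using PSH_less_top[OF \<phi>] x K by auto
  then obtain C where "\<phi> x \<le> ereal C" by (cases "\<phi> x") auto
  then show ?thesis using x by (meson order_trans)
qed auto

lemma PSH_nn_integral_abs_le:
  fixes \<phi> :: "complex ^ 'n \<Rightarrow> ereal"
  assumes \<phi>: "\<phi> \<in> PSH \<Omega>" and \<Omega>: "open \<Omega>" and S [measurable]: "S \<in> sets borel" and sub: "S \<subseteq> \<Omega>"
    and C: "\<And>z. z \<in> S \<Longrightarrow> \<phi> z \<le> ereal C"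
  shows "(\<integral>\<^sup>+z\<in>S. e2ennreal \<bar>\<phi> z\<bar> \<partial>lborel)
    \<le> (\<integral>\<^sup>+z\<in>S. e2ennreal (ereal C - \<phi> z) \<partial>lborel) + ennreal \<bar>C\<bar> * emeasure lborel S"
proof -
  have *: "e2ennreal \<bar>x\<bar> \<le> e2ennreal (ereal C - x) + ennreal \<bar>C\<bar>" if "x \<le> ereal C" for x
  proof (cases x)
    case (real y)
    then have "ennreal \<bar>y\<bar> \<le> ennreal (C - y + \<bar>C\<bar>)"
      using that by (intro ennreal_leI) auto
    also have "\<dots> = ennreal (C - y) + ennreal \<bar>C\<bar>"
      using that real by (intro ennreal_plus) auto
    finally show ?thesis using real by simp
  qed (use that in auto)
  have "(\<lambda>z. e2ennreal (ereal C - (if z \<in> \<Omega> then \<phi> z else 0)) * indicator S z) \<in> borel_measurable borel"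
    using usc_on_borel_measurable[OF \<Omega> PSH_usc_on[OF \<phi>], of 0] by measurable
  also have "(\<lambda>z. e2ennreal (ereal C - (if z \<in> \<Omega> then \<phi> z else 0)) * indicator S z)
      = (\<lambda>z. e2ennreal (ereal C - \<phi> z) * indicator S z)"
    using sub by (auto simp: indicator_def fun_eq_iff)
  finally have [measurable]: "(\<lambda>z. e2ennreal (ereal C - \<phi> z) * indicator S z) \<in> borel_measurable borel" .
  have "(\<integral>\<^sup>+z\<in>S. e2ennreal \<bar>\<phi> z\<bar> \<partial>lborel)
      \<le> (\<integral>\<^sup>+z. e2ennreal (ereal C - \<phi> z) * indicator S z + ennreal \<bar>C\<bar> * indicator S z \<partial>lborel)"
    using * C by (intro nn_integral_mono) (auto simp: indicator_def)
  also have "\<dots> = (\<integral>\<^sup>+z\<in>S. e2ennreal (ereal C - \<phi> z) \<partial>lborel) + ennreal \<bar>C\<bar> * emeasure lborel S"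
    by (subst nn_integral_add) (auto simp: nn_integral_cmult_indicator)
  finally show ?thesis .
qed

text \<open>A Euclidean ball is balanced about its centre, so the mean value estimate turns one
  finite value \<open>\<phi> b\<close> into integrability on the ball.\<close>

lemma PSH_ball_integrable:
  fixes \<phi> :: "complex ^ 'n \<Rightarrow> ereal"
  assumes \<phi>: "\<phi> \<in> PSH \<Omega>" and \<Omega>: "open \<Omega>" and sub: "cball b \<rho> \<subseteq> \<Omega>"
    and b: "b \<in> \<Omega>" "\<phi> b \<noteq> -\<infinity>"
  shows "(\<integral>\<^sup>+z\<in>ball b \<rho>. e2ennreal \<bar>\<phi> z\<bar> \<partial>lborel) < \<infinity>"
proof -
  obtain m where m: "\<phi> b = ereal m"
    using PSH_less_top[OF \<phi> b(1)] b(2) by (cases "\<phi> b") auto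
  obtain C where C: "\<And>z. z \<in> cball b \<rho> \<Longrightarrow> \<phi> z \<le> ereal C"
    using PSH_bounded_above[OF \<phi> compact_cball sub] by blast
  have bal: "b + t *s (z - b) \<in> ball b \<rho>" if "z \<in> ball b \<rho>" "cmod t \<le> 1" for z t
  proof -
    have "norm (t *s (z - b)) = cmod t * norm (z - b)"
      by (simp only: norm_vec_def vector_smult_component norm_mult) (simp add: L2_set_right_distrib)
    also have "\<dots> \<le> norm (z - b)"
      using that(2) by (simp add: mult_left_le_one_le)
    finally show ?thesis
      using that(1) by (simp add: dist_norm norm_minus_commute)
  qed
  have "(\<integral>\<^sup>+z\<in>ball b \<rho>. e2ennreal \<bar>\<phi> z\<bar> \<partial>lborel)
      \<le> (\<integral>\<^sup>+z\<in>ball b \<rho>. e2ennreal (ereal C - \<phi> z) \<partial>lborel) + ennreal \<bar>C\<bar> * emeasure lborel (ball b \<rho>)"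
    using sub C ball_subset_cball by (intro PSH_nn_integral_abs_le[OF \<phi> \<Omega>]) auto
  also have "\<dots> \<le> ennreal (C - m) * emeasure lborel (ball b \<rho>) + ennreal \<bar>C\<bar> * emeasure lborel (ball b \<rho>)"
    using sub C ball_subset_cball by (intro add_mono order_refl PSH_nn_integral_le[OF \<phi> \<Omega> _ _ bal _ m]) auto
  also have "\<dots> < \<infinity>"
    using emeasure_lborel_ball_finite[of b \<rho>] by (simp add: ennreal_mult_less_top)
  finally show ?thesis .
qed

text \<open>Connectedness: the closure in \<Omega> of the set of finite values is also open. A
  finite value at a point \<open>b\<close> close to \<open>z\<close> makes \<phi> integrable on a
  ball about \<open>b\<close> that covers a neighbourhood of \<open>z\<close>, which excludes any
  smaller ball where \<phi> is -\<infinity>.\<close>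

lemma PSH_finite_dense:
  fixes \<phi> :: "complex ^ 'n \<Rightarrow> ereal"
  assumes \<phi>: "\<phi> \<in> PSH \<Omega>" and \<Omega>: "is_domain \<Omega>"
  shows "\<Omega> \<subseteq> closure {z \<in> \<Omega>. \<phi> z \<noteq> -\<infinity>}"
proof -
  define F where "F = {z \<in> \<Omega>. \<phi> z \<noteq> -\<infinity>}"
  have o: "open \<Omega>" and con: "connected \<Omega>" using \<Omega> by (auto simp: is_domain_def)
  have ball: "\<exists>\<rho>>0. ball z \<rho> \<subseteq> \<Omega> \<inter> closure F" if z: "z \<in> \<Omega>" "z \<in> closure F" for z
  proof -
    obtain e where e: "e > 0" "cball z e \<subseteq> \<Omega>" using o z open_contains_cball by blast
    \<comment> \<open>With \<open>dist b z < \<rho>\<close>, the ball of radius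
      \<open>2 * \<rho>\<close> about \<open>b\<close> contains \<open>ball z \<rho>\<close> and
      stays within distance \<open>3 * \<rho> = e\<close> of \<open>z\<close>.\<close>
    define \<rho> where "\<rho> = e / 3"
    have \<rho>: "\<rho> > 0" using e by (simp add: \<rho>_def)
    obtain b where b: "b \<in> F" "dist b z < \<rho>" using z(2) \<rho> by (meson closure_approachable)
    have "cball b (2 * \<rho>) \<subseteq> cball z e"
      using b(2) by (simp add: cball_subset_cball_iff \<rho>_def)
    then have fin: "(\<integral>\<^sup>+y\<in>ball b (2 * \<rho>). e2ennreal \<bar>\<phi> y\<bar> \<partial>lborel) < \<infinity>"
      using b e by (intro PSH_ball_integrable[OF \<phi> o]) (auto simp: F_def)
    have "y \<in> closure F" if y: "y \<in> ball z \<rho>" for y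
    proof (rule ccontr)
      assume "y \<notin> closure F"
      then have "y \<in> ball z \<rho> - closure F" "open (ball z \<rho> - closure F)" using y by auto
      then obtain \<delta> where \<delta>: "\<delta> > 0" "ball y \<delta> \<subseteq> ball z \<rho> - closure F"
        using open_contains_ball by blast
      have sub: "ball y \<delta> \<subseteq> ball b (2 * \<rho>)"
      proof
        fix x assume "x \<in> ball y \<delta>"
        then have "dist z x < \<rho>" using \<delta> by auto
        then show "x \<in> ball b (2 * \<rho>)" using b(2) dist_triangle[of b x z] by simp
      qed
      have inf: "\<phi> x = -\<infinity>" if "x \<in> ball y \<delta>" for x
      proof -
        have "x \<notin> F" "x \<in> ball z \<rho>" using that \<delta>(2) closure_subset[of F] by blast+
        moreover have "ball z \<rho> \<subseteq> \<Omega>" using e \<rho> by (auto simp: \<rho>_def)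
        ultimately show ?thesis by (auto simp: F_def)
      qed
      have "\<infinity> * emeasure lborel (ball y \<delta>) = (\<integral>\<^sup>+x. \<infinity> * indicator (ball y \<delta>) x \<partial>lborel)"
        by (subst nn_integral_cmult_indicator) auto
      also have "\<dots> \<le> (\<integral>\<^sup>+y\<in>ball b (2 * \<rho>). e2ennreal \<bar>\<phi> y\<bar> \<partial>lborel)"
        using sub inf by (intro nn_integral_mono) (auto simp: indicator_def)
      finally have "\<infinity> * emeasure lborel (ball y \<delta>) < \<infinity>" using fin by simp
      moreover have "emeasure lborel (ball y \<delta>) \<noteq> 0"
        using open_not_negligible[of "ball y \<delta>"] \<delta>(1) by (auto simp: negligible_iff_null_sets null_sets_def)
      ultimately show False by (simp add: ennreal_top_mult)
    qed
    then show ?thesis using \<rho> e by (intro exI[of _ \<rho>]) (auto simp: \<rho>_def)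
  qed
  have "open (\<Omega> \<inter> closure F)"
    unfolding open_contains_ball using ball by blast
  then have "openin (top_of_set \<Omega>) (\<Omega> \<inter> closure F)"
    using o by (auto simp: openin_open_eq)
  moreover have "closedin (top_of_set \<Omega>) (\<Omega> \<inter> closure F)"
    by (auto simp: closedin_closed)
  moreover have "\<Omega> \<inter> closure F \<noteq> {}"
    using \<phi> closure_subset[of F] by (auto simp: PSH_def F_def)
  ultimately have "\<Omega> \<inter> closure F = \<Omega>"
    using con connected_clopen by blast
  then show ?thesis by (auto simp: F_def)
qed

text \<open>By density each point of \<open>K\<close> is close to one where \<phi> is finite, hence
  has a ball with finite integral; finitely many of these balls cover \<open>K\<close>.\<close>

lemma PSH_in_L1_loc:
  fixes \<phi> :: "complex ^ 'n \<Rightarrow> ereal"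
  assumes \<phi>: "\<phi> \<in> PSH \<Omega>" and \<Omega>: "is_domain \<Omega>"
  shows "\<phi> \<in> L1_loc \<Omega>"
  unfolding L1_loc_def
proof (intro CollectI conjI allI impI)
  have o: "open \<Omega>" using \<Omega> by (auto simp: is_domain_def)
  have "(\<lambda>z. if z \<in> \<Omega> then \<phi> z else 0) \<in> borel_measurable lebesgue"
    using usc_on_borel_measurable[OF o PSH_usc_on[OF \<phi>], of 0] by (intro measurable_completion) simp
  then have "(\<lambda>z. if z \<in> \<Omega> then \<phi> z else 0) \<in> borel_measurable (lebesgue_on \<Omega>)"
    by (rule measurable_restrict_space1)
  then show "\<phi> \<in> borel_measurable (lebesgue_on \<Omega>)"
    by (rule measurable_cong[THEN iffD1, rotated]) simp
  fix K assume K: "compact K \<and> K \<subseteq> \<Omega>"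
  have "\<exists>\<rho>>0. (\<integral>\<^sup>+y\<in>ball z \<rho>. e2ennreal \<bar>\<phi> y\<bar> \<partial>lborel) < \<infinity>" if z: "z \<in> K" for z
  proof -
    have z': "z \<in> \<Omega>" using z K by auto
    then obtain e where e: "e > 0" "cball z e \<subseteq> \<Omega>" using o open_contains_cball by blast
    define \<rho> where "\<rho> = e / 3"
    have \<rho>: "\<rho> > 0" using e by (simp add: \<rho>_def)
    have "z \<in> closure {z \<in> \<Omega>. \<phi> z \<noteq> -\<infinity>}" using PSH_finite_dense[OF \<phi> \<Omega>] z' by auto
    then obtain b where b: "b \<in> \<Omega>" "\<phi> b \<noteq> -\<infinity>" "dist b z < \<rho>"
      using \<rho> by (auto simp: closure_approachable)
    have "cball b (2 * \<rho>) \<subseteq> cball z e"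
      using b(3) by (simp add: cball_subset_cball_iff \<rho>_def)
    then have fin: "(\<integral>\<^sup>+y\<in>ball b (2 * \<rho>). e2ennreal \<bar>\<phi> y\<bar> \<partial>lborel) < \<infinity>"
      using b e by (intro PSH_ball_integrable[OF \<phi> o]) auto
    have "ball z \<rho> \<subseteq> ball b (2 * \<rho>)"
      using b(3) by (simp add: ball_subset_ball_iff dist_commute)
    then have "(\<integral>\<^sup>+y\<in>ball z \<rho>. e2ennreal \<bar>\<phi> y\<bar> \<partial>lborel) \<le> (\<integral>\<^sup>+y\<in>ball b (2 * \<rho>). e2ennreal \<bar>\<phi> y\<bar> \<partial>lborel)"
      by (intro nn_integral_mono) (auto simp: indicator_def)
    with fin \<rho> show ?thesis by (auto intro: order_le_less_trans)
  qed
  then obtain \<rho> where \<rho>: "\<And>z. z \<in> K \<Longrightarrow> \<rho> z > 0"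
      "\<And>z. z \<in> K \<Longrightarrow> (\<integral>\<^sup>+y\<in>ball z (\<rho> z). e2ennreal \<bar>\<phi> y\<bar> \<partial>lborel) < \<infinity>" by metis
  obtain D where D: "D \<subseteq> K" "finite D" "K \<subseteq> (\<Union>z\<in>D. ball z (\<rho> z))"
  proof (rule compactE_image[of K K "\<lambda>z. ball z (\<rho> z)"])
    show "compact K" using K by simp
    show "K \<subseteq> (\<Union>z\<in>K. ball z (\<rho> z))" using \<rho>(1) by auto
  qed auto
  define f where "f y = e2ennreal \<bar>if y \<in> \<Omega> then \<phi> y else 0\<bar>" for y
  have [measurable]: "f \<in> borel_measurable borel"
    unfolding f_def using usc_on_borel_measurable[OF o PSH_usc_on[OF \<phi>], of 0] by measurable
  have "(\<integral>\<^sup>+z\<in>K. e2ennreal \<bar>\<phi> z\<bar> \<partial>lebesgue) \<le> (\<integral>\<^sup>+y. (\<Sum>z\<in>D. f y * indicator (ball z (\<rho> z)) y) \<partial>lborel)"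
    unfolding nn_integral_completion
  proof (intro nn_integral_mono)
    fix y
    show "e2ennreal \<bar>\<phi> y\<bar> * indicator K y \<le> (\<Sum>z\<in>D. f y * indicator (ball z (\<rho> z)) y)"
    proof (cases "y \<in> K")
      case True
      then obtain z where z: "z \<in> D" "y \<in> ball z (\<rho> z)" using D by auto
      have "e2ennreal \<bar>\<phi> y\<bar> = f y * indicator (ball z (\<rho> z)) y"
        using z True K by (auto simp: f_def)
      also have "\<dots> \<le> (\<Sum>z\<in>D. f y * indicator (ball z (\<rho> z)) y)"
        using z D by (intro member_le_sum) auto
      finally show ?thesis using True by simp
    qed simp
  qed
  also have "\<dots> = (\<Sum>z\<in>D. (\<integral>\<^sup>+y. f y * indicator (ball z (\<rho> z)) y \<partial>lborel))"
    by (rule nn_integral_sum) (intro borel_measurable_times_ennreal borel_measurable_indicator, auto)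
  also have "\<dots> < \<infinity>"
  proof -
    have "(\<integral>\<^sup>+y. f y * indicator (ball z (\<rho> z)) y \<partial>lborel) < \<infinity>" if "z \<in> D" for z
    proof -
      have "(\<integral>\<^sup>+y. f y * indicator (ball z (\<rho> z)) y \<partial>lborel) \<le> (\<integral>\<^sup>+y\<in>ball z (\<rho> z). e2ennreal \<bar>\<phi> y\<bar> \<partial>lborel)"
        by (intro nn_integral_mono) (auto simp: f_def zero_ennreal.abs_eq[symmetric] indicator_def)
      then show ?thesis using \<rho>(2) that D by (auto intro: order_le_less_trans)
    qed
    then show ?thesis using D(2) by (simp add: less_top)
  qed
  finally show "(\<integral>\<^sup>+z\<in>K. e2ennreal \<bar>\<phi> z\<bar> \<partial>lebesgue) < \<infinity>" .
qed

lemma L1_loc_mono: "\<phi> \<in> L1_loc \<Omega> \<Longrightarrow> \<Omega>' \<subseteq> \<Omega> \<Longrightarrow> \<phi> \<in> L1_loc \<Omega>'"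
  unfolding L1_loc_def by (auto intro: measurable_restrict_mono)

text \<open>Density of the finite values keeps the attained maximum from being -\<infinity>; it is a
  real number, as the subtractions in the oscillation estimates demand.\<close>

lemma PSH_max_polydisc:
  fixes \<phi> :: "complex ^ 'n \<Rightarrow> ereal" and r :: "real ^ 'n"
  assumes \<phi>: "\<phi> \<in> PSH \<Omega>" and \<Omega>: "is_domain \<Omega>" and r: "\<And>j. 0 < r $ j"
    and sub: "closed_polydisc a r \<subseteq> \<Omega>"
  obtains b m where "b \<in> closed_polydisc a r" "\<phi> b = ereal m" "\<forall>z\<in>closed_polydisc a r. \<phi> z \<le> ereal m"
proof -
  have a: "a \<in> polydisc a r" using r by (rule polydisc_center)
  have ne: "closed_polydisc a r \<noteq> {}" using a polydisc_subset_closed_polydisc by auto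
  obtain b where b: "b \<in> closed_polydisc a r" "\<forall>z\<in>closed_polydisc a r. \<phi> z \<le> \<phi> b"
    using usc_attains_max[OF usc_on_subset[OF PSH_usc_on[OF \<phi>] sub] compact_closed_polydisc ne] by blast
  have "a \<in> closure {z \<in> \<Omega>. \<phi> z \<noteq> -\<infinity>}"
    using PSH_finite_dense[OF \<phi> \<Omega>] a polydisc_subset_closed_polydisc sub by blast
  then obtain y where "y \<in> polydisc a r" "\<phi> y \<noteq> -\<infinity>"
    using a open_polydisc[of a r] by (auto simp: closure_iff_nhds_not_empty)
  then have "\<phi> b \<noteq> -\<infinity>"
    using b(2) polydisc_subset_closed_polydisc[of a r] by (metis ereal_infty_less_eq(2) subsetD)
  moreover have "\<phi> b < \<infinity>" using PSH_less_top[OF \<phi>] b sub by blast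
  ultimately obtain m where "\<phi> b = ereal m" by (cases "\<phi> b") auto
  with b that show thesis by metis
qed

section \<open>Logarithmic growth and the constant 3^n\<close>

lemma ln_5_less: "ln 5 < (27/16 :: real)"
proof -
  \<comment> \<open>\<open>5^3 = 125\<close> is below \<open>2^7 = 128\<close>, so
    \<open>ln 5 \<le> 7/3 * ln 2 \<le> 175/108\<close>; the target 27/16 is
    \<open>3 / (16/9)\<close>.\<close>
  have "3 * ln (5::real) = ln (5 ^ 3)" using ln_realpow[of "5::real" 3] by simp
  also have "\<dots> \<le> ln (2 ^ 7)" by simp
  also have "\<dots> = 7 * ln (2::real)" using ln_realpow[of "2::real" 7] by simp
  finally show ?thesis using ln2_le_25_over_36 by simp
qed

lemma Max_ln_le:
  fixes z :: "complex ^ 'n"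
  assumes "\<And>j. 1 + cmod (z $ j) \<le> R"
  shows "(MAX j. ln (1 + cmod (z $ j))) \<le> ln R"
proof -
  have "ln (1 + cmod (z $ j)) \<le> ln R" for j
    using assms[of j] by (intro ln_mono) (auto intro: add_pos_nonneg)
  then show ?thesis by simp
qed

lemma is_domain_UNIV: "is_domain UNIV"
  by (simp add: is_domain_def convex_connected)

text \<open>Logarithmic growth bounds the slope of the function \<open>ln t \<mapsto> sup \<phi>\<close> over the polydiscs of
  polyradius \<open>t r\<close>, which is convex by the three circles theorem, by \<open>1\<close>.\<close>

lemma PSH_log_growth_UO_less:
  fixes \<phi> :: "complex ^ 'n \<Rightarrow> ereal" and r :: "real ^ 'n"
  assumes \<phi>: "\<phi> \<in> PSH UNIV" and r: "\<And>j. 0 < r $ j"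
    and growth: "\<And>z. \<phi> z \<le> ereal (c + (MAX j. ln (1 + cmod (z $ j))))"
  shows "UO (polydisc a r) \<phi> < 3 ^ CARD('n)"
proof -
  have r3: "\<And>j. 0 < ((1/3) *\<^sub>R r) $ j" using r by simp
  obtain b A where b: "b \<in> closed_polydisc a ((1/3) *\<^sub>R r)" "\<phi> b = ereal A"
      and A: "\<forall>z\<in>closed_polydisc a ((1/3) *\<^sub>R r). \<phi> z \<le> ereal A"
    using PSH_max_polydisc[OF \<phi> is_domain_UNIV r3] by blast
  \<comment> \<open>For \<open>T \<ge> 1\<close> each \<open>z\<close> in the polydisc of polyradius
    \<open>T r\<close> satisfies \<open>1 + |z_j| \<le> T * R0\<close>, which turns the growth
    condition into the bound \<open>E + ln T\<close>.\<close>
  define R0 where "R0 = 1 + (\<Sum>j\<in>UNIV. cmod (a $ j) + r $ j)"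
  have R0: "1 + cmod (a $ j) + r $ j \<le> R0" for j
    unfolding R0_def using member_le_sum[of j UNIV "\<lambda>j. cmod (a $ j) + r $ j"] r
    by (simp add: add_nonneg_pos less_imp_le)
  have R0pos: "R0 > 0" unfolding R0_def using r by (intro add_pos_nonneg sum_nonneg) (auto simp: add_nonneg_pos less_imp_le)
  define E where "E = c + ln R0"
  have bound: "\<phi> z \<le> ereal (E + ln T)" if T: "1 \<le> T" and z: "z \<in> closed_polydisc a (T *\<^sub>R r)" for T z
  proof -
    have "1 + cmod (z $ j) \<le> T * R0" for j
    proof -
      have "cmod (z $ j) \<le> cmod (a $ j) + T * r $ j"
        using z norm_triangle_sub[of "z $ j" "a $ j"] by (auto simp: closed_polydisc_def dest!: spec[of _ j])
      also have "\<dots> \<le> T * cmod (a $ j) + T * r $ j"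
        using T by (simp add: mult_left_mono mult_le_cancel_right1)
      finally have "1 + cmod (z $ j) \<le> T * (1 + cmod (a $ j) + r $ j)"
        using T by (simp add: algebra_simps)
      also have "\<dots> \<le> T * R0" using R0[of j] T by (intro mult_left_mono) auto
      finally show ?thesis .
    qed
    then have "(MAX j. ln (1 + cmod (z $ j))) \<le> ln (T * R0)" by (rule Max_ln_le)
    also have "\<dots> = ln T + ln R0" using T R0pos by (simp add: ln_mult)
    finally have "c + (MAX j. ln (1 + cmod (z $ j))) \<le> E + ln T" unfolding E_def by linarith
    then show ?thesis using growth[of z] by (meson ereal_less_eq(3) order_trans)
  qed
  \<comment> \<open>Three circles with inner scale 1/3 and outer scale \<open>T\<close>, as
    \<open>T\<close> tends to \<infinity>. Taking \<open>ln T \<ge> A - E\<close> makes the outer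
    bound at least the inner one, and \<open>(E + ln T - A) / ln (3 * T)\<close> tends to 1.\<close>
  have le: "\<phi> z \<le> ereal (A + ln 5)" if z: "z \<in> closed_polydisc a ((5/3) *\<^sub>R r)" for z
  proof -
    have "\<forall>\<^sub>F T in at_top. \<phi> z \<le> ereal (A + (E + ln T - A) * (ln 5 / ln (3 * T)))"
    proof -
      have "\<forall>\<^sub>F T::real in at_top. A - E \<le> ln T"
        using ln_at_top by (simp add: filterlim_at_top)
      then show ?thesis
        using eventually_ge_at_top[of 2]
      proof eventually_elim
        case (elim T)
        have "\<phi> z \<le> ereal (A + ((E + ln T) - A) * (ln ((5/3) / (1/3)) / ln (T / (1/3))))"
          using A elim bound z by (intro PSH_three_polydiscs[OF \<phi> r]) auto
        then show ?case by (simp add: mult.commute)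
      qed
    qed
    moreover have "((\<lambda>T. A + (E + ln T - A) * (ln 5 / ln (3 * T))) \<longlongrightarrow> A + ln 5) at_top"
      by real_asymp
    then have "((\<lambda>T. ereal (A + (E + ln T - A) * (ln 5 / ln (3 * T)))) \<longlongrightarrow> ereal (A + ln 5)) at_top"
      by (rule tendsto_ereal)
    ultimately show ?thesis
      by (intro tendsto_lowerbound[of _ "ereal (A + ln 5)" at_top "\<phi> z"]) auto
  qed
  have "UO (polydisc a r) \<phi> \<le> ennreal ((16/9) ^ CARD('n) * (A + ln 5 - A))"
    using le b by (intro PSH_UO_polydisc_le[OF \<phi> _ r]) auto
  also have "\<dots> < ennreal (3 ^ CARD('n))"
  proof (intro ennreal_lessI)
    \<comment> \<open>\<open>16/9 * 27/16 = 3\<close>, and \<open>27/16 > 1\<close> lets the single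
      factor \<open>ln 5\<close> be absorbed into the n-th power.\<close>
    have "ln 5 < (27/16 :: real) ^ 1" using ln_5_less by simp
    also have "\<dots> \<le> (27/16) ^ CARD('n)" by (intro power_increasing) (auto simp: Suc_leI)
    finally have "(16/9) ^ CARD('n) * ln 5 < (16/9) ^ CARD('n) * (27/16 :: real) ^ CARD('n)" by simp
    also have "\<dots> = 3 ^ CARD('n)" by (simp flip: power_mult_distrib)
    finally show "(16/9) ^ CARD('n) * (A + ln 5 - A) < 3 ^ CARD('n)" by simp
  qed simp
  also have "\<dots> = 3 ^ CARD('n)" by (simp flip: ennreal_power)
  finally show ?thesis .
qed

text \<open>The Euclidean norm exceeds the largest modulus by a factor of at most n, which costs
  \<open>ln n\<close>. On a ball, where the Lelong condition gives no information, \<open>u\<close>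
  is bounded above and the maximum of the logarithms is nonnegative.\<close>

lemma Lelong_class_growth:
  fixes u :: "complex ^ 'n \<Rightarrow> ereal"
  assumes u: "u \<in> Lelong_class"
  shows "\<exists>c. \<forall>z. u z \<le> ereal (c + (MAX j. ln (1 + cmod (z $ j))))"
proof -
  have psh: "u \<in> PSH UNIV" and lim: "Limsup at_infinity (\<lambda>z. u z - ereal (ln (norm z))) < \<infinity>"
    using u by (auto simp: Lelong_class_def)
  obtain C where "Limsup at_infinity (\<lambda>z. u z - ereal (ln (norm z))) < ereal C"
    using ereal_dense2[OF lim] by blast
  from Limsup_lessD[OF this] obtain R where R: "\<And>z. R \<le> norm z \<Longrightarrow> u z - ereal (ln (norm z)) < ereal C"
    by (auto simp: eventually_at_infinity)
  obtain C' where C': "\<And>z. z \<in> cball 0 (max R 1) \<Longrightarrow> u z \<le> ereal C'"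
    using PSH_bounded_above[OF psh compact_cball subset_UNIV, of 0 "max R 1"] by blast
  define n where "n = real CARD('n)"
  have n: "n > 0" by (simp add: n_def)
  define c where "c = max (C + ln n) C'"
  have "u z \<le> ereal (c + (MAX j. ln (1 + cmod (z $ j))))" for z
  proof -
    define M where "M = (MAX j. ln (1 + cmod (z $ j)))"
    have M: "ln (1 + cmod (z $ j)) \<le> M" for j by (simp add: M_def)
    have "0 \<le> ln (1 + cmod (z $ undefined))" by (rule ln_ge_zero) simp
    then have M0: "0 \<le> M" using M order_trans by blast
    show ?thesis
    proof (cases "norm z \<le> max R 1")
      case True
      then have "u z \<le> ereal C'" by (intro C') simp
      also have "\<dots> \<le> ereal (c + M)" using M0 by (simp add: c_def)
      finally show ?thesis by (simp add: M_def)
    next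
      case False
      have "cmod (z $ j) \<le> exp M" for j
      proof -
        have "1 + cmod (z $ j) = exp (ln (1 + cmod (z $ j)))" by (subst exp_ln) (auto intro: add_pos_nonneg)
        also have "\<dots> \<le> exp M" using M by simp
        finally show ?thesis by simp
      qed
      then have "(\<Sum>j\<in>UNIV. cmod (z $ j)) \<le> n * exp M"
        unfolding n_def using sum_bounded_above[of UNIV "\<lambda>j. cmod (z $ j)" "exp M"] by simp
      moreover have "norm z \<le> (\<Sum>j\<in>UNIV. cmod (z $ j))"
        unfolding norm_vec_def by (rule L2_set_le_sum) simp
      ultimately have "norm z \<le> n * exp M" by simp
      then have "ln (norm z) \<le> ln (n * exp M)" using False by (intro ln_mono) auto
      also have "\<dots> = ln n + M" using n by (simp add: ln_mult)
      finally have ln: "ln (norm z) \<le> ln n + M" .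
      have "u z \<le> ereal (C + ln (norm z))"
      proof -
        have "R \<le> norm z" using False by simp
        from R[OF this] show ?thesis by (cases "u z") auto
      qed
      also have "\<dots> \<le> ereal (c + M)" using ln by (simp add: c_def)
      finally show ?thesis by (simp add: M_def)
    qed
  qed
  then show ?thesis by blast
qed

lemma Lelong_class_subset_BUO: "(Lelong_class :: (complex ^ 'n \<Rightarrow> ereal) set) \<subseteq> BUO UNIV (polydiscs UNIV)"
proof
  fix u :: "complex ^ 'n \<Rightarrow> ereal" assume u: "u \<in> Lelong_class"
  then have psh: "u \<in> PSH UNIV" by (simp add: Lelong_class_def)
  obtain c where c: "\<forall>z. u z \<le> ereal (c + (MAX j. ln (1 + cmod (z $ j))))"
    using Lelong_class_growth[OF u] by blast
  have "(SUP S\<in>polydiscs UNIV. UO S u) \<le> 3 ^ CARD('n)"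
  proof (rule SUP_least)
    fix S :: "(complex ^ 'n) set" assume "S \<in> polydiscs UNIV"
    then obtain a and r :: "real ^ 'n" where S: "S = polydisc a r" "\<And>j. 0 < r $ j" by (auto simp: polydiscs_def)
    show "UO S u \<le> 3 ^ CARD('n)"
      unfolding S(1) using PSH_log_growth_UO_less[OF psh S(2)] c by (intro less_imp_le) blast
  qed
  also have "\<dots> < \<infinity>"
    by (metis ennreal_less_top ennreal_numeral ennreal_power infinity_ennreal_def zero_le_numeral)
  finally show "u \<in> BUO UNIV (polydiscs UNIV)"
    using PSH_in_L1_loc[OF psh is_domain_UNIV] by (simp add: BUO_def)
qed

subsection \<open>Polydiscs of finite type\<close>

text \<open>When \<open>UO\<close> is finite, the supremum is real: in \<open>ereal\<close>, \<open>\<bar>\<phi> z - s\<bar> = \<infinity>\<close> whenever \<open>s\<close> is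
  infinite and \<open>\<phi> z \<le> s\<close>.\<close>

lemma MO_le_UO:
  fixes S :: "(complex ^ 'n) set"
  assumes S: "S \<in> sets borel" "emeasure lborel S \<noteq> 0" "emeasure lborel S < \<infinity>"
    and \<phi>: "\<phi> \<in> borel_measurable (lebesgue_on S)" and fin: "UO S \<phi> < \<infinity>"
  shows "MO S \<phi> \<le> 2 * UO S \<phi>"
proof -
  define c where "c = (SUP w\<in>S. \<phi> w)"
  define I where "I = (\<integral>\<^sup>+z\<in>S. e2ennreal \<bar>\<phi> z - c\<bar> \<partial>lebesgue)"
  define u where "u z = (if z \<in> S then \<phi> z else 0)" for z
  have [measurable]: "S \<in> sets lebesgue" using S(1) by simp
  have [measurable]: "u \<in> borel_measurable lebesgue"
    using \<phi> unfolding u_def by (subst (asm) measurable_restrict_space_iff[where c = 0]) auto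
  have le: "\<phi> z \<le> c" if "z \<in> S" for z using that unfolding c_def by (rule SUP_upper)
  obtain s where s: "emeasure lebesgue S = ennreal s" "0 < s"
  proof -
    obtain s where "emeasure lborel S = ennreal s" "0 \<le> s" using S(3) by (cases "emeasure lborel S") auto
    then show thesis using S by (intro that[of s]) (auto simp: less_le)
  qed
  have UO: "UO S \<phi> = I / ennreal s" by (simp add: UO_def I_def c_def s)
  have Ifin: "I < \<infinity>" using fin s unfolding UO by (cases I) (auto simp: ennreal_top_divide)
  have "\<bar>c\<bar> \<noteq> \<infinity>"
  proof
    assume c: "\<bar>c\<bar> = \<infinity>"
    have "\<bar>\<phi> z - c\<bar> = \<infinity>" if "z \<in> S" for z
      using le[OF that] c by (cases "\<phi> z"; cases c) auto
    then have "I = (\<integral>\<^sup>+z. \<infinity> * indicator S z \<partial>lebesgue)"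
      unfolding I_def by (intro nn_integral_cong) (auto simp: indicator_def)
    also have "\<dots> = \<infinity> * ennreal s" by (subst nn_integral_cmult_indicator) (simp_all add: s)
    finally show False using Ifin s by (simp add: ennreal_top_mult)
  qed
  then obtain c' where c': "c = ereal c'" by (cases c) auto
  obtain i where i: "I = ennreal i" "0 \<le> i" using Ifin by (cases I) auto
  have Iu: "I = (\<integral>\<^sup>+z\<in>S. e2ennreal (ereal c' - u z) \<partial>lebesgue)"
    unfolding I_def
  proof (intro nn_integral_cong)
    fix z
    have "\<bar>\<phi> z - c\<bar> = ereal c' - \<phi> z" if "z \<in> S"
      using le[OF that] by (cases "\<phi> z") (auto simp: c')
    then show "e2ennreal \<bar>\<phi> z - c\<bar> * indicator S z = e2ennreal (ereal c' - u z) * indicator S z"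
      by (auto simp: u_def indicator_def)
  qed
  \<comment> \<open>The mean is the supremum minus the upper oscillation, \<open>c' - i / s\<close>;
    it is computed on the measurable extension \<open>u\<close>.\<close>
  have "ereal_integral lebesgue S \<phi> = ereal_integral lebesgue S u"
    unfolding ereal_integral_def by (intro arg_cong2[where f = minus] arg_cong[where f = enn2ereal] nn_integral_cong)
      (auto simp: u_def indicator_def)
  also have "\<dots> = ereal (c' * s) - enn2ereal I"
    unfolding Iu using s le by (intro ereal_integral_bounded_above) (auto simp: u_def c')
  finally have "avg S \<phi> = ereal ((c' * s - i) / s)"
    using s i by (simp add: avg_def measure_def enn2ereal_ennreal)
  also have "(c' * s - i) / s = c' - i / s" using s by (simp add: field_simps)
  finally have avg: "avg S \<phi> = ereal (c' - i / s)" .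
  \<comment> \<open>Triangle inequality through the supremum:
    \<open>|\<phi> - avg| \<le> (c' - \<phi>) + (c' - avg)\<close>. Each term integrates to
    \<open>I\<close>, whence the factor 2.\<close>
  have is0: "0 \<le> i / s" using i s by simp
  have "(\<integral>\<^sup>+z\<in>S. e2ennreal \<bar>\<phi> z - avg S \<phi>\<bar> \<partial>lebesgue)
      \<le> (\<integral>\<^sup>+z. e2ennreal (ereal c' - u z) * indicator S z + ennreal (i / s) * indicator S z \<partial>lebesgue)"
  proof (intro nn_integral_mono)
    fix z
    have "e2ennreal \<bar>\<phi> z - avg S \<phi>\<bar> \<le> e2ennreal (ereal c' - \<phi> z) + ennreal (i / s)" if "z \<in> S"
    proof (cases "\<phi> z")
      case (real x)
      then have "x \<le> c'" using le[OF that] by (simp add: c')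
      then have "ennreal \<bar>x - (c' - i / s)\<bar> \<le> ennreal ((c' - x) + i / s)"
        using is0 by (intro ennreal_leI) auto
      also have "\<dots> = ennreal (c' - x) + ennreal (i / s)"
        using is0 \<open>x \<le> c'\<close> by (intro ennreal_plus) auto
      finally show ?thesis using real by (simp add: avg)
    qed (use le[OF that] in \<open>auto simp: avg c'\<close>)
    then show "e2ennreal \<bar>\<phi> z - avg S \<phi>\<bar> * indicator S z
        \<le> e2ennreal (ereal c' - u z) * indicator S z + ennreal (i / s) * indicator S z"
      by (auto simp: u_def indicator_def)
  qed
  also have "\<dots> = I + ennreal (i / s) * ennreal s"
    by (subst nn_integral_add) (auto simp: Iu nn_integral_cmult_indicator s)
  also have "ennreal (i / s) * ennreal s = I"
    using i s by (simp flip: ennreal_mult)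
  finally have "MO S \<phi> \<le> (I + I) / ennreal s"
    unfolding MO_def s by (rule divide_right_mono_ennreal)
  also have "\<dots> = 2 * UO S \<phi>"
    unfolding UO by (simp add: mult_2[symmetric] ennreal_times_divide)
  finally show ?thesis .
qed

lemma polydiscs_type_subset_polydiscs: "polydiscs_type N \<Omega> \<subseteq> polydiscs \<Omega>"
  by (auto simp: polydiscs_type_def polydiscs_def)

lemma BUO_subset_BMO:
  fixes \<Omega> :: "(complex ^ 'n) set"
  assumes \<S>: "\<S> \<subseteq> polydiscs \<Omega>"
  shows "BUO \<Omega> \<S> \<subseteq> BMO \<Omega> \<S>"
proof
  fix \<phi> :: "complex ^ 'n \<Rightarrow> ereal"
  assume \<phi>: "\<phi> \<in> BUO \<Omega> \<S>"
  define B where "B = (SUP S\<in>\<S>. UO S \<phi>)"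
  have B: "B < \<infinity>" and L1: "\<phi> \<in> L1_loc \<Omega>" using \<phi> by (auto simp: BUO_def B_def)
  have "(SUP S\<in>\<S>. MO S \<phi>) \<le> 2 * B"
  proof (rule SUP_least)
    fix S assume S: "S \<in> \<S>"
    then obtain a and r :: "real ^ 'n" where P: "S = polydisc a r" "\<And>j. 0 < r $ j" "S \<subset>\<subset> \<Omega>"
      using \<S> by (auto simp: polydiscs_def)
    have "S \<subseteq> \<Omega>" using P(3) closure_subset[of S] by (auto simp: relatively_compact_in_def)
    then have meas: "\<phi> \<in> borel_measurable (lebesgue_on S)"
      using L1 by (auto simp: L1_loc_def intro: measurable_restrict_mono)
    have UO: "UO S \<phi> \<le> B" using S by (auto simp: B_def intro: SUP_upper)
    have "MO S \<phi> \<le> 2 * UO S \<phi>"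
      using emeasure_polydisc_pos[OF P(2)] emeasure_polydisc_finite meas UO B P(1)
      by (intro MO_le_UO) auto
    also have "\<dots> \<le> 2 * B" using UO by (rule mult_left_mono) simp
    finally show "MO S \<phi> \<le> 2 * B" .
  qed
  also have "\<dots> < \<infinity>" using B by (simp add: ennreal_mult_less_top)
  finally show "\<phi> \<in> BMO \<Omega> \<S>" using L1 by (simp add: BMO_def)
qed

lemma BUO_loc_subset_BMO_loc:
  fixes \<Omega> :: "(complex ^ 'n) set"
  assumes \<S>: "\<S> \<subseteq> polydiscs \<Omega>"
  shows "BUO_loc \<Omega> \<S> \<subseteq> BMO_loc \<Omega> \<S>"
proof -
  have "{S \<in> \<S>. S \<subset>\<subset> \<Omega>'} \<subseteq> polydiscs \<Omega>'" for \<Omega>'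
    using \<S> unfolding polydiscs_def by blast
  from BUO_subset_BMO[OF this] show ?thesis
    unfolding BUO_loc_def BMO_loc_def by blast
qed

section \<open>Local estimates on polydiscs of finite type\<close>

lemma closed_polydisc_subset_cball:
  fixes r :: "real ^ 'n"
  assumes "\<And>j. r $ j \<le> \<delta>"
  shows "closed_polydisc a r \<subseteq> cball a (real CARD('n) * \<delta>)"
proof -
  have "(\<Sum>j\<in>UNIV. r $ j) \<le> real CARD('n) * \<delta>"
    using assms sum_bounded_above[of UNIV "\<lambda>j. r $ j" \<delta>] by simp
  then show ?thesis using closed_polydisc_cball[of a r] by (meson order_trans subset_cball)
qed

text \<open>Though \<phi> may be unbounded below on \<open>K\<close>, finitely many points of finite
  value come within \<eta> of every point of \<open>K\<close>, so one constant serves all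
  centres.\<close>

lemma PSH_lower_bound_near:
  fixes \<phi> :: "complex ^ 'n \<Rightarrow> ereal"
  assumes \<phi>: "\<phi> \<in> PSH \<Omega>" and \<Omega>: "is_domain \<Omega>" and K: "compact K" "K \<subseteq> \<Omega>" and \<eta>: "0 < \<eta>"
  shows "\<exists>C\<ge>0. \<forall>a\<in>K. \<exists>b\<in>ball a \<eta>. ereal (- C) \<le> \<phi> b"
proof -
  define F where "F = {z \<in> \<Omega>. \<phi> z \<noteq> -\<infinity>}"
  have "K \<subseteq> (\<Union>b\<in>F. ball b \<eta>)"
  proof
    fix a assume "a \<in> K"
    then have "a \<in> closure F" using PSH_finite_dense[OF \<phi> \<Omega>] K by (auto simp: F_def)
    then obtain b where "b \<in> F" "dist b a < \<eta>" using \<eta> by (meson closure_approachable)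
    then show "a \<in> (\<Union>b\<in>F. ball b \<eta>)" by auto
  qed
  then obtain D where D: "D \<subseteq> F" "finite D" "K \<subseteq> (\<Union>b\<in>D. ball b \<eta>)"
    by (rule compactE_image[OF K(1), rotated]) auto
  define C where "C = Max (insert 0 ((\<lambda>b. - real_of_ereal (\<phi> b)) ` D))"
  have C: "C \<ge> 0" "\<And>b. b \<in> D \<Longrightarrow> - real_of_ereal (\<phi> b) \<le> C"
    using D(2) by (auto simp: C_def)
  have "\<exists>b\<in>ball a \<eta>. ereal (- C) \<le> \<phi> b" if a: "a \<in> K" for a
  proof -
    obtain b where b: "b \<in> D" "a \<in> ball b \<eta>" using a D(3) by auto
    have "\<phi> b \<noteq> -\<infinity>" "\<phi> b < \<infinity>" using b(1) D(1) PSH_less_top[OF \<phi>] by (auto simp: F_def)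
    then have "ereal (- C) \<le> \<phi> b" using C(2)[OF b(1)] by (cases "\<phi> b") auto
    then show ?thesis using b(2) by (auto simp: dist_commute)
  qed
  with C(1) show ?thesis by blast
qed

text \<open>The bound on the logarithmic slope: the three circles theorem between the polyradii \<open>\<rho>/3\<close>
  and \<open>\<delta>\<close> (in all coordinates) shows that \<open>\<phi>\<close> is at least of order \<open>ln \<rho>\<close> somewhere near \<open>a\<close>;
  between \<open>r/3\<close> and \<open>\<delta> r/R\<close> it bounds the slope by the quotient of \<open>ln (1/\<rho>)\<close> and \<open>ln (1/R)\<close>,
  which is at most \<open>N\<close>.\<close>

lemma PSH_UO_small_polydisc:
  fixes \<phi> :: "complex ^ 'n \<Rightarrow> ereal" and r :: "real ^ 'n"
  assumes \<phi>: "\<phi> \<in> PSH \<Omega>" and \<Omega>: "is_domain \<Omega>" and r: "\<And>j. 0 < r $ j"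
    and \<delta>: "0 < \<delta>" "3 * \<delta> \<le> 1/5"
    and sub: "closed_polydisc a (\<chi> j. \<delta>) \<subseteq> \<Omega>"
    and C: "0 \<le> C" "\<And>z. z \<in> closed_polydisc a (\<chi> j. \<delta>) \<Longrightarrow> \<phi> z \<le> ereal C"
    and C': "0 \<le> C'" "b0 \<in> closed_polydisc a (\<chi> j. \<delta> / exp 1)" "ereal (- C') \<le> \<phi> b0"
    and R: "\<And>j. r $ j \<le> R" "R \<le> (3 * \<delta>)^2"
    and \<rho>: "0 < \<rho>" "\<And>j. \<rho> \<le> r $ j" "R powr N \<le> \<rho>" and N: "0 < N"
  shows "UO (polydisc a r) \<phi> \<le> ennreal ((16/9) ^ CARD('n) * (ln 5 * (C + 2 * N * (C + C'))))"
proof -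
  have R0: "0 < R" using R(1) r order_less_le_trans by blast
  have \<rho>R: "\<rho> \<le> R" using \<rho>(2) R(1) order_trans by blast
  \<comment> \<open>In both uses of the three circles theorem the ratio of outer to inner scale has
    numerator \<Delta>: \<open>\<delta> / (\<rho>/3) = \<Delta> / \<rho>\<close> and
    \<open>(\<delta>/R) / (1/3) = \<Delta> / R\<close>.\<close>
  define \<Delta> where "\<Delta> = 3 * \<delta>"
  have \<Delta>: "0 < \<Delta>" "\<Delta> \<le> 1/5" using \<delta> by (auto simp: \<Delta>_def)
  have R\<Delta>: "R \<le> \<Delta> * \<Delta>" using R(2) by (simp add: \<Delta>_def power2_eq_square)
  have "\<Delta> * \<Delta> \<le> \<Delta> * (1/5)" using \<Delta> by (intro mult_left_mono) auto
  then have R5: "R \<le> \<Delta> / 5" using R\<Delta> by simp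
  have e: "exp 1 \<le> (3::real)" by (rule exp_le)
  have ln5: "1 \<le> ln (5::real)"
  proof -
    have "ln (exp 1) \<le> ln (5::real)" using e by (intro ln_mono) auto
    then show ?thesis by simp
  qed
  have subR: "closed_polydisc a (t *\<^sub>R r) \<subseteq> closed_polydisc a (\<chi> j. \<delta>)" if "0 \<le> t" "t * R \<le> \<delta>" for t
  proof (rule closed_polydisc_mono)
    fix j
    have "t * r $ j \<le> t * R" using R(1) that by (intro mult_left_mono) auto
    then show "(t *\<^sub>R r) $ j \<le> (\<chi> j. \<delta>) $ j" using that by simp
  qed
  have sub13: "closed_polydisc a ((1/3) *\<^sub>R r) \<subseteq> closed_polydisc a (\<chi> j. \<delta>)"
    using R5 R0 by (intro subR) (auto simp: \<Delta>_def)
  have sub53: "closed_polydisc a ((5/3) *\<^sub>R r) \<subseteq> closed_polydisc a (\<chi> j. \<delta>)"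
    using R5 R0 by (intro subR) (auto simp: \<Delta>_def)
  have r3: "\<And>j. 0 < ((1/3) *\<^sub>R r) $ j" using r by simp
  obtain b m where b: "b \<in> closed_polydisc a ((1/3) *\<^sub>R r)" "\<phi> b = ereal m"
      and m: "\<forall>z\<in>closed_polydisc a ((1/3) *\<^sub>R r). \<phi> z \<le> ereal m"
    using PSH_max_polydisc[OF \<phi> \<Omega> r3] sub13 sub by blast
  have mC: "m \<le> C" using C(2)[of b] b sub13 by auto
  define L where "L = ln (\<Delta> / \<rho>)"
  have "\<Delta> / \<rho> \<ge> 5" using R5 \<rho>R \<rho>(1) by (simp add: le_divide_eq)
  then have "ln 5 \<le> L" unfolding L_def by (intro ln_mono) auto
  then have L1: "1 \<le> L" using ln5 by simp
  \<comment> \<open>Equal radii \<open>\<rho>/3\<close>, \<open>\<delta>/exp 1\<close> and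
    \<open>\<delta>\<close>: the smallest polydisc lies in that of polyradius \<open>r/3\<close>,
    where \<open>\<phi> \<le> m\<close>, and \<open>b0\<close> lies in the middle one. The factor
    \<open>exp 1\<close> makes the middle logarithm exactly \<open>L - 1\<close>, so the lower bound
    at \<open>b0\<close> becomes one for \<open>m\<close>.\<close>
  have "- C' \<le> m + (C - m) * ((L - 1) / L)"
  proof -
    define one :: "real ^ 'n" where "one = (\<chi> j. 1)"
    have one: "(\<chi> j. x) = x *\<^sub>R one" for x :: real by (simp add: one_def vec_eq_iff)
    have "\<rho> / 3 \<le> \<delta> / exp 1"
    proof -
      have "\<rho> / 3 \<le> \<delta> / 5" using R5 \<rho>R by (simp add: \<Delta>_def)
      also have "\<dots> \<le> \<delta> / exp 1" using e \<delta> by (intro divide_left_mono) auto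
      finally show ?thesis .
    qed
    moreover have "\<delta> / exp 1 \<le> \<delta>" using \<delta> by (simp add: divide_le_eq)
    moreover have "\<rho> / 3 < \<delta>" using R5 \<rho>R \<delta> by (simp add: \<Delta>_def)
    moreover have "closed_polydisc a ((\<rho> / 3) *\<^sub>R one) \<subseteq> closed_polydisc a ((1/3) *\<^sub>R r)"
      using \<rho>(2) by (intro closed_polydisc_mono) (simp add: one_def)
    ultimately have "\<phi> b0 \<le> ereal (m + (C - m) * (ln ((\<delta> / exp 1) / (\<rho> / 3)) / ln (\<delta> / (\<rho> / 3))))"
      using \<rho>(1) m sub C C' mC unfolding one
      by (intro PSH_three_polydiscs[OF \<phi>, of one "\<rho> / 3" \<delta> a m C "\<delta> / exp 1"]) (auto simp: one_def)
    also have "(\<delta> / exp 1) / (\<rho> / 3) = (\<Delta> / \<rho>) / exp 1" by (simp add: \<Delta>_def mult.commute)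
    also have "ln ((\<Delta> / \<rho>) / exp 1) = L - 1"
      using \<Delta> \<rho>(1) unfolding L_def by (subst ln_div) auto
    also have "\<delta> / (\<rho> / 3) = \<Delta> / \<rho>" by (simp add: \<Delta>_def)
    finally have "\<phi> b0 \<le> ereal (m + (C - m) * ((L - 1) / L))" by (simp add: L_def)
    then show ?thesis using C'(3) by (metis ereal_less_eq(3) order_trans)
  qed
  then have "- C' * L \<le> (m + (C - m) * ((L - 1) / L)) * L"
    using L1 by (intro mult_right_mono) auto
  also have "\<dots> = m + C * (L - 1)" using L1 by (simp add: field_simps)
  also have "\<dots> \<le> m + C * L" using C by (simp add: mult_left_mono)
  finally have low: "C - m \<le> C + (C + C') * L" by (simp add: algebra_simps)
  define \<Lambda> where "\<Lambda> = ln (\<Delta> / R)"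
  have "\<Delta> / R \<ge> 5" using R5 R0 by (simp add: le_divide_eq)
  then have "ln 5 \<le> \<Lambda>" unfolding \<Lambda>_def by (intro ln_mono) auto
  then have \<Lambda>1: "1 \<le> \<Lambda>" using ln5 by simp
  \<comment> \<open>Finite type gives \<open>- ln \<rho> \<le> N * (- ln R)\<close>. From
    \<open>R \<le> \<Delta>^2\<close> the ratio \<open>\<Delta> / R\<close> is at least
    \<open>1 / sqrt R\<close>, whence \<open>- ln R \<le> 2 * \<Lambda>\<close>; this is the origin
    of the 2 in the constant.\<close>
  have "L \<le> 2 * N * \<Lambda>"
  proof -
    have "ln R \<le> ln (\<Delta> * \<Delta>)" using R\<Delta> R0 by (intro ln_mono) auto
    then have "ln R \<le> 2 * ln \<Delta>" using \<Delta> by (simp add: ln_mult)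
    then have "- ln R \<le> 2 * \<Lambda>" using \<Delta> R0 by (simp add: \<Lambda>_def ln_div)
    then have 1: "N * (- ln R) \<le> N * (2 * \<Lambda>)" using N by (intro mult_left_mono) auto
    have "ln (R powr N) \<le> ln \<rho>" using \<rho> R0 by (intro ln_mono) auto
    then have "- ln \<rho> \<le> N * (- ln R)" using R0 by (simp add: ln_powr)
    moreover have "ln \<Delta> \<le> 0" using \<Delta> by simp
    then have "L \<le> - ln \<rho>" using \<Delta> \<rho> by (simp add: L_def ln_div)
    ultimately show ?thesis using 1 by simp
  qed
  then have "C - m \<le> C + (C + C') * (2 * N * \<Lambda>)"
    using low C C' by (smt (verit) mult_left_mono)
  moreover have "C \<le> C * \<Lambda>" using C \<Lambda>1 by (simp add: mult_le_cancel_left1)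
  ultimately have slope: "C - m \<le> (C + 2 * N * (C + C')) * \<Lambda>" by (simp add: algebra_simps)
  \<comment> \<open>Three circles at the scales 1/3, 5/3 and \<open>\<delta> / R\<close>; at the
    last one, all radii are still at most \<delta>.\<close>
  define M where "M = m + (C - m) * (ln 5 / \<Lambda>)"
  have M: "\<phi> z \<le> ereal M" if z: "z \<in> closed_polydisc a ((5/3) *\<^sub>R r)" for z
  proof -
    have T: "5/3 \<le> \<delta> / R" using R5 R0 by (simp add: \<Delta>_def le_divide_eq)
    have subT: "closed_polydisc a ((\<delta> / R) *\<^sub>R r) \<subseteq> closed_polydisc a (\<chi> j. \<delta>)"
      using R0 \<delta> by (intro subR) auto
    have "\<phi> z \<le> ereal (m + (C - m) * (ln ((5/3) / (1/3)) / ln ((\<delta> / R) / (1/3))))"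
    proof (rule PSH_three_polydiscs[OF \<phi> r])
      show "closed_polydisc a ((\<delta> / R) *\<^sub>R r) \<subseteq> \<Omega>" using subT sub by blast
      show "\<phi> z \<le> ereal C" if "z \<in> closed_polydisc a ((\<delta> / R) *\<^sub>R r)" for z
        using that subT C(2) by blast
    qed (use m mC T z in auto)
    then show ?thesis by (simp add: M_def \<Lambda>_def \<Delta>_def mult.commute)
  qed
  have "UO (polydisc a r) \<phi> \<le> ennreal ((16/9) ^ CARD('n) * (M - m))"
    using M sub53 sub b \<Omega> by (intro PSH_UO_polydisc_le[OF \<phi> _ r _ _ b]) (auto simp: is_domain_def)
  also have "\<dots> \<le> ennreal ((16/9) ^ CARD('n) * (ln 5 * (C + 2 * N * (C + C'))))"
  proof (intro ennreal_leI mult_left_mono)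
    have "(C - m) / \<Lambda> \<le> C + 2 * N * (C + C')" using slope \<Lambda>1 by (simp add: divide_le_eq)
    then have "ln 5 * ((C - m) / \<Lambda>) \<le> ln 5 * (C + 2 * N * (C + C'))" using ln5 by (intro mult_left_mono) auto
    then show "M - m \<le> ln 5 * (C + 2 * N * (C + C'))" by (simp add: M_def mult.commute)
  qed simp
  finally show ?thesis .
qed

text \<open>Two cases by the largest radius. Small polydiscs fall under the slope estimate.
  Otherwise finite type bounds every radius from below, so the volume is bounded below, and the
  integral of \<open>C - \<phi>\<close> over \<open>K\<close> controls the oscillation.\<close>

lemma PSH_subset_BUO_loc:
  fixes \<Omega> :: "(complex ^ 'n) set"
  assumes \<Omega>: "is_domain \<Omega>" and N: "N > 0"
  shows "PSH \<Omega> \<subseteq> BUO_loc \<Omega> (polydiscs_type N \<Omega>)"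
proof
  fix \<phi> assume \<phi>: "\<phi> \<in> PSH \<Omega>"
  have o: "open \<Omega>" using \<Omega> by (simp add: is_domain_def)
  have L1: "\<phi> \<in> L1_loc \<Omega>" by (rule PSH_in_L1_loc[OF \<phi> \<Omega>])
  show "\<phi> \<in> BUO_loc \<Omega> (polydiscs_type N \<Omega>)"
    unfolding BUO_loc_def
  proof (intro CollectI allI impI)
    fix \<Omega>\<^sub>0 :: "(complex ^ 'n) set" assume "open \<Omega>\<^sub>0 \<and> \<Omega>\<^sub>0 \<subset>\<subset> \<Omega>"
    define K where "K = closure \<Omega>\<^sub>0"
    have K: "compact K" "K \<subseteq> \<Omega>" and \<Omega>\<^sub>0K: "\<Omega>\<^sub>0 \<subseteq> K"
      using \<open>open \<Omega>\<^sub>0 \<and> \<Omega>\<^sub>0 \<subset>\<subset> \<Omega>\<close> closure_subset by (auto simp: K_def relatively_compact_in_def)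
    obtain \<epsilon> where \<epsilon>: "\<epsilon> > 0" "(\<Union>x\<in>K. cball x \<epsilon>) \<subseteq> \<Omega>"
      using compact_subset_open_imp_cball_epsilon_subset[OF K(1) o K(2)] by blast
    \<comment> \<open>Centres lie in \<open>K\<close>, but polydiscs of radii \<delta> about them
      may leave \<open>K\<close>, so upper bounds are taken on this compact neighbourhood.\<close>
    define K' where "K' = (\<Union>x\<in>K. \<Union>y\<in>cball 0 \<epsilon>. {x + y})"
    have K'eq: "K' = (\<Union>x\<in>K. cball x \<epsilon>)"
    proof -
      have "(\<Union>y\<in>cball 0 \<epsilon>. {x + y}) = cball x \<epsilon>" for x :: "complex ^ 'n"
        using cball_translation[of x 0 \<epsilon>] by (auto simp: image_def)
      then show ?thesis by (simp add: K'_def)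
    qed
    have "compact K'" unfolding K'_def using K(1) compact_cball by (rule compact_sums')
    then obtain C0 where C0: "\<forall>z\<in>K'. \<phi> z \<le> ereal C0"
      using PSH_bounded_above[OF \<phi>] \<epsilon>(2) K'eq by blast
    define C where "C = max C0 0"
    have C: "0 \<le> C" "\<And>z. z \<in> K' \<Longrightarrow> \<phi> z \<le> ereal C"
      using C0 order_trans by (fastforce simp: C_def)+
    \<comment> \<open>\<open>n * \<delta> \<le> \<epsilon>\<close> puts the polydisc of radii
      \<delta> inside a Euclidean ball of radius \<epsilon>; 1/15 yields
      \<open>3 * \<delta> \<le> 1/5\<close>.\<close>
    define \<delta> where "\<delta> = min (\<epsilon> / real CARD('n)) (1/15)"
    have \<delta>: "0 < \<delta>" "3 * \<delta> \<le> 1/5" "real CARD('n) * \<delta> \<le> \<epsilon>"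
      using \<epsilon>(1) by (auto simp: \<delta>_def min_def field_simps)
    obtain C' where C': "0 \<le> C'" "\<And>a. a \<in> K \<Longrightarrow> \<exists>b\<in>ball a (\<delta> / exp 1). ereal (- C') \<le> \<phi> b"
      using PSH_lower_bound_near[OF \<phi> \<Omega> K, of "\<delta> / exp 1"] \<delta>(1) by auto
    \<comment> \<open>A lower bound for all radii once the largest exceeds
      \<open>(3 * \<delta>)^2\<close>; the polydisc then contains a ball of radius
      \<open>v\<close>.\<close>
    define v where "v = ((3 * \<delta>)^2) powr N"
    have v: "0 < v" using \<delta> by (simp add: v_def)
    define X where "X = (\<integral>\<^sup>+z\<in>K. e2ennreal (ereal C - \<phi> z) \<partial>lborel)"
    have Xfin: "X < \<infinity>"
    proof -
      define f where "f z = e2ennreal \<bar>if z \<in> \<Omega> then \<phi> z else 0\<bar>" for z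
      have [measurable]: "f \<in> borel_measurable borel"
        unfolding f_def using usc_on_borel_measurable[OF o PSH_usc_on[OF \<phi>], of 0] by measurable
      have [measurable]: "K \<in> sets borel" using K(1) by (simp add: compact_imp_closed)
      have *: "e2ennreal (ereal C - x) \<le> e2ennreal \<bar>x\<bar> + ennreal C" for x
      proof (cases x)
        case (real y)
        have "ennreal (C - y) \<le> ennreal (\<bar>y\<bar> + C)" by (intro ennreal_leI) auto
        also have "\<dots> = ennreal \<bar>y\<bar> + ennreal C" using C by (intro ennreal_plus) auto
        finally show ?thesis using real by simp
      qed auto
      have "X \<le> (\<integral>\<^sup>+z. f z * indicator K z + ennreal C * indicator K z \<partial>lborel)"
        unfolding X_def f_def using * K(2) by (intro nn_integral_mono) (auto simp: indicator_def)
      also have "\<dots> = (\<integral>\<^sup>+z\<in>K. f z \<partial>lborel) + ennreal C * emeasure lborel K"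
        by (subst nn_integral_add) (auto simp: nn_integral_cmult_indicator)
      also have "(\<integral>\<^sup>+z\<in>K. f z \<partial>lborel) = (\<integral>\<^sup>+z\<in>K. e2ennreal \<bar>\<phi> z\<bar> \<partial>lebesgue)"
        unfolding nn_integral_completion using K(2)
        by (intro nn_integral_cong) (auto simp: f_def indicator_def)
      also have "\<dots> + ennreal C * emeasure lborel K < \<infinity>"
        using L1 K emeasure_compact_finite[OF K(1)]
        by (auto simp: L1_loc_def ennreal_mult_less_top)
      finally show ?thesis .
    qed
    define w where "w = emeasure lborel (ball (0 :: complex ^ 'n) v)"
    have w: "0 < w" using open_not_negligible[of "ball (0 :: complex ^ 'n) v"] v
      by (auto simp: w_def negligible_iff_null_sets null_sets_def zero_less_iff_neq_zero)
    define B where "B = max (ennreal ((16/9) ^ CARD('n) * (ln 5 * (C + 2 * N * (C + C'))))) (X / w)"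
    have "UO P \<phi> \<le> B" if P: "P \<in> polydiscs_type N \<Omega>" "P \<subset>\<subset> \<Omega>\<^sub>0" for P
    proof -
      obtain a and r :: "real ^ 'n" where Par: "P = polydisc a r" and r: "\<And>j. 0 < r $ j"
          and type: "(MAX j. r $ j) \<le> (MIN j. (r $ j) powr (1 / N))"
        using P(1) by (auto simp: polydiscs_type_def)
      define R where "R = (MAX j. r $ j)"
      define \<rho> where "\<rho> = (MIN j. r $ j)"
      have R: "r $ j \<le> R" "\<rho> \<le> r $ j" for j by (simp_all add: R_def \<rho>_def)
      have R0: "0 < R" using R(1) r order_less_le_trans by blast
      have "\<rho> \<in> range (\<lambda>j. r $ j)" unfolding \<rho>_def by (rule Min_in) auto
      then obtain i where i: "\<rho> = r $ i" by auto
      have \<rho>0: "0 < \<rho>" using r i by simp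
      have "R \<le> (r $ i) powr (1 / N)"
        using type unfolding R_def[symmetric] by (rule order_trans) simp
      then have "R powr N \<le> ((r $ i) powr (1 / N)) powr N"
        using R0 N by (intro powr_mono2) auto
      then have R\<rho>: "R powr N \<le> \<rho>" using N \<rho>0 by (simp add: powr_powr i)
      have PK: "P \<subseteq> K" using P(2) closure_subset[of P] \<Omega>\<^sub>0K by (auto simp: relatively_compact_in_def)
      then have aK: "a \<in> K" using polydisc_center[OF r] Par by auto
      show ?thesis
      proof (cases "R \<le> (3 * \<delta>)^2")
        case True
        have subK': "closed_polydisc a (\<chi> j. \<delta>) \<subseteq> K'"
          using closed_polydisc_subset_cball[of "\<chi> j. \<delta>" \<delta> a] \<delta>(3) aK unfolding K'eq by force
        obtain b where b: "b \<in> ball a (\<delta> / exp 1)" "ereal (- C') \<le> \<phi> b" using C'(2)[OF aK] by blast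
        have "b \<in> closed_polydisc a (\<chi> j. \<delta> / exp 1)"
          using b(1) ball_subset_polydisc[of "\<delta> / exp 1" "\<chi> j. \<delta> / exp 1" a]
            polydisc_subset_closed_polydisc[of a "\<chi> j. \<delta> / exp 1"] by auto
        then have "UO P \<phi> \<le> ennreal ((16/9) ^ CARD('n) * (ln 5 * (C + 2 * N * (C + C'))))"
          unfolding Par
        proof (intro PSH_UO_small_polydisc[OF \<phi> \<Omega>, of r \<delta> a C C' b R \<rho> N])
          show "closed_polydisc a (\<chi> j. \<delta>) \<subseteq> \<Omega>" using subK' \<epsilon>(2) K'eq by blast
          show "\<phi> z \<le> ereal C" if "z \<in> closed_polydisc a (\<chi> j. \<delta>)" for z
            using C(2) subK' that by blast
        qed (use C b(2) C'(1) True R \<rho>0 R\<rho> N \<delta> r in auto)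
        then show ?thesis by (simp add: B_def le_max_iff_disj)
      next
        case False
        have "v \<le> R powr N" unfolding v_def using False N by (intro powr_mono2) auto
        then have "v \<le> r $ j" for j using R\<rho> R(2)[of j] by linarith
        then have "ball a v \<subseteq> P" unfolding Par by (rule ball_subset_polydisc)
        then have "emeasure lborel (ball a v) \<le> emeasure lborel P"
          by (intro emeasure_mono) (auto simp: Par)
        then have wP: "w \<le> emeasure lborel P"
          using v by (simp add: w_def emeasure_ball)
        have "K \<subseteq> K'" using \<epsilon>(1) unfolding K'eq by force
        then have "UO P \<phi> \<le> (\<integral>\<^sup>+z\<in>P. e2ennreal (ereal C - \<phi> z) \<partial>lborel) / emeasure lebesgue P"
          using PK C(2) by (intro UO_le) blast
        also have "\<dots> \<le> X / w"
        proof (rule divide_le_posI_ennreal)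
          have eP: "emeasure lebesgue P = emeasure lborel P" by (simp add: Par)
          show "0 < emeasure lebesgue P" using w wP eP by simp
          have "(\<integral>\<^sup>+z\<in>P. e2ennreal (ereal C - \<phi> z) \<partial>lborel) \<le> X"
            unfolding X_def using PK by (intro nn_integral_mono) (auto simp: indicator_def)
          also have "X = w * (X / w)"
            using w emeasure_lborel_ball_finite[of "0 :: complex ^ 'n" v]
            by (simp add: ennreal_times_divide mult.commute w_def mult_divide_eq_ennreal)
          also have "\<dots> \<le> emeasure lebesgue P * (X / w)"
            unfolding eP using wP by (intro mult_right_mono) auto
          finally show "(\<integral>\<^sup>+z\<in>P. e2ennreal (ereal C - \<phi> z) \<partial>lborel) \<le> emeasure lebesgue P * (X / w)" .
        qed
        finally show ?thesis by (simp add: B_def le_max_iff_disj)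
      qed
    qed
    then have "(SUP P\<in>{P \<in> polydiscs_type N \<Omega>. P \<subset>\<subset> \<Omega>\<^sub>0}. UO P \<phi>) \<le> B"
      by (intro SUP_least) auto
    also have "B < \<infinity>"
    proof -
      have "X / w \<noteq> top" using Xfin w by (auto simp: ennreal_divide_eq_top_iff)
      then show ?thesis by (simp add: B_def less_top)
    qed
    finally show "\<phi> \<in> BUO \<Omega>\<^sub>0 {P \<in> polydiscs_type N \<Omega>. P \<subset>\<subset> \<Omega>\<^sub>0}"
      using L1_loc_mono[OF L1] \<Omega>\<^sub>0K K(2) by (auto simp: BUO_def)
  qed
qed

subsection \<open>A function of unbounded mean oscillation\<close>

text \<open>\<open>- ln |z|\<close> on the unit disc as a nonnegative extended function: \<infinity>
  replaces the default value of the real logarithm at the pole, and outside the disc the value is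
  truncated to 0. This makes it continuous, as the limit argument for circles through the pole
  requires.\<close>

definition neg_ln :: "complex \<Rightarrow> ennreal" where
  "neg_ln z = (if z = 0 then \<infinity> else ennreal (- ln (cmod z)))"

lemma neg_ln_measurable [measurable]: "neg_ln \<in> borel_measurable borel"
  unfolding neg_ln_def by measurable

lemma tendsto_neg_ln:
  assumes "(f \<longlongrightarrow> z) F"
  shows "((\<lambda>k. neg_ln (f k)) \<longlongrightarrow> neg_ln z) F"
proof (cases "z = 0")
  case False
  then have "\<forall>\<^sub>F k in F. f k \<noteq> 0" using assms by (rule tendsto_imp_eventually_ne[rotated])
  moreover have "((\<lambda>k. ennreal (- ln (cmod (f k)))) \<longlongrightarrow> ennreal (- ln (cmod z))) F"
    using False assms by (intro tendsto_intros) auto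
  ultimately show ?thesis
    using False by (auto simp: neg_ln_def elim!: eventually_mono intro: Lim_transform_eventually)
next
  case True
  have "\<forall>\<^sub>F k in F. ereal y < enn2ereal (neg_ln (f k))" for y
  proof -
    have "\<forall>\<^sub>F k in F. cmod (f k) < exp (- \<bar>y\<bar> - 1)"
      using assms True tendstoD[of f z F "exp (- \<bar>y\<bar> - 1)"] by simp
    then show ?thesis
    proof eventually_elim
      case (elim k)
      show ?case
      proof (cases "f k = 0")
        case False
        then have "ln (cmod (f k)) < - \<bar>y\<bar> - 1"
          using elim by (metis exp_gt_zero ln_exp ln_less_cancel_iff zero_less_norm_iff)
        then have "y < - ln (cmod (f k))" "0 \<le> - ln (cmod (f k))" by linarith+
        then show ?thesis using False by (simp add: neg_ln_def enn2ereal_ennreal)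
      qed (simp add: neg_ln_def)
    qed
  qed
  then have "((\<lambda>k. enn2ereal (neg_ln (f k))) \<longlongrightarrow> \<infinity>) F"
    by (auto simp: tendsto_PInfty)
  then show ?thesis
    using True by (simp add: tendsto_enn2ereal_iff[symmetric] neg_ln_def)
qed

text \<open>\<open>\<alpha> + \<beta> * t\<close> has no zero in the closed unit disc, so its
  logarithmic modulus has the mean value property; factoring out \<alpha> reduces to the normalised
  integral.\<close>

lemma has_integral_ln_circle:
  assumes \<beta>: "cmod \<beta> < cmod \<alpha>"
  shows "((\<lambda>\<theta>. ln (cmod (\<alpha> + \<beta> * cis \<theta>))) has_integral (2 * pi) * ln (cmod \<alpha>)) {0..2*pi}"
proof -
  have \<alpha>: "\<alpha> \<noteq> 0" using \<beta> by auto
  have ne: "1 + (\<beta> / \<alpha>) * cis \<theta> \<noteq> 0" for \<theta>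
  proof
    assume "1 + (\<beta> / \<alpha>) * cis \<theta> = 0"
    then have "cmod ((\<beta> / \<alpha>) * cis \<theta>) = 1" by (metis add_eq_0_iff norm_minus_cancel norm_one)
    then show False using \<beta> by (simp add: norm_mult norm_divide divide_eq_1_iff)
  qed
  have "cmod (\<beta> / \<alpha>) < 1" using \<beta> \<alpha> by (simp add: norm_divide)
  from circle_integral_ln_cmod[OF this]
  have "((\<lambda>\<theta>. ln (cmod \<alpha>) + ln (cmod (1 + (\<beta> / \<alpha>) * cis \<theta>))) has_integral (2 * pi) * ln (cmod \<alpha>) + 0) {0..2*pi}"
    using has_integral_const_real[of "ln (cmod \<alpha>)" 0 "2*pi"] by (intro has_integral_add) auto
  moreover have "ln (cmod \<alpha>) + ln (cmod (1 + (\<beta> / \<alpha>) * cis \<theta>)) = ln (cmod (\<alpha> + \<beta> * cis \<theta>))" for \<theta>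
  proof -
    have "\<alpha> + \<beta> * cis \<theta> = \<alpha> * (1 + (\<beta> / \<alpha>) * cis \<theta>)" using \<alpha> by (simp add: field_simps)
    then show ?thesis using \<alpha> ne[of \<theta>] by (simp only: norm_mult) (subst ln_mult, auto)
  qed
  ultimately show ?thesis by simp
qed

text \<open>The bound by 1 makes \<open>- ln\<close> nonnegative on the circle, so
  \<open>neg_ln\<close> truncates nothing.\<close>

lemma nn_integral_neg_ln_circle_less:
  assumes \<beta>: "cmod \<beta> < cmod \<alpha>" and le: "\<And>\<theta>. cmod (\<alpha> + \<beta> * cis \<theta>) \<le> 1"
  shows "(\<integral>\<^sup>+\<theta>\<in>{0..2*pi}. neg_ln (\<alpha> + \<beta> * cis \<theta>) \<partial>lborel) = ennreal (2 * pi * (- ln (cmod \<alpha>)))"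
proof -
  have ne: "\<alpha> + \<beta> * cis \<theta> \<noteq> 0" for \<theta>
  proof
    assume "\<alpha> + \<beta> * cis \<theta> = 0"
    then have "cmod (\<beta> * cis \<theta>) = cmod \<alpha>" by (metis add_eq_0_iff norm_minus_cancel)
    then show False using \<beta> by (simp add: norm_mult)
  qed
  have "((\<lambda>\<theta>. - ln (cmod (\<alpha> + \<beta> * cis \<theta>))) has_integral - ((2 * pi) * ln (cmod \<alpha>))) {0..2*pi}"
    by (intro has_integral_neg has_integral_ln_circle \<beta>)
  then have "(\<integral>\<^sup>+\<theta>. ennreal (indicator {0..2*pi} \<theta> * (- ln (cmod (\<alpha> + \<beta> * cis \<theta>)))) \<partial>lborel)
      = ennreal (- ((2 * pi) * ln (cmod \<alpha>)))"
    using ne le by (intro nn_integral_has_integral_lebesgue) auto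
  moreover have "(\<integral>\<^sup>+\<theta>\<in>{0..2*pi}. neg_ln (\<alpha> + \<beta> * cis \<theta>) \<partial>lborel)
      = (\<integral>\<^sup>+\<theta>. ennreal (indicator {0..2*pi} \<theta> * (- ln (cmod (\<alpha> + \<beta> * cis \<theta>)))) \<partial>lborel)"
    using ne by (intro nn_integral_cong) (auto simp: neg_ln_def indicator_def)
  ultimately show ?thesis by simp
qed

text \<open>If \<open>cmod \<beta> > cmod \<alpha>\<close>, conjugation exchanges the roles of \<open>\<alpha>\<close> and \<open>\<beta>\<close>; the case of equality,
  where the circle passes through the pole, follows by Fatou's lemma.\<close>

lemma nn_integral_neg_ln_circle_le:
  assumes \<alpha>: "\<alpha> \<noteq> 0" and le: "\<And>t. cmod t \<le> 1 \<Longrightarrow> cmod (\<alpha> + \<beta> * t) \<le> 1"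
  shows "(\<integral>\<^sup>+\<theta>\<in>{0..2*pi}. neg_ln (\<alpha> + \<beta> * cis \<theta>) \<partial>lborel) \<le> ennreal (2 * pi * (- ln (cmod \<alpha>)))"
proof (cases "cmod \<beta>" "cmod \<alpha>" rule: linorder_cases)
  case less
  then show ?thesis using le by (subst nn_integral_neg_ln_circle_less) auto
next
  case greater
  have conj: "cmod (cnj \<beta> + cnj \<alpha> * cis \<theta>) = cmod (\<alpha> + \<beta> * cis \<theta>)" for \<theta>
  proof -
    have "cnj \<beta> + cnj \<alpha> * cis \<theta> = cnj (\<alpha> + \<beta> * cis \<theta>) * cis \<theta>"
      by (simp add: cis_cnj ring_distribs mult.assoc cis_mult)
    then show ?thesis by (simp add: norm_mult del: complex_cnj_add complex_cnj_mult)
  qed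
  have "cnj \<beta> + cnj \<alpha> * cis \<theta> = 0 \<longleftrightarrow> \<alpha> + \<beta> * cis \<theta> = 0" for \<theta>
    using conj[of \<theta>] by (metis norm_eq_zero)
  then have "(\<integral>\<^sup>+\<theta>\<in>{0..2*pi}. neg_ln (\<alpha> + \<beta> * cis \<theta>) \<partial>lborel)
      = (\<integral>\<^sup>+\<theta>\<in>{0..2*pi}. neg_ln (cnj \<beta> + cnj \<alpha> * cis \<theta>) \<partial>lborel)"
    by (intro nn_integral_cong) (simp add: neg_ln_def conj)
  also have "\<dots> = ennreal (2 * pi * (- ln (cmod (cnj \<beta>))))"
    using greater le by (intro nn_integral_neg_ln_circle_less) (auto simp: conj)
  also have "\<dots> \<le> ennreal (2 * pi * (- ln (cmod \<alpha>)))"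
  proof -
    have "ln (cmod \<alpha>) \<le> ln (cmod \<beta>)" using greater \<alpha> by (intro ln_mono) auto
    then show ?thesis by (intro ennreal_leI) simp
  qed
  finally show ?thesis .
next
  case equal
  \<comment> \<open>Shrinking the circle by factors tending to 1 from below moves it off the pole
    while each mean remains exactly \<open>- ln |\<alpha>|\<close>; Fatou's lemma then gives the
    inequality in the wanted direction.\<close>
  define s where "s k = real k / real (Suc k)" for k
  have s: "0 \<le> s k" "s k < 1" for k by (auto simp: s_def divide_less_eq)
  have "s \<longlonglongrightarrow> 1" unfolding s_def by (rule LIMSEQ_n_over_Suc_n)
  define f where "f k \<theta> = neg_ln (\<alpha> + (of_real (s k) * \<beta>) * cis \<theta>) * indicator {0..2*pi} \<theta>" for k \<theta>
  have f: "(\<integral>\<^sup>+\<theta>. f k \<theta> \<partial>lborel) = ennreal (2 * pi * (- ln (cmod \<alpha>)))" for k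
    unfolding f_def
  proof (rule nn_integral_neg_ln_circle_less)
    show "cmod (of_real (s k) * \<beta>) < cmod \<alpha>"
      using equal \<alpha> s[of k] by (simp add: norm_mult)
    fix \<theta>
    have "cmod (of_real (s k) * cis \<theta>) \<le> 1" using s[of k] by (simp add: norm_mult)
    from le[OF this] show "cmod (\<alpha> + of_real (s k) * \<beta> * cis \<theta>) \<le> 1" by (simp add: mult_ac)
  qed
  have "(\<integral>\<^sup>+\<theta>\<in>{0..2*pi}. neg_ln (\<alpha> + \<beta> * cis \<theta>) \<partial>lborel) = (\<integral>\<^sup>+\<theta>. liminf (\<lambda>k. f k \<theta>) \<partial>lborel)"
  proof (intro nn_integral_cong)
    fix \<theta>
    have "(\<lambda>k. \<alpha> + (of_real (s k) * \<beta>) * cis \<theta>) \<longlonglongrightarrow> \<alpha> + (of_real 1 * \<beta>) * cis \<theta>"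
      using \<open>s \<longlonglongrightarrow> 1\<close> by (intro tendsto_intros)
    then have "(\<lambda>k. neg_ln (\<alpha> + (of_real (s k) * \<beta>) * cis \<theta>)) \<longlonglongrightarrow> neg_ln (\<alpha> + \<beta> * cis \<theta>)"
      by (intro tendsto_neg_ln) simp
    then have "liminf (\<lambda>k. neg_ln (\<alpha> + (of_real (s k) * \<beta>) * cis \<theta>)) = neg_ln (\<alpha> + \<beta> * cis \<theta>)"
      by (intro lim_imp_Liminf) auto
    then show "neg_ln (\<alpha> + \<beta> * cis \<theta>) * indicator {0..2*pi} \<theta> = liminf (\<lambda>k. f k \<theta>)"
      by (cases "\<theta> \<in> {0..2*pi}") (simp_all add: f_def Liminf_const)
  qed
  also have "\<dots> \<le> liminf (\<lambda>k. \<integral>\<^sup>+\<theta>. f k \<theta> \<partial>lborel)"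
  proof (rule nn_integral_liminf)
    fix k
    have "(\<lambda>\<theta>. neg_ln (\<alpha> + (of_real (s k) * \<beta>) * cis \<theta>)) \<in> borel_measurable borel"
      by (intro measurable_compose[OF _ neg_ln_measurable] borel_measurable_continuous_onI continuous_intros)
    then show "f k \<in> borel_measurable lborel" unfolding f_def by simp
  qed
  also have "\<dots> = ennreal (2 * pi * (- ln (cmod \<alpha>)))"
    by (simp only: f) (simp add: Liminf_const)
  finally show ?thesis .
qed

section \<open>Plurisubharmonicity of the counterexample\<close>

lemma usc_on_compose:
  assumes u: "usc_on V u" and f: "continuous_on U f" "f ` U \<subseteq> V"
  shows "usc_on U (\<lambda>x. u (f x))"
  unfolding usc_on_def
proof
  fix c
  obtain T where T: "open T" "{z \<in> V. u z < c} = V \<inter> T"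
    using u unfolding usc_on_def openin_open by metis
  have "{x \<in> U. u (f x) < c} = U \<inter> f -` T" using T(2) f(2) by blast
  then show "openin (top_of_set U) {x \<in> U. u (f x) < c}"
    using continuous_openin_preimage_gen[OF f(1) T(1)] by simp
qed

text \<open>On the unit polydisc this is the supremum over \<open>\<lambda> > 0\<close> of
  \<open>(\<lambda> ln |z\<^sub>i| + ln |z\<^sub>j| / \<lambda>) / 2\<close>, hence plurisubharmonic.\<close>

definition neg_geometric_mean :: "'n \<Rightarrow> 'n \<Rightarrow> complex ^ 'n \<Rightarrow> ereal" where
  "neg_geometric_mean i j z =
     (if z $ i = 0 \<or> z $ j = 0 then -\<infinity> else ereal (- sqrt (ln (cmod (z $ i)) * ln (cmod (z $ j)))))"

text \<open>Truncating both moduli from below at \<open>exp (- x)\<close> gives continuous functions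
  \<open>- g x\<close> whose infimum over \<open>x \<ge> 0\<close> is the given function, also where
  a coordinate vanishes; its sublevel sets are therefore unions of open sets.\<close>

lemma neg_geometric_mean_usc:
  "usc_on (polydisc (0 :: complex ^ 'n) (\<chi> j. 1)) (neg_geometric_mean i j)"
proof -
  define D where "D = polydisc (0 :: complex ^ 'n) (\<chi> j. 1)"
  have D: "cmod (z $ k) < 1" if "z \<in> D" for z :: "complex ^ 'n" and k
    using that by (simp add: D_def polydisc_def)
  have openD: "open D" by (simp add: D_def open_polydisc)
  define g where "g x z = sqrt (ln (max (cmod (z $ i)) (exp (- x))) * ln (max (cmod (z $ j)) (exp (- x))))"
    for x and z :: "complex ^ 'n"
  have contg: "continuous_on UNIV (g x)" for x
  proof -
    have "max t (exp (- x)) \<noteq> 0" for t :: real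
      using exp_gt_zero[of "- x"] by (auto simp: max_def)
    then show ?thesis unfolding g_def by (intro continuous_intros) auto
  qed
  have neg: "- x \<le> ln (max (cmod (z $ k)) (exp (- x)))" "ln (max (cmod (z $ k)) (exp (- x))) \<le> 0"
    if "z \<in> D" "0 \<le> x" for x k and z :: "complex ^ 'n"
  proof -
    have "ln (exp (- x)) \<le> ln (max (cmod (z $ k)) (exp (- x)))" by (intro ln_mono) auto
    then show "- x \<le> ln (max (cmod (z $ k)) (exp (- x)))" by simp
    have "0 < max (cmod (z $ k)) (exp (- x))" by (simp add: less_max_iff_disj)
    then show "ln (max (cmod (z $ k)) (exp (- x))) \<le> 0"
      using D[OF that(1), of k] that(2) by (simp add: ln_le_zero_iff less_imp_le)
  qed
  have le: "neg_geometric_mean i j z \<le> ereal (- g x z)" if z: "z \<in> D" "0 \<le> x" for x z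
  proof (cases "z $ i = 0 \<or> z $ j = 0")
    case False
    have ln: "ln (cmod (z $ k)) \<le> ln (max (cmod (z $ k)) (exp (- x)))" if "z $ k \<noteq> 0" for k
      using that by (intro ln_mono) auto
    have "(- ln (max (cmod (z $ i)) (exp (- x)))) * (- ln (max (cmod (z $ j)) (exp (- x))))
        \<le> (- ln (cmod (z $ i))) * (- ln (cmod (z $ j)))"
      using False ln neg[OF z] D[OF z(1)] by (intro mult_mono) (auto simp: less_imp_le)
    then have "g x z \<le> sqrt (ln (cmod (z $ i)) * ln (cmod (z $ j)))" by (simp add: g_def)
    then show ?thesis using False by (simp add: neg_geometric_mean_def)
  qed (simp add: neg_geometric_mean_def)
  have ex: "\<exists>x\<ge>0. ereal (- g x z) < c" if z: "z \<in> D" and c: "neg_geometric_mean i j z < c" for z c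
  proof (cases "z $ i = 0 \<or> z $ j = 0")
    case False
    define x where "x = max (- ln (cmod (z $ i))) (- ln (cmod (z $ j)))"
    have "exp (- x) \<le> cmod (z $ k)" if "k = i \<or> k = j" for k
    proof -
      have "exp (- x) \<le> exp (ln (cmod (z $ k)))" using that by (auto simp: x_def)
      also have "\<dots> = cmod (z $ k)" using that False by (intro exp_ln) auto
      finally show ?thesis .
    qed
    then have "ereal (- g x z) = neg_geometric_mean i j z"
      using False by (simp add: g_def neg_geometric_mean_def max_absorb1)
    moreover have "0 \<le> x" using D[OF z, of i] False by (simp add: x_def le_max_iff_disj less_imp_le)
    ultimately show ?thesis using c by auto
  next
    case True
    then obtain k l where kl: "z $ k = 0" "g x z = sqrt (ln (max (cmod (z $ k)) (exp (- x))) * ln (max (cmod (z $ l)) (exp (- x))))" for x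
      using that[of i j] that[of j i] by (auto simp: g_def mult.commute)
    obtain y where y: "ereal (- y) < c" "0 \<le> y"
    proof (cases c)
      case (real r)
      then show ?thesis by (intro that[of "\<bar>r\<bar> + 1"]) auto
    qed (use c that[of 0] in auto)
    define b where "b = (if z $ l = 0 then 1 else - ln (cmod (z $ l)))"
    have b: "0 < b" using D[OF z, of l] by (simp add: b_def)
    \<comment> \<open>\<open>x \<ge> b\<close> leaves a nonzero \<open>z_l\<close> untruncated and
      covers \<open>z_l = 0\<close>, where the truncated logarithm is \<open>- x\<close>. Then
      \<open>g x z \<ge> sqrt (x * b) \<ge> y\<close>.\<close>
    define x where "x = max (max 1 b) (y^2 / b)"
    have x: "1 \<le> x" "b \<le> x" "y^2 \<le> x * b" using b by (auto simp: x_def le_max_iff_disj pos_divide_le_eq[symmetric])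
    have bl: "b \<le> - ln (max (cmod (z $ l)) (exp (- x)))"
    proof (cases "z $ l = 0")
      case True
      then show ?thesis using x by (simp add: b_def)
    next
      case False
      then have "exp (- x) \<le> exp (ln (cmod (z $ l)))" using x by (simp add: b_def del: exp_ln)
      also have "\<dots> = cmod (z $ l)" using False by (intro exp_ln) auto
      finally show ?thesis using False by (simp add: b_def max_absorb1)
    qed
    have "y^2 \<le> x * b" by (rule x)
    also have "\<dots> \<le> x * (- ln (max (cmod (z $ l)) (exp (- x))))" using bl x by (intro mult_left_mono) auto
    also have "\<dots> = ln (max (cmod (z $ k)) (exp (- x))) * ln (max (cmod (z $ l)) (exp (- x)))"
      by (simp add: kl(1))
    finally have "y \<le> g x z" unfolding kl(2) using y(2) by (intro real_le_rsqrt)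
    then have "ereal (- g x z) \<le> ereal (- y)" by simp
    from order_le_less_trans[OF this y(1)] show ?thesis using x(1) by (intro exI[of _ x]) auto
  qed
  have "openin (top_of_set D) {z \<in> D. neg_geometric_mean i j z < c}" for c
  proof -
    have "{z \<in> D. neg_geometric_mean i j z < c} = (\<Union>x\<in>{0..}. D \<inter> {z. ereal (- g x z) < c})"
    proof -
      have "neg_geometric_mean i j z < c \<longleftrightarrow> (\<exists>x\<ge>0. ereal (- g x z) < c)" if "z \<in> D" for z
        using le ex that by (meson order_le_less_trans)
      then show ?thesis by auto
    qed
    moreover have "open {z. ereal (- g x z) < c}" for x
      using contg by (intro open_Collect_less continuous_intros)
    ultimately show ?thesis using openD by (auto simp: openin_open_eq intro!: open_UN)
  qed
  then show ?thesis by (simp add: usc_on_def D_def)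
qed


text \<open>The inequality \<open>sqrt (A * B) \<le> (\<mu> * A + B / \<mu>) / 2\<close> linearises
  the root, and \<mu> is fixed so that equality holds at the centre of the disc. The two logarithms
  then satisfy the mean value inequality separately.\<close>

lemma neg_geometric_mean_sub_mean:
  fixes z w :: "complex ^ 'n"
  assumes disc: "\<And>t. cmod t \<le> 1 \<Longrightarrow> z + t *s w \<in> polydisc 0 (\<chi> j. 1)"
  shows "neg_geometric_mean i j z \<le> circle_mean (\<lambda>t. neg_geometric_mean i j (z + t *s w)) 0 1"
proof (cases "z $ i = 0 \<or> z $ j = 0")
  case False
  define u where "u \<theta> = neg_geometric_mean i j (z + cis \<theta> *s w)" for \<theta>
  have lt1: "cmod ((z + t *s w) $ k) < 1" if "cmod t \<le> 1" for t k
    using disc[OF that] by (simp add: polydisc_def)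
  have z1: "cmod (z $ k) < 1" for k using lt1[of 0 k] by simp
  define x where "x = - ln (cmod (z $ i))"
  define y where "y = - ln (cmod (z $ j))"
  have xy: "0 < x" "0 < y" using z1[of i] z1[of j] False by (auto simp: x_def y_def)
  define \<mu> where "\<mu> = sqrt (y / x)"
  have \<mu>: "0 < \<mu>" using xy by (simp add: \<mu>_def)
  have u_le: "e2ennreal (- u \<theta>) \<le> ennreal (\<mu> / 2) * neg_ln ((z + cis \<theta> *s w) $ i) + ennreal (1 / (2 * \<mu>)) * neg_ln ((z + cis \<theta> *s w) $ j)" for \<theta>
  proof (cases "(z + cis \<theta> *s w) $ i = 0 \<or> (z + cis \<theta> *s w) $ j = 0")
    case True
    then show ?thesis using \<mu> by (auto simp: neg_ln_def ennreal_mult_top)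
  next
    case nz: False
    define A where "A = - ln (cmod ((z + cis \<theta> *s w) $ i))"
    define B where "B = - ln (cmod ((z + cis \<theta> *s w) $ j))"
    have AB: "0 \<le> A" "0 \<le> B" using lt1[of "cis \<theta>" i] lt1[of "cis \<theta>" j] nz by (auto simp: A_def B_def less_imp_le)
    have "sqrt (A * B) = sqrt ((\<mu> * A) * (B / \<mu>))" using \<mu> by simp
    also have "\<dots> \<le> (\<mu> * A + B / \<mu>) / 2" using AB \<mu> by (intro arith_geo_mean_sqrt) auto
    also have "\<dots> = \<mu> / 2 * A + 1 / (2 * \<mu>) * B" by (simp add: field_simps)
    finally have "ennreal (sqrt (A * B)) \<le> ennreal (\<mu> / 2 * A + 1 / (2 * \<mu>) * B)" by (rule ennreal_leI)
    also have "\<dots> = ennreal (\<mu> / 2) * ennreal A + ennreal (1 / (2 * \<mu>)) * ennreal B"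
    proof -
      have "ennreal (\<mu> / 2) * ennreal A = ennreal (\<mu> / 2 * A)"
        using \<mu> by (intro ennreal_mult'[symmetric]) simp
      moreover have "ennreal (1 / (2 * \<mu>)) * ennreal B = ennreal (1 / (2 * \<mu>) * B)"
        using \<mu> by (intro ennreal_mult'[symmetric]) simp
      ultimately show ?thesis using AB \<mu> by (simp only:) (intro ennreal_plus, auto)
    qed
    finally have "ennreal (sqrt (A * B)) \<le> \<dots>" .
    moreover have "e2ennreal (- u \<theta>) = ennreal (sqrt (A * B))"
      using nz by (simp add: u_def neg_geometric_mean_def A_def B_def)
    moreover have "neg_ln ((z + cis \<theta> *s w) $ i) = ennreal A" "neg_ln ((z + cis \<theta> *s w) $ j) = ennreal B"
      using nz by (simp_all only: neg_ln_def A_def B_def) auto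
    ultimately show ?thesis by (simp only:)
  qed
  \<comment> \<open>The positive part contributes nothing, so the extended integral is minus a
    single nonnegative one.\<close>
  have u_neg: "e2ennreal (u \<theta>) = 0" for \<theta>
  proof -
    have "u \<theta> \<le> 0"
    proof (cases "(z + cis \<theta> *s w) $ i = 0 \<or> (z + cis \<theta> *s w) $ j = 0")
      case False
      have "ln (cmod ((z + cis \<theta> *s w) $ k)) \<le> 0" if "(z + cis \<theta> *s w) $ k \<noteq> 0" for k
      proof -
        define c where "c = cmod ((z + cis \<theta> *s w) $ k)"
        have "0 < c" "c < 1" using that lt1[OF eq_refl[OF norm_cis[of \<theta>]], of k]
          unfolding c_def by (simp_all only: zero_less_norm_iff not_False_eq_True)
        then show ?thesis unfolding c_def[symmetric] by simp
      qed
      then have "0 \<le> ln (cmod ((z + cis \<theta> *s w) $ i)) * ln (cmod ((z + cis \<theta> *s w) $ j))"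
        using False by (intro mult_nonpos_nonpos) auto
      then show ?thesis using False by (simp add: u_def neg_geometric_mean_def)
    qed (simp add: u_def neg_geometric_mean_def)
    then show ?thesis by (simp add: e2ennreal_neg)
  qed
  have J: "(\<integral>\<^sup>+\<theta>\<in>{0..2*pi}. neg_ln ((z + cis \<theta> *s w) $ k) \<partial>lborel) \<le> ennreal (2 * pi * (- ln (cmod (z $ k))))"
    if "z $ k \<noteq> 0" for k
  proof -
    have "cmod (z $ k + w $ k * t) \<le> 1" if "cmod t \<le> 1" for t
      using lt1[OF that, of k] by (simp add: mult.commute)
    then have "(\<integral>\<^sup>+\<theta>\<in>{0..2*pi}. neg_ln (z $ k + w $ k * cis \<theta>) \<partial>lborel) \<le> ennreal (2 * pi * (- ln (cmod (z $ k))))"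
      using that by (intro nn_integral_neg_ln_circle_le)
    then show ?thesis by (simp add: mult.commute)
  qed
  have meas [measurable]: "(\<lambda>\<theta>. neg_ln ((z + cis \<theta> *s w) $ k)) \<in> borel_measurable borel" for k
    by (intro measurable_compose[OF _ neg_ln_measurable] borel_measurable_continuous_onI continuous_intros)
  have "(\<integral>\<^sup>+\<theta>\<in>{0..2*pi}. e2ennreal (- u \<theta>) \<partial>lborel)
      \<le> (\<integral>\<^sup>+\<theta>. ennreal (\<mu> / 2) * (neg_ln ((z + cis \<theta> *s w) $ i) * indicator {0..2*pi} \<theta>)
            + ennreal (1 / (2 * \<mu>)) * (neg_ln ((z + cis \<theta> *s w) $ j) * indicator {0..2*pi} \<theta>) \<partial>lborel)"
    using u_le by (intro nn_integral_mono) (auto simp: indicator_def simp del: vector_add_component vector_smult_component)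
  also have "\<dots> = ennreal (\<mu> / 2) * (\<integral>\<^sup>+\<theta>\<in>{0..2*pi}. neg_ln ((z + cis \<theta> *s w) $ i) \<partial>lborel)
        + ennreal (1 / (2 * \<mu>)) * (\<integral>\<^sup>+\<theta>\<in>{0..2*pi}. neg_ln ((z + cis \<theta> *s w) $ j) \<partial>lborel)"
    using meas by (simp add: nn_integral_add nn_integral_cmult del: vector_add_component vector_smult_component)
  also have "\<dots> \<le> ennreal (\<mu> / 2) * ennreal (2 * pi * x) + ennreal (1 / (2 * \<mu>)) * ennreal (2 * pi * y)"
    using J[of i] J[of j] False unfolding x_def y_def by (intro add_mono mult_left_mono) auto
  also have "\<dots> = ennreal (2 * pi * ((\<mu> * x + y / \<mu>) / 2))"
    using \<mu> xy by (simp add: ennreal_mult[symmetric] ennreal_plus[symmetric] field_simps del: ennreal_plus)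
  also have "(\<mu> * x + y / \<mu>) / 2 = sqrt (x * y)"
  proof -
    have "\<mu> * x = sqrt (x * y)"
    proof -
      have "\<mu> * x = sqrt (y / x) * sqrt (x^2)" using xy by (simp only: \<mu>_def real_sqrt_abs abs_of_pos)
      also have "\<dots> = sqrt (y / x * x^2)" by (rule real_sqrt_mult[symmetric])
      also have "y / x * x^2 = x * y" using xy by (simp add: power2_eq_square)
      finally show ?thesis .
    qed
    moreover have "y / \<mu> = sqrt (x * y)"
    proof -
      have "y / \<mu> = sqrt (y^2) / sqrt (y / x)" using xy by (simp only: \<mu>_def real_sqrt_abs abs_of_pos)
      also have "\<dots> = sqrt (y^2 / (y / x))" by (rule real_sqrt_divide[symmetric])
      also have "y^2 / (y / x) = x * y" using xy by (simp add: power2_eq_square)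
      finally show ?thesis .
    qed
    ultimately show ?thesis by simp
  qed
  finally have Y: "(\<integral>\<^sup>+\<theta>\<in>{0..2*pi}. e2ennreal (- u \<theta>) \<partial>lborel) \<le> ennreal (2 * pi * sqrt (x * y))" .
  have "ereal (2 * pi * (- sqrt (x * y))) \<le> - enn2ereal (\<integral>\<^sup>+\<theta>\<in>{0..2*pi}. e2ennreal (- u \<theta>) \<partial>lborel)"
  proof -
    have "enn2ereal (\<integral>\<^sup>+\<theta>\<in>{0..2*pi}. e2ennreal (- u \<theta>) \<partial>lborel) \<le> ereal (2 * pi * sqrt (x * y))"
      using Y xy by (simp add: less_eq_ennreal.rep_eq enn2ereal_ennreal)
    then show ?thesis by (simp add: ereal_uminus_le_reorder flip: uminus_ereal.simps(1))
  qed
  also have "\<dots> = ereal_integral lborel {0..2*pi} u"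
    by (simp add: ereal_integral_def u_neg zero_ennreal.rep_eq)
  finally have "ereal (2 * pi * (- sqrt (x * y))) / ereal (2 * pi) \<le> ereal_integral lborel {0..2*pi} u / ereal (2 * pi)"
    by (intro ereal_divide_right_mono) auto
  then have "ereal (- sqrt (x * y)) \<le> circle_mean (\<lambda>t. neg_geometric_mean i j (z + t *s w)) 0 1"
    by (simp add: circle_mean_def u_def[abs_def])
  then show ?thesis using False by (simp add: neg_geometric_mean_def x_def y_def)
qed (simp add: neg_geometric_mean_def)

lemma neg_geometric_mean_PSH:
  "neg_geometric_mean i j \<in> PSH (polydisc (0 :: complex ^ 'n) (\<chi> j. 1))"
proof -
  define D where "D = polydisc (0 :: complex ^ 'n) (\<chi> j. 1)"
  have fin: "neg_geometric_mean i j z < \<infinity>" for z :: "complex ^ 'n" by (simp add: neg_geometric_mean_def)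
  have usc: "usc_on D (neg_geometric_mean i j)" unfolding D_def by (rule neg_geometric_mean_usc)
  have "(\<chi> k. 1/2) \<in> D" "neg_geometric_mean i j (\<chi> k. 1/2) \<noteq> -\<infinity>"
    by (auto simp: D_def polydisc_def neg_geometric_mean_def norm_divide)
  moreover have "subharmonic_on {t. a + t *s w \<in> D} (\<lambda>t. neg_geometric_mean i j (a + t *s w))" for a w
    unfolding subharmonic_on_def
  proof (intro conjI ballI allI impI fin)
    show "usc_on {t. a + t *s w \<in> D} (\<lambda>t. neg_geometric_mean i j (a + t *s w))"
      by (intro usc_on_compose[OF usc] continuous_intros) auto
    fix b r assume br: "0 < r \<and> cball b r \<subseteq> {t. a + t *s w \<in> D}"
    \<comment> \<open>An affine substitution in the parameter of the line carries the disc of centre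
      \<open>b\<close> and radius \<open>r\<close> to the unit disc.\<close>
    have "(a + b *s w) + t *s (of_real r *s w) \<in> D" if "cmod t \<le> 1" for t
    proof -
      have "b + of_real r * t \<in> cball b r"
        using that br by (simp add: dist_norm norm_mult mult_left_le)
      then show ?thesis using br by (auto simp: vector_smult_assoc vector_sadd_rdistrib algebra_simps)
    qed
    then have "neg_geometric_mean i j (a + b *s w)
        \<le> circle_mean (\<lambda>t. neg_geometric_mean i j ((a + b *s w) + t *s (of_real r *s w))) 0 1"
      unfolding D_def by (rule neg_geometric_mean_sub_mean)
    also have "\<dots> = circle_mean (\<lambda>t. neg_geometric_mean i j (a + t *s w)) b r"
      unfolding circle_mean_def by (simp add: vector_smult_assoc vector_sadd_rdistrib algebra_simps)
    finally show "neg_geometric_mean i j (a + b *s w) \<le> circle_mean (\<lambda>t. neg_geometric_mean i j (a + t *s w)) b r" .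
  qed
  ultimately show ?thesis using usc fin unfolding PSH_def D_def by blast
qed

text \<open>The mean lies on one side of the midpoint of \<open>x\<close> and \<open>y\<close>, so
  the deviation from it is at least \<open>(x - y) / 2\<close> on all of \<open>A\<close> or on all
  of \<open>B\<close>; this holds whatever the mean is, even infinite.\<close>

lemma MO_ge:
  assumes A: "A \<in> sets borel" "A \<subseteq> S" "\<And>z. z \<in> A \<Longrightarrow> ereal x \<le> \<phi> z"
    and B: "B \<in> sets borel" "B \<subseteq> S" "\<And>z. z \<in> B \<Longrightarrow> \<phi> z \<le> ereal y"
    and k: "k * emeasure lborel S \<le> emeasure lborel A" "k * emeasure lborel S \<le> emeasure lborel B"
    and S: "S \<in> sets borel" "emeasure lborel S \<noteq> 0" "emeasure lborel S < \<infinity>"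
  shows "k * ennreal ((x - y) / 2) \<le> MO S \<phi>"
proof -
  define c where "c = avg S \<phi>"
  have low: "k * ennreal ((x - y) / 2) \<le> MO S \<phi>"
    if E: "E \<in> sets borel" "E \<subseteq> S" "k * emeasure lborel S \<le> emeasure lborel E"
      and le: "\<And>z. z \<in> E \<Longrightarrow> ereal ((x - y) / 2) \<le> \<bar>\<phi> z - c\<bar>" for E
  proof -
    have "k * ennreal ((x - y) / 2) * emeasure lborel S \<le> ennreal ((x - y) / 2) * emeasure lborel E"
      using mult_left_mono[OF E(3), of "ennreal ((x - y) / 2)"] by (simp add: mult_ac)
    also have "\<dots> = (\<integral>\<^sup>+z. ennreal ((x - y) / 2) * indicator E z \<partial>lborel)"
      using E(1) by (subst nn_integral_cmult_indicator) auto
    also have "\<dots> \<le> (\<integral>\<^sup>+z\<in>S. e2ennreal \<bar>\<phi> z - c\<bar> \<partial>lborel)"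
      using E(2) le by (intro nn_integral_mono) (auto simp: indicator_def simp flip: e2ennreal_ereal intro!: e2ennreal_mono)
    finally have "k * ennreal ((x - y) / 2) * emeasure lborel S / emeasure lborel S
        \<le> (\<integral>\<^sup>+z\<in>S. e2ennreal \<bar>\<phi> z - c\<bar> \<partial>lborel) / emeasure lborel S"
      by (rule divide_right_mono_ennreal)
    then show ?thesis
      using S by (simp add: MO_def c_def nn_integral_completion ennreal_mult_divide_eq)
  qed
  show ?thesis
  proof (cases "c \<le> ereal ((x + y) / 2)")
    case True
    have "ereal ((x - y) / 2) \<le> \<bar>\<phi> z - c\<bar>" if "z \<in> A" for z
      using A(3)[OF that] True by (cases "\<phi> z"; cases c) (auto simp: field_simps abs_if)
    then show ?thesis by (rule low[OF A(1,2) k(1)])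
  next
    case False
    have "ereal ((x - y) / 2) \<le> \<bar>\<phi> z - c\<bar>" if "z \<in> B" for z
      using B(3)[OF that] False by (cases "\<phi> z"; cases c) (auto simp: field_simps abs_if)
    then show ?thesis by (rule low[OF B(1,2) k(2)])
  qed
qed

lemma closed_polydisc_relatively_compact:
  assumes "closed_polydisc a r \<subseteq> \<Omega>"
  shows "polydisc a r \<subset>\<subset> \<Omega>"
proof -
  have "compact (closure (polydisc a r))"
    using closure_polydisc_subset[of a r] compact_closed_polydisc[of a r]
    by (meson bounded_closure bounded_subset closed_closure compact_eq_bounded_closed compact_imp_bounded)
  then show ?thesis
    using closure_polydisc_subset[of a r] assms by (auto simp: relatively_compact_in_def)
qed

text \<open>Two small homothetic copies of the polydisc are compared. On \<open>A\<close> the moduli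
  of coordinates \<open>i\<close> and \<open>j\<close> are comparable to their radii; on
  \<open>B\<close> the modulus of \<open>z_i\<close> is tiny, while \<open>- ln |z_j|\<close> is
  still at least \<open>T\<close>. The values differ by at least \<open>sqrt T\<close>.\<close>

lemma neg_geometric_mean_MO_ge:
  fixes i j :: "'n :: finite"
  assumes ij: "i \<noteq> j" and T: "1 \<le> T"
  defines "r \<equiv> \<chi> k. if k = j then exp (- T) else (1/2 :: real)"
  shows "ennreal ((1 / 2^15) ^ (2 * CARD('n))) * ennreal (sqrt T / 2)
    \<le> MO (polydisc (0 :: complex ^ 'n) r) (neg_geometric_mean i j)"
proof -
  define S where "S = polydisc (0 :: complex ^ 'n) r"
  \<comment> \<open>\<open>k * r_i = 2^(-16)\<close> gives \<open>- ln |z_i| \<ge> 16 * ln 2\<close>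
    on \<open>B\<close>; the exponent is chosen so that
    \<open>(16 * ln 2) * T = (2 * q)^2\<close>.\<close>
  define k :: real where "k = 1 / 2^15"
  \<comment> \<open>Coordinates \<open>i\<close> and \<open>j\<close> of the centre sit at 3/4 of
    their radii; as \<open>k \<le> 1/16\<close>, on \<open>A\<close> these moduli stay between half
    the radius and the radius.\<close>
  define ctr :: "complex ^ 'n" where
    "ctr = (\<chi> l. if l = i then 3/8 else if l = j then of_real (3/4 * exp (- T)) else 0)"
  define A where "A = polydisc ctr (k *\<^sub>R r)"
  define B where "B = polydisc (0 :: complex ^ 'n) (k *\<^sub>R r)"
  have r: "0 < r $ l" for l by (simp add: r_def)
  have k: "0 < k" "k \<le> 1/16" by (simp_all add: k_def)
  have ri: "r $ i = 1/2" and rj: "r $ j = exp (- T)" using ij by (simp_all add: r_def)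
  have meas: "emeasure lborel (polydisc b (k *\<^sub>R r)) = ennreal (k ^ (2 * CARD('n))) * emeasure lborel S" for b
    unfolding S_def by (rule emeasure_polydisc_scale) (rule k)
  have eT: "exp (- T) < 1/2"
  proof -
    have "exp (- T) < exp (- ln 2)" using T ln2_le_25_over_36 by simp
    then show ?thesis by (simp add: exp_minus)
  qed
  have kr: "k * r $ l \<le> r $ l / 16" for l
    using mult_right_mono[OF k(2), of "r $ l"] r[of l] by simp
  have BS: "B \<subseteq> S"
  proof
    fix z assume z: "z \<in> B"
    have "cmod (z $ l) < r $ l" for l
    proof -
      have "cmod (z $ l) < k * r $ l" using z by (simp add: B_def polydisc_def)
      then show ?thesis using kr[of l] r[of l] by linarith
    qed
    then show "z \<in> S" by (simp add: S_def polydisc_def)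
  qed
  have A_bounds: "cmod (z $ i) < r $ i" "r $ i / 2 < cmod (z $ i)" "cmod (z $ j) < r $ j" "r $ j / 2 < cmod (z $ j)"
    "cmod (z $ l) < r $ l" if z: "z \<in> A" for z l
  proof -
    have z': "cmod (z $ l - ctr $ l) < r $ l / 16" for l
    proof -
      have "cmod (z $ l - ctr $ l) < k * r $ l" using z by (simp add: A_def polydisc_def)
      then show ?thesis using kr[of l] by linarith
    qed
    have *: "cmod (z $ l) < r $ l" "r $ l / 2 < cmod (z $ l)" if "l = i \<or> l = j" for l
    proof -
      have c: "cmod (ctr $ l) = 3/4 * r $ l"
        using that ij by (auto simp: ctr_def r_def norm_mult)
      show "cmod (z $ l) < r $ l" "r $ l / 2 < cmod (z $ l)"
        using z'[of l] c norm_triangle_ineq3[of "z $ l" "ctr $ l"] r[of l] by linarith+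
    qed
    show "cmod (z $ i) < r $ i" "r $ i / 2 < cmod (z $ i)" "cmod (z $ j) < r $ j" "r $ j / 2 < cmod (z $ j)"
      using * by auto
    show "cmod (z $ l) < r $ l"
    proof (cases "l = i \<or> l = j")
      case False
      then show ?thesis using z'[of l] r[of l] by (simp add: ctr_def)
    qed (rule *)
  qed
  then have AS: "A \<subseteq> S" by (auto simp: S_def polydisc_def)
  define L where "L = ln (2::real)"
  have L: "0 < L" "L \<le> 1" "1/2 \<le> L" using ln2_le_25_over_36 ln2_ge_two_thirds by (simp_all add: L_def)
  \<comment> \<open>On \<open>A\<close>, \<open>|z_i| > 1/4\<close> and
    \<open>|z_j| > exp (-T) / 2\<close> bound the two negative logarithms by \<open>2 * L\<close>
    and \<open>T + L \<le> 2 * T\<close>.\<close>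
  define q where "q = sqrt ((2 * L) * (2 * T))"
  have "ennreal (k ^ (2 * CARD('n))) * ennreal ((- q - (- (2 * q))) / 2) \<le> MO S (neg_geometric_mean i j)"
  proof (rule MO_ge)
    show "A \<in> sets borel" "B \<in> sets borel" "S \<in> sets borel" by (simp_all add: A_def B_def S_def)
    show "A \<subseteq> S" "B \<subseteq> S" by fact+
    show "emeasure lborel S \<noteq> 0" unfolding S_def using r by (rule emeasure_polydisc_pos)
    show "emeasure lborel S < \<infinity>" unfolding S_def by (rule emeasure_polydisc_finite)
    show "ennreal (k ^ (2 * CARD('n))) * emeasure lborel S \<le> emeasure lborel A"
      "ennreal (k ^ (2 * CARD('n))) * emeasure lborel S \<le> emeasure lborel B"
      by (simp_all add: A_def B_def meas)
    show "ereal (- q) \<le> neg_geometric_mean i j z" if z: "z \<in> A" for z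
    proof -
      note b = A_bounds[OF z]
      have nz: "z $ i \<noteq> 0" "z $ j \<noteq> 0" using b r[of i] r[of j] by auto
      have "- ln (cmod (z $ i)) \<le> 2 * L"
      proof -
        have "ln (1/4) \<le> ln (cmod (z $ i))" using b(2) by (intro ln_mono) (auto simp: ri)
        moreover have "ln (1/4 :: real) = - (2 * L)"
          using ln_realpow[of "2::real" 2] by (simp add: L_def ln_div)
        ultimately show ?thesis by simp
      qed
      moreover have "- ln (cmod (z $ j)) \<le> 2 * T"
      proof -
        have "ln (exp (- T) / 2) \<le> ln (cmod (z $ j))" using b(4) by (intro ln_mono) (auto simp: rj)
        then show ?thesis using L T by (simp add: ln_div L_def[symmetric])
      qed
      moreover have "0 \<le> - ln (cmod (z $ i))" "0 \<le> - ln (cmod (z $ j))"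
        using b nz ri rj eT by (auto intro!: less_imp_le)
      ultimately have "(- ln (cmod (z $ i))) * (- ln (cmod (z $ j))) \<le> (2 * L) * (2 * T)"
        using L by (intro mult_mono) auto
      then have "sqrt (ln (cmod (z $ i)) * ln (cmod (z $ j))) \<le> q" by (simp add: q_def)
      then show ?thesis using nz by (simp add: neg_geometric_mean_def)
    qed
    show "neg_geometric_mean i j z \<le> ereal (- (2 * q))" if z: "z \<in> B" for z
    proof (cases "z $ i = 0 \<or> z $ j = 0")
      case False
      have "cmod (z $ i) < k * r $ i" "cmod (z $ j) < k * r $ j"
        using z by (simp_all add: B_def polydisc_def)
      then have zi: "cmod (z $ i) \<le> 1 / 2^16" and zj: "cmod (z $ j) \<le> r $ j"
        using kr[of j] r[of j] by (simp_all add: ri k_def)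
      have "ln (cmod (z $ i)) \<le> ln (1 / 2^16)" using zi False by (intro ln_mono) auto
      also have "\<dots> = - (16 * L)" using ln_realpow[of "2::real" 16] by (simp add: L_def ln_div)
      finally have "16 * L \<le> - ln (cmod (z $ i))" by simp
      moreover have "ln (cmod (z $ j)) \<le> ln (exp (- T))" using zj False unfolding rj by (intro ln_mono) auto
      then have "T \<le> - ln (cmod (z $ j))" by simp
      ultimately have "(16 * L) * T \<le> (- ln (cmod (z $ i))) * (- ln (cmod (z $ j)))"
        using L T by (intro mult_mono) auto
      then have "sqrt ((2^2) * ((2 * L) * (2 * T))) \<le> sqrt (ln (cmod (z $ i)) * ln (cmod (z $ j)))"
        by (intro real_sqrt_le_mono) simp
      then have "2 * q \<le> sqrt (ln (cmod (z $ i)) * ln (cmod (z $ j)))"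
        by (simp add: q_def real_sqrt_mult)
      then show ?thesis using False by (simp add: neg_geometric_mean_def)
    qed (simp add: neg_geometric_mean_def)
  qed
  moreover have "sqrt T \<le> q"
  proof -
    have "1 * T \<le> (4 * L) * T" using L T by (intro mult_right_mono) auto
    then show ?thesis by (simp add: q_def)
  qed
  then have "ennreal (sqrt T / 2) \<le> ennreal ((- q - (- (2 * q))) / 2)" by (intro ennreal_leI) simp
  ultimately show ?thesis
    unfolding k_def[symmetric] S_def[symmetric] by (meson mult_left_mono order_trans zero_le)
qed

lemma neg_geometric_mean_not_BMO_loc:
  fixes i j :: "'n :: finite"
  assumes ij: "i \<noteq> j"
  defines "D \<equiv> polydisc (0 :: complex ^ 'n) (\<chi> k. 1)"
  shows "neg_geometric_mean i j \<notin> BMO_loc D (polydiscs D)"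
proof
  assume BMO: "neg_geometric_mean i j \<in> BMO_loc D (polydiscs D)"
  \<comment> \<open>Radius 3/4 leaves room for the test polydiscs, of radii at most 1/2, inside
    \<Omega>, and for \<Omega> inside \<open>D\<close>.\<close>
  define \<Omega> where "\<Omega> = polydisc (0 :: complex ^ 'n) (\<chi> k. 3/4)"
  have "\<Omega> \<subset>\<subset> D"
    unfolding \<Omega>_def D_def
  proof (intro closed_polydisc_relatively_compact subsetI)
    fix z :: "complex ^ 'n" assume "z \<in> closed_polydisc 0 (\<chi> k. 3/4)"
    then have "cmod (z $ k) \<le> 3/4" for k by (simp add: closed_polydisc_def)
    then have "cmod (z $ k) < 1" for k using order_le_less_trans[of "cmod (z $ k)" "3/4" 1] by simp
    then show "z \<in> polydisc 0 (\<chi> k. 1)" by (simp add: polydisc_def)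
  qed
  then have "neg_geometric_mean i j \<in> BMO \<Omega> {S \<in> polydiscs D. S \<subset>\<subset> \<Omega>}"
    using BMO by (simp add: BMO_loc_def \<Omega>_def open_polydisc)
  then have fin: "(SUP S\<in>{S \<in> polydiscs D. S \<subset>\<subset> \<Omega>}. MO S (neg_geometric_mean i j)) < \<infinity>"
    by (simp add: BMO_def)
  then obtain K where K: "(SUP S\<in>{S \<in> polydiscs D. S \<subset>\<subset> \<Omega>}. MO S (neg_geometric_mean i j)) = ennreal K" "0 \<le> K"
    by (cases "SUP S\<in>{S \<in> polydiscs D. S \<subset>\<subset> \<Omega>}. MO S (neg_geometric_mean i j)") auto
  define c :: real where "c = (1 / 2^15) ^ (2 * CARD('n))"
  have c: "0 < c" by (simp add: c_def)
  have le: "c * (sqrt T / 2) \<le> K" if T: "1 \<le> T" for T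
  proof -
    define r :: "real ^ 'n" where "r = (\<chi> k. if k = j then exp (- T) else 1/2)"
    have "exp (- T) \<le> exp (- ln 2 :: real)" using T ln2_le_25_over_36 by simp
    then have r: "0 < r $ k" "r $ k \<le> 1/2" for k by (auto simp: r_def exp_minus)
    have "closed_polydisc 0 r \<subseteq> \<Omega>"
    proof
      fix z assume "z \<in> closed_polydisc 0 r"
      then have "cmod (z $ k) < 3/4" for k
        using r(2)[of k] by (auto simp: closed_polydisc_def dest!: spec[of _ k])
      then show "z \<in> \<Omega>" by (simp add: \<Omega>_def polydisc_def)
    qed
    moreover have "\<Omega> \<subseteq> D"
    proof
      fix z assume "z \<in> \<Omega>"
      then have "cmod (z $ k) < 3/4" for k by (simp add: \<Omega>_def polydisc_def)
      then have "cmod (z $ k) < 1" for k using less_trans[of "cmod (z $ k)" "3/4" 1] by simp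
      then show "z \<in> D" by (simp add: D_def polydisc_def)
    qed
    ultimately have "polydisc 0 r \<in> {S \<in> polydiscs D. S \<subset>\<subset> \<Omega>}"
      using r(1) unfolding polydiscs_def by (blast intro: closed_polydisc_relatively_compact)
    then have "MO (polydisc 0 r) (neg_geometric_mean i j) \<le> ennreal K"
      unfolding K(1)[symmetric] by (rule SUP_upper)
    moreover have "ennreal c * ennreal (sqrt T / 2) \<le> MO (polydisc 0 r) (neg_geometric_mean i j)"
      unfolding c_def r_def by (rule neg_geometric_mean_MO_ge[OF ij T])
    ultimately have "ennreal (c * (sqrt T / 2)) \<le> ennreal K"
      using c T by (subst ennreal_mult) auto
    then show ?thesis using K(2) by simp
  qed
  \<comment> \<open>At \<open>T = t^2\<close> the bound reads \<open>c * t \<le> 2 * K\<close>,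
    whereas \<open>c * t = c + 2 * K\<close>.\<close>
  define t where "t = 1 + 2 * K / c"
  have "0 \<le> 2 * K / c" using K(2) c by simp
  then have "1 \<le> t" by (simp add: t_def)
  then have "c * (sqrt (t^2) / 2) \<le> K" by (intro le one_le_power)
  then have "c * t \<le> 2 * K" using \<open>1 \<le> t\<close> by simp
  moreover have "c * t = c + 2 * K" using c by (simp add: t_def field_simps)
  ultimately show False using c by simp
qed

theorem theorem1p1:
  shows "(\<forall>(\<Omega> :: (complex ^ 'n) set) N :: real. is_domain \<Omega> \<and> N > 0 \<longrightarrow>
            PSH \<Omega> \<subseteq> BUO_loc \<Omega> (polydiscs_type N \<Omega>) \<and>
            BUO_loc \<Omega> (polydiscs_type N \<Omega>) \<subseteq> BMO_loc \<Omega> (polydiscs_type N \<Omega>))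
       \<and> (CARD('n) \<ge> 2 \<longrightarrow>
            (let D = polydisc (0 :: complex ^ 'n) (\<chi> j. 1)
             in \<not> PSH D \<subseteq> BMO_loc D (polydiscs D)))
       \<and> (Lelong_class :: (complex ^ 'n \<Rightarrow> ereal) set) \<subseteq> BUO UNIV (polydiscs UNIV)
       \<and> (\<forall>\<phi> \<in> PSH (UNIV :: (complex ^ 'n) set).
            (\<exists>c :: real. \<forall>z. \<phi> z \<le> ereal (c + (MAX j. ln (1 + cmod (z $ j))))) \<longrightarrow>
            (\<forall>P \<in> polydiscs UNIV. UO P \<phi> < 3 ^ CARD('n)))"
proof (intro conjI allI impI ballI)
  fix \<Omega> :: "(complex ^ 'n) set" and N :: real
  assume "is_domain \<Omega> \<and> N > 0"
  then show "PSH \<Omega> \<subseteq> BUO_loc \<Omega> (polydiscs_type N \<Omega>)" by (intro PSH_subset_BUO_loc) auto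
  show "BUO_loc \<Omega> (polydiscs_type N \<Omega>) \<subseteq> BMO_loc \<Omega> (polydiscs_type N \<Omega>)"
    by (rule BUO_loc_subset_BMO_loc[OF polydiscs_type_subset_polydiscs])
next
  assume "CARD('n) \<ge> 2"
  then obtain i j :: 'n where "i \<noteq> j"
    using card_2_iff'[of "UNIV :: 'n set"] by (metis One_nat_def Suc_1 UNIV_I card_le_Suc0_iff_eq finite not_less_eq_eq)
  then show "let D = polydisc (0 :: complex ^ 'n) (\<chi> j. 1) in \<not> PSH D \<subseteq> BMO_loc D (polydiscs D)"
    unfolding Let_def using neg_geometric_mean_PSH neg_geometric_mean_not_BMO_loc by blast
next
  show "(Lelong_class :: (complex ^ 'n \<Rightarrow> ereal) set) \<subseteq> BUO UNIV (polydiscs UNIV)"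
    by (rule Lelong_class_subset_BUO)
next
  fix \<phi> :: "complex ^ 'n \<Rightarrow> ereal" and P :: "(complex ^ 'n) set"
  assume \<phi>: "\<phi> \<in> PSH UNIV" and P: "P \<in> polydiscs UNIV"
    and "\<exists>c :: real. \<forall>z. \<phi> z \<le> ereal (c + (MAX j. ln (1 + cmod (z $ j))))"
  then obtain c where c: "\<And>z. \<phi> z \<le> ereal (c + (MAX j. ln (1 + cmod (z $ j))))" by blast
  obtain a and r :: "real ^ 'n" where "P = polydisc a r" "\<And>j. 0 < r $ j"
    using P by (auto simp: polydiscs_def)
  then show "UO P \<phi> < 3 ^ CARD('n)" using PSH_log_growth_UO_less[OF \<phi> _ c] by simp
qed

end
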